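(* Let $0<d<n$ be integers. Let $C\ge 1$ and $E\subset\mathbb{R}^n$ be $C$-Ahlfors regular with dimension $d$. Assume that there are $\theta>0$, $C_1\ge1$, and $\gamma_1:(0,1)\to(0,+\infty)$ such that for each $p\in E$, $r>0$, there is $\widetilde{E}\subset\mathbb{R}^n$ with the following properties: (1) $\widetilde{E}$ is $C_1$-Ahlfors regular with dimension $d$; (2) for each $\epsilon\in(0,1)$ the set $\{(q,s)\in\widetilde{E}\times(0,+\infty): b\beta_{\widetilde{E}}(q,s)>\epsilon\}$ is $\gamma_1(\epsilon)$-Carleson; (3) $$\mathcal{H}^d(E\cap\widetilde{E}\cap B(p,r))\ge\theta r^d.$$ Then $E$ satisfies the bilateral weak geometric lemma. More precisely, for each $\epsilon\in(0,1)$ the set $\{(p,s)\in E\times(0,+\infty): b\beta_E(p,s)>\epsilon\}$ is $\gamma(\epsilon)$-Carleson for some function $\gamma:(0,1)\to(0,+\infty)$ depending only on $C$, $\theta$, $C_1$ and $\gamma_1$ (the integers $d,n$ being fixed).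
   Context: $\mathbb{R}^n$ carries the Euclidean distance; $B(p,r)$ is the open Euclidean ball, $\mathcal{H}^d$ the $d$-dimensional Hausdorff measure, $\operatorname{dist}$ the Euclidean distance to a set. A set $E\subset\mathbb{R}^n$ is $C$-Ahlfors regular with dimension $d$ if it is closed and $C^{-1}r^d\le\mathcal{H}^d(E\cap B(p,r))\le Cr^d$ for all $p\in E$, $r>0$. For such $E$ and $\gamma_0>0$, a $\gamma_0$-Carleson set is a measurable set $A\subset E\times(0,+\infty)$ with $\int_0^r\int_{E\cap B(p,r)}\chi_A(q,s)\,d\mathcal{H}^d(q)\,\frac{ds}{s}\le\gamma_0 r^d$ for all $p\in E$, $r>0$. For $p\in E$, $s>0$, $$b\beta_E(p,s)=s^{-1}\inf_{P}\Big\{\sup_{q\in B(p,s)\cap E}\operatorname{dist}(q,P)+\sup_{q\in B(p,s)\cap P}\operatorname{dist}(q,E)\Big\},$$ where the infimum is over all affine $d$-planes $P\subset\mathbb{R}^n$ and the supremum over the empty set is $0$. $E$ satisfies the bilateral weak geometric lemma if it is Ahlfors regular with dimension $d$ and there is $\gamma:(0,1)\to(0,+\infty)$ such that for each $\epsilon\in(0,1)$ the set $\{(p,s)\in E\times(0,+\infty): b\beta_E(p,s)>\epsilon\}$ is $\gamma(\epsilon)$-Carleson. *)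

theory Defs
  imports "HOL-Analysis.Analysis"
begin

section \<open>Hausdorff measure\<close>

text \<open>
  The weight is normalised so that the \<open>d\<close>-dimensional Hausdorff measure of a \<open>d\<close>-dimensional
  unit ball is \<open>unit_ball_vol d\<close>. The empty set is singled out because \<open>0 ^ 0 = 1\<close>.
\<close>

definition hausdorff_weight :: "nat \<Rightarrow> 'a::metric_space set \<Rightarrow> ennreal" where
  "hausdorff_weight d U =
     (if U = {} then 0 else ennreal (unit_ball_vol (real d) * (diameter U / 2) ^ d))"

text \<open>Boundedness is required separately since \<^const>\<open>diameter\<close> is junk on unbounded sets.\<close>

definition hausdorff_covers :: "real \<Rightarrow> 'a::metric_space set \<Rightarrow> (nat \<Rightarrow> 'a set) set" where
  "hausdorff_covers \<delta> A =
     {U. A \<subseteq> (\<Union>i. U i) \<and> (\<forall>i. bounded (U i) \<and> diameter (U i) \<le> \<delta>)}"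

definition hausdorff_premeasure :: "nat \<Rightarrow> real \<Rightarrow> 'a::metric_space set \<Rightarrow> ennreal" where
  "hausdorff_premeasure d \<delta> A = (INF U\<in>hausdorff_covers \<delta> A. \<Sum>i. hausdorff_weight d (U i))"

definition hausdorff_outer :: "nat \<Rightarrow> 'a::metric_space set \<Rightarrow> ennreal" where
  "hausdorff_outer d A = (SUP \<delta>\<in>{0<..}. hausdorff_premeasure d \<delta> A)"

text \<open>
  As a measure, restricted to the Borel sets. That \<^const>\<open>hausdorff_outer\<close> really is a measure
  there (so that \<^const>\<open>measure_of\<close> is not degenerate) is \<open>emeasure_hausdorff_measure\<close> below.
\<close>

definition hausdorff_measure :: "nat \<Rightarrow> 'a::metric_space measure" where
  "hausdorff_measure d = measure_of UNIV (sets borel) (hausdorff_outer d)"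

lemma hausdorff_weight_empty [simp]: "hausdorff_weight d {} = 0"
  by (simp add: hausdorff_weight_def)

lemma hausdorff_premeasure_mono:
  "A \<subseteq> B \<Longrightarrow> hausdorff_premeasure d \<delta> A \<le> hausdorff_premeasure d \<delta> B"
  unfolding hausdorff_premeasure_def
  by (rule INF_superset_mono) (auto simp: hausdorff_covers_def)

lemma hausdorff_premeasure_antimono:
  "\<delta> \<le> \<delta>' \<Longrightarrow> hausdorff_premeasure d \<delta>' A \<le> hausdorff_premeasure d \<delta> A"
  unfolding hausdorff_premeasure_def
  by (rule INF_superset_mono) (auto simp: hausdorff_covers_def intro: order_trans)

lemma hausdorff_premeasure_empty: 
  assumes "0 < \<delta>" shows "hausdorff_premeasure d \<delta> {} = 0"
proof -
  have "(\<lambda>_. {}) \<in> hausdorff_covers \<delta> ({} :: 'a set)"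
    using assms by (auto simp: hausdorff_covers_def)
  then have "hausdorff_premeasure d \<delta> ({} :: 'a set) \<le> (\<Sum>i::nat. hausdorff_weight d ({} :: 'a set))"
    unfolding hausdorff_premeasure_def by (rule INF_lower)
  then show ?thesis by simp
qed

lemma hausdorff_premeasure_subadd:
  "hausdorff_premeasure d \<delta> (\<Union>i::nat. A i) \<le> (\<Sum>i. hausdorff_premeasure d \<delta> (A i))"
proof (rule ennreal_le_epsilon)
  fix e :: real
  assume fin: "(\<Sum>i. hausdorff_premeasure d \<delta> (A i)) < top" and e: "0 < e"
  have lt: "hausdorff_premeasure d \<delta> (A i) < top" for i
    using ennreal_suminf_lessD[OF fin] by simp
  have "\<exists>U\<in>hausdorff_covers \<delta> (A i). (\<Sum>k. hausdorff_weight d (U k))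
          \<le> hausdorff_premeasure d \<delta> (A i) + ennreal (e * (1/2)^Suc i)" for i
  proof -
    have "hausdorff_premeasure d \<delta> (A i) < hausdorff_premeasure d \<delta> (A i) + ennreal (e * (1/2)^Suc i)"
      using lt[of i] e ennreal_add_left_cancel_less[of _ 0] by auto
    then obtain U where "U \<in> hausdorff_covers \<delta> (A i)"
      "(\<Sum>k. hausdorff_weight d (U k)) < hausdorff_premeasure d \<delta> (A i) + ennreal (e * (1/2)^Suc i)"
      unfolding hausdorff_premeasure_def INF_less_iff by blast
    then show ?thesis by (meson less_imp_le)
  qed
  then obtain U where U: "\<And>i. U i \<in> hausdorff_covers \<delta> (A i)"
    and Ule: "\<And>i. (\<Sum>k. hausdorff_weight d (U i k))
          \<le> hausdorff_premeasure d \<delta> (A i) + ennreal (e * (1/2)^Suc i)"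
    by metis
  define V where "V = (\<lambda>n. case prod_decode n of (i, k) \<Rightarrow> U i k)"
  have V: "V \<in> hausdorff_covers \<delta> (\<Union>i. A i)"
  proof -
    have "x \<in> (\<Union>n. V n)" if xA: "x \<in> A i" for x i
    proof -
      have "A i \<subseteq> (\<Union>k. U i k)" using U[of i] by (simp add: hausdorff_covers_def)
      then obtain k where "x \<in> U i k" using xA by blast
      then have "x \<in> V (prod_encode (i, k))" by (simp add: V_def)
      then show ?thesis by blast
    qed
    moreover have "bounded (V n) \<and> diameter (V n) \<le> \<delta>" for n
      using U by (auto simp: V_def hausdorff_covers_def split: prod.split)
    ultimately show ?thesis by (auto simp: hausdorff_covers_def)
  qed
  have "hausdorff_premeasure d \<delta> (\<Union>i. A i) \<le> (\<Sum>n. hausdorff_weight d (V n))"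
    unfolding hausdorff_premeasure_def by (rule INF_lower[OF V])
  also have "\<dots> = (\<Sum>i. \<Sum>k. hausdorff_weight d (U i k))"
    using suminf_ennreal_2dimen[of "\<lambda>i. \<Sum>k. hausdorff_weight d (U i k)"
        "\<lambda>(i, k). hausdorff_weight d (U i k)"]
    by (simp add: V_def split_def)
  also have "\<dots> \<le> (\<Sum>i. hausdorff_premeasure d \<delta> (A i) + ennreal (e * (1/2)^Suc i))"
    by (intro suminf_le Ule) auto
  also have "\<dots> = (\<Sum>i. hausdorff_premeasure d \<delta> (A i)) + (\<Sum>i. ennreal (e * (1/2)^Suc i))"
    by (rule suminf_add[symmetric]) auto
  also have "(\<Sum>i. ennreal (e * (1/2)^Suc i)) = ennreal e"
    using sums_mult[OF power_half_series, of e] e by (intro suminf_ennreal_eq) auto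
  finally show "hausdorff_premeasure d \<delta> (\<Union>i. A i)
                  \<le> (\<Sum>i. hausdorff_premeasure d \<delta> (A i)) + ennreal e" .
qed

lemma hausdorff_premeasure_le_outer:
  "0 < \<delta> \<Longrightarrow> hausdorff_premeasure d \<delta> A \<le> hausdorff_outer d A"
  unfolding hausdorff_outer_def by (rule SUP_upper) simp

lemma outer_measure_space_hausdorff_outer:
  "outer_measure_space UNIV (hausdorff_outer d :: 'a::metric_space set \<Rightarrow> ennreal)"
proof -
  have "(SUP \<delta>\<in>{0<..}. hausdorff_premeasure d \<delta> ({}::'a set)) = (SUP \<delta>\<in>{0::real<..}. 0)"
    by (rule SUP_cong) (auto simp: hausdorff_premeasure_empty)
  then have "positive UNIV (hausdorff_outer d :: 'a set \<Rightarrow> ennreal)"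
    by (simp add: positive_def hausdorff_outer_def)
  moreover have "increasing UNIV (hausdorff_outer d :: 'a set \<Rightarrow> ennreal)"
    unfolding increasing_def hausdorff_outer_def
    by (intro ballI impI SUP_mono) (blast intro: hausdorff_premeasure_mono)
  moreover have "hausdorff_outer d (\<Union>i::nat. A i) \<le> (\<Sum>i. hausdorff_outer d (A i))"
    for A :: "nat \<Rightarrow> 'a set"
    unfolding hausdorff_outer_def[of d "\<Union>i. A i"]
    by (rule SUP_least, rule order_trans[OF hausdorff_premeasure_subadd])
       (auto intro!: suminf_le hausdorff_premeasure_le_outer)
  then have "countably_subadditive UNIV (hausdorff_outer d :: 'a set \<Rightarrow> ennreal)"
    by (simp add: countably_subadditive_def)
  ultimately show ?thesis by (simp add: outer_measure_space_def)
qed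

lemma hausdorff_outer_empty [simp]: "hausdorff_outer d {} = 0"
  using outer_measure_space_hausdorff_outer
  by (auto simp: outer_measure_space_def positive_def)

lemma hausdorff_outer_mono: "A \<subseteq> B \<Longrightarrow> hausdorff_outer d A \<le> hausdorff_outer d B"
  using outer_measure_space_hausdorff_outer
  by (auto simp: outer_measure_space_def increasing_def)

lemma hausdorff_outer_subadd: "hausdorff_outer d (\<Union>i::nat. A i) \<le> (\<Sum>i. hausdorff_outer d (A i))"
  unfolding hausdorff_outer_def[of d "\<Union>i. A i"]
    by (rule SUP_least, rule order_trans[OF hausdorff_premeasure_subadd])
       (auto intro!: suminf_le hausdorff_premeasure_le_outer)

lemma hausdorff_outer_Un: "hausdorff_outer d (A \<union> B) \<le> hausdorff_outer d A + hausdorff_outer d B"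
proof -
  have eq: "A \<union> B = (\<Union>i::nat. if i = 0 then A else if i = 1 then B else {})" by (auto split: if_splits)
  have "hausdorff_outer d (A \<union> B)
     \<le> (\<Sum>i::nat. hausdorff_outer d (if i = 0 then A else if i = 1 then B else {}))"
    unfolding eq by (rule hausdorff_outer_subadd)
  also have "\<dots> = (\<Sum>i\<in>{0,1::nat}. hausdorff_outer d (if i = 0 then A else if i = 1 then B else {}))"
    by (rule suminf_finite) auto
  finally show ?thesis by simp
qed

lemma hausdorff_outer_separated:
  fixes A B :: "'a::metric_space set"
  assumes \<eta>: "0 < \<eta>" and sep: "\<And>x y. x \<in> A \<Longrightarrow> y \<in> B \<Longrightarrow> \<eta> \<le> dist x y"
  shows "hausdorff_outer d (A \<union> B) = hausdorff_outer d A + hausdorff_outer d B"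
proof (rule antisym[OF hausdorff_outer_Un])
  have pre: "hausdorff_premeasure d \<delta> A + hausdorff_premeasure d \<delta> B
      \<le> hausdorff_premeasure d \<delta> (A \<union> B)" if \<delta>: "0 < \<delta>" "\<delta> < \<eta>" for \<delta>
    unfolding hausdorff_premeasure_def[of d \<delta> "A \<union> B"]
  proof (rule INF_greatest)
    fix U assume U: "U \<in> hausdorff_covers \<delta> (A \<union> B)"
    define V where "V S = (\<lambda>i. if U i \<inter> S \<noteq> {} then U i else {})" for S
    have cov: "V S \<in> hausdorff_covers \<delta> S" if "S \<subseteq> A \<union> B" for S
      using U that \<delta> unfolding hausdorff_covers_def V_def by (fastforce split: if_splits)
    have le: "hausdorff_weight d (V A i) + hausdorff_weight d (V B i) \<le> hausdorff_weight d (U i)" for i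
    proof (cases "U i \<inter> A \<noteq> {} \<and> U i \<inter> B \<noteq> {}")
      case True
      then obtain x y where "x \<in> U i" "x \<in> A" "y \<in> U i" "y \<in> B" by blast
      with U sep[of x y] diameter_bounded_bound[of "U i" x y] \<delta> have False
        by (auto simp: hausdorff_covers_def) (meson leD le_less_trans order.trans)
      then show ?thesis ..
    qed (auto simp: V_def)
    have "hausdorff_premeasure d \<delta> A + hausdorff_premeasure d \<delta> B
        \<le> (\<Sum>i. hausdorff_weight d (V A i)) + (\<Sum>i. hausdorff_weight d (V B i))"
      unfolding hausdorff_premeasure_def by (intro add_mono INF_lower cov) auto
    also have "\<dots> = (\<Sum>i. hausdorff_weight d (V A i) + hausdorff_weight d (V B i))"
      by (rule suminf_add) auto
    also have "\<dots> \<le> (\<Sum>i. hausdorff_weight d (U i))"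
      by (intro suminf_le le) auto
    finally show "hausdorff_premeasure d \<delta> A + hausdorff_premeasure d \<delta> B
        \<le> (\<Sum>i. hausdorff_weight d (U i))" .
  qed
  have "(SUP \<delta>\<in>{0<..}. hausdorff_premeasure d \<delta> A) + (SUP \<delta>\<in>{0<..}. hausdorff_premeasure d \<delta> B)
      = (SUP \<delta>\<in>{0<..}. hausdorff_premeasure d \<delta> A + hausdorff_premeasure d \<delta> B)"
  proof (rule SUP_add_directed_ennreal[symmetric])
    fix i j :: real assume ij: "i \<in> {0<..}" "j \<in> {0<..}"
    show "\<exists>k\<in>{0<..}. hausdorff_premeasure d i A + hausdorff_premeasure d j B
        \<le> hausdorff_premeasure d k A + hausdorff_premeasure d k B"
      using ij by (intro bexI[of _ "min i j"] add_mono hausdorff_premeasure_antimono) auto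
  qed
  also have "\<dots> \<le> hausdorff_outer d (A \<union> B)"
  proof (rule SUP_least)
    fix \<delta> :: real assume "\<delta> \<in> {0<..}"
    define k where "k = min \<delta> (\<eta>/2)"
    have k: "0 < k" "k < \<eta>" "k \<le> \<delta>" using \<open>\<delta> \<in> {0<..}\<close> \<eta> by (auto simp: k_def)
    have "hausdorff_premeasure d \<delta> A + hausdorff_premeasure d \<delta> B
        \<le> hausdorff_premeasure d k A + hausdorff_premeasure d k B"
      by (intro add_mono hausdorff_premeasure_antimono k)
    also have "\<dots> \<le> hausdorff_premeasure d k (A \<union> B)" by (rule pre[OF k(1,2)])
    also have "\<dots> \<le> hausdorff_outer d (A \<union> B)" by (rule hausdorff_premeasure_le_outer[OF k(1)])
    finally show "hausdorff_premeasure d \<delta> A + hausdorff_premeasure d \<delta> B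
        \<le> hausdorff_outer d (A \<union> B)" .
  qed
  finally show "hausdorff_outer d A + hausdorff_outer d B \<le> hausdorff_outer d (A \<union> B)"
    by (simp add: hausdorff_outer_def)
qed

lemma closed_in_lambda_system_hausdorff_outer:
  fixes F :: "'a::metric_space set"
  assumes "closed F"
  shows "F \<in> lambda_system UNIV UNIV (hausdorff_outer d)"
proof (cases "F = {}")
  case True
  then show ?thesis by (simp add: lambda_system_def)
next
  case F: False
  let ?H = "hausdorff_outer d"
  have "?H (F \<inter> a) + ?H ((UNIV - F) \<inter> a) \<le> ?H a" for a
  proof (cases "?H a = top")
    case fin: False
    define R where "R k = {x \<in> a. 1 / real (k+2) \<le> infdist x F \<and> infdist x F < 1 / real (k+1)}" for k :: nat
    define A where "A n = {x \<in> a. 1 / real (n+1) \<le> infdist x F}" for n :: nat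
    have gap: "s - t \<le> dist x y" if "s \<le> infdist x F" "infdist y F \<le> t" for s t x y
      using that infdist_triangle[of x F y] by linarith
    have sums: "(\<Sum>k<m. ?H (R (2*k+b))) = ?H (\<Union>k<m. R (2*k+b))" for m b
    proof (induction m)
      case (Suc m)
      show ?case
      proof (cases "2*m+b = 0")
        case False
        have "?H ((\<Union>k<m. R (2*k+b)) \<union> R (2*m+b)) = ?H (\<Union>k<m. R (2*k+b)) + ?H (R (2*m+b))"
        proof (rule hausdorff_outer_separated)
          show "0 < 1 / real (2*m+b) - 1 / real (2*m+b+1)"
          proof -
            have "0 < real (2*m+b)" using False by linarith
            then have "1 / (real (2*m+b) + 1) < 1 / real (2*m+b)" by (intro divide_strict_left_mono) auto
            then show ?thesis by (simp only: of_nat_add of_nat_1 diff_gt_0_iff_gt)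
          qed
          fix x y assume "x \<in> (\<Union>k<m. R (2*k+b))" and y: "y \<in> R (2*m+b)"
          then obtain k where k: "k < m" "x \<in> R (2*k+b)" by blast
          have "1 / real (2*m+b) \<le> 1 / real (2*k+b+2)"
            using k by (intro divide_left_mono) (auto simp: of_nat_diff)
          also have "\<dots> \<le> infdist x F" using k by (simp add: R_def)
          finally show "1 / real (2*m+b) - 1 / real (2*m+b+1) \<le> dist x y"
            using y by (intro gap) (auto simp: R_def)
        qed
        then show ?thesis using Suc by (simp add: lessThan_Suc Un_commute)
      qed (simp add: lessThan_Suc)
    qed simp
    have half: "(\<Sum>k. ?H (R (2*k+b))) \<le> ?H a" for b
    proof (rule suminf_le_const)
      show "(\<Sum>k<m. ?H (R (2*k+b))) \<le> ?H a" for m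
        unfolding sums by (rule hausdorff_outer_mono) (auto simp: R_def)
    qed simp
    have "(\<Sum>k<n. ?H (R k)) \<le> ?H a + ?H a" for n
    proof -
      have "(\<Sum>k<n. ?H (R k)) \<le> (\<Sum>k<2*n. ?H (R k))"
        by (rule sum_mono2) auto
      also have "\<dots> = (\<Sum>k<n. ?H (R (2*k+0))) + (\<Sum>k<n. ?H (R (2*k+1)))"
        by (induction n) (auto simp: algebra_simps)
      also have "\<dots> \<le> ?H a + ?H a"
        by (intro add_mono order_trans[OF sum_le_suminf half] summableI) auto
      finally show ?thesis .
    qed
    then have "(\<Sum>k. ?H (R k)) \<le> ?H a + ?H a"
      by (intro suminf_le_const) auto
    also have "\<dots> < top" using fin by (simp add: top.not_eq_extremum)
    finally have Rfin: "(\<Sum>k. ?H (R k)) \<noteq> top" by simp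
    have main: "?H (F \<inter> a) + ?H ((UNIV - F) \<inter> a) \<le> ?H a + (\<Sum>k. ?H (R (k+n)))" for n
    proof -
      have "x \<in> A n \<union> (\<Union>k. R (k+n))" if x: "x \<in> (UNIV - F) \<inter> a" for x
      proof (cases "x \<in> A n")
        case False
        have pos: "0 < infdist x F"
          using x F assms by (auto simp: in_closed_iff_infdist_zero infdist_nonneg order_less_le)
        obtain j where j: "1 / real (Suc j) < infdist x F"
          using nat_approx_posE[OF pos] by blast
        define m where "m = (LEAST m. 1 / real (m+1) \<le> infdist x F)"
        have m1: "1 / real (m+1) \<le> infdist x F"
          unfolding m_def by (rule LeastI[of _ j]) (use j in auto)
        have m2: "infdist x F < 1 / real (i+1)" if "i < m" for i
          using not_less_Least[of i "\<lambda>m. 1 / real (m+1) \<le> infdist x F"] that by (auto simp: m_def)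
        have nm: "n < m"
        proof (rule ccontr)
          assume "\<not> n < m"
          then have "1 / real (n+1) \<le> 1 / real (m+1)" by (intro divide_left_mono) auto
          with m1 False x show False by (auto simp: A_def)
        qed
        have "x \<in> R (m - 1)"
          using m1 m2[of "m - 1"] nm x by (auto simp: R_def)
        moreover have "m - 1 = (m - 1 - n) + n" using nm by simp
        ultimately show ?thesis by (metis UN_iff UNIV_I UnCI)
      qed simp
      then have "?H ((UNIV - F) \<inter> a) \<le> ?H (A n \<union> (\<Union>k. R (k+n)))"
        by (intro hausdorff_outer_mono) blast
      also have "\<dots> \<le> ?H (A n) + ?H (\<Union>k. R (k+n))" by (rule hausdorff_outer_Un)
      also have "\<dots> \<le> ?H (A n) + (\<Sum>k. ?H (R (k+n)))"
        by (intro add_left_mono hausdorff_outer_subadd)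
      finally have "?H (F \<inter> a) + ?H ((UNIV - F) \<inter> a)
          \<le> ?H (F \<inter> a) + (?H (A n) + (\<Sum>k. ?H (R (k+n))))" by (rule add_left_mono)
      also have "\<dots> = ?H (A n \<union> (F \<inter> a)) + (\<Sum>k. ?H (R (k+n)))"
      proof -
        have "?H (A n \<union> (F \<inter> a)) = ?H (A n) + ?H (F \<inter> a)"
        proof (rule hausdorff_outer_separated)
          show "1 / real (n+1) \<le> dist x y" if "x \<in> A n" "y \<in> F \<inter> a" for x y
            using gap[of "1 / real (n+1)" x y 0] that by (auto simp: A_def)
        qed simp
        then show ?thesis by (simp add: ac_simps)
      qed
      also have "\<dots> \<le> ?H a + (\<Sum>k. ?H (R (k+n)))"
        by (intro add_right_mono hausdorff_outer_mono) (auto simp: A_def)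
      finally show ?thesis .
    qed
    have tail: "(\<lambda>n. \<Sum>k. ?H (R (k+n))) \<longlonglongrightarrow> 0"
    proof -
      define r where "r k = enn2real (?H (R k))" for k
      have Rk: "?H (R k) < top" for k
        using ennreal_suminf_lessD[of "\<lambda>k. ?H (R k)" top] Rfin by (simp add: top.not_eq_extremum)
      have r: "?H (R k) = ennreal (r k)" "0 \<le> r k" for k
        using Rk[of k] by (auto simp: r_def)
      have sm: "summable r"
        using Rfin r by (intro summable_suminf_not_top) auto
      have "(\<Sum>k. ?H (R (k+n))) = ennreal (\<Sum>k. r (k+n))" for n
        using r summable_ignore_initial_segment[OF sm] by (simp add: suminf_ennreal2)
      moreover have "(\<lambda>n. \<Sum>k. r (k+n)) \<longlonglongrightarrow> 0"
        by (rule suminf_exist_split2[OF sm])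
      ultimately show ?thesis by (simp flip: ennreal_0)
    qed
    have "(\<lambda>n. ?H a + (\<Sum>k. ?H (R (k+n)))) \<longlonglongrightarrow> ?H a + 0"
      by (intro tendsto_add tendsto_const tail)
    then show ?thesis
      using main by (intro LIMSEQ_le_const) auto
  qed simp
  moreover have "?H a \<le> ?H (F \<inter> a) + ?H ((UNIV - F) \<inter> a)" for a
    using hausdorff_outer_Un[of d "F \<inter> a" "(UNIV - F) \<inter> a"]
    by (metis Int_Un_distrib2 Un_Diff_cancel Un_UNIV_right inf_top_left)
  ultimately show ?thesis by (auto simp: lambda_system_def intro!: antisym)
qed

lemma measure_space_hausdorff_outer:
  "measure_space UNIV (sets borel) (hausdorff_outer d :: 'a::metric_space set \<Rightarrow> ennreal)"
proof -
  let ?H = "hausdorff_outer d :: 'a set \<Rightarrow> ennreal"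
  let ?L = "lambda_system UNIV UNIV ?H"
  have ms: "measure_space UNIV ?L ?H"
    using sigma_algebra.caratheodory_lemma[OF _ outer_measure_space_hausdorff_outer]
    by (metis Pow_UNIV sigma_algebra_Pow)
  then have "sigma_algebra UNIV ?L" by (simp add: measure_space_def)
  then have "sigma_sets UNIV (Collect closed) \<subseteq> ?L"
    by (rule sigma_algebra.sigma_sets_subset) (auto intro: closed_in_lambda_system_hausdorff_outer)
  then have "sets (borel :: 'a measure) \<subseteq> ?L"
    by (simp add: borel_eq_closed)
  then show ?thesis
    by (rule measure_down[OF ms, rotated]) (metis sets.sigma_algebra_axioms space_borel)
qed

lemma sets_hausdorff_measure [simp, measurable_cong]: "sets (hausdorff_measure d) = sets borel"
  by (metis hausdorff_measure_def sets.sets_measure_of_eq space_borel)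

lemma space_hausdorff_measure [simp]: "space (hausdorff_measure d) = UNIV"
  by (simp add: hausdorff_measure_def space_measure_of_conv)

lemma emeasure_hausdorff_measure:
  "A \<in> sets borel \<Longrightarrow> emeasure (hausdorff_measure d) A = hausdorff_outer d A"
  unfolding hausdorff_measure_def using measure_space_hausdorff_outer[of d]
  by (intro emeasure_measure_of_sigma) (auto simp: measure_space_def)


section \<open>Ahlfors regularity, Carleson sets and the bilateral weak geometric lemma\<close>

definition ahlfors_regular :: "nat \<Rightarrow> real \<Rightarrow> 'a::euclidean_space set \<Rightarrow> bool" where
  "ahlfors_regular d C E \<longleftrightarrow> closed E \<and>
     (\<forall>p\<in>E. \<forall>r>0.
        ennreal (inverse C * r ^ d) \<le> emeasure (hausdorff_measure d) (E \<inter> ball p r) \<and>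
        emeasure (hausdorff_measure d) (E \<inter> ball p r) \<le> ennreal (C * r ^ d))"

text \<open>Measurability of a subset of \<open>E \<times> {0<..}\<close> is read as Borel measurability.\<close>

definition carleson_set ::
    "nat \<Rightarrow> real \<Rightarrow> 'a::euclidean_space set \<Rightarrow> ('a \<times> real) set \<Rightarrow> bool" where
  "carleson_set d \<gamma>\<^sub>0 E A \<longleftrightarrow> A \<subseteq> E \<times> {0<..} \<and> A \<in> sets borel \<and>
     (\<forall>p\<in>E. \<forall>r>0.
        (\<integral>\<^sup>+s\<in>{0<..<r}. (\<integral>\<^sup>+q\<in>E \<inter> ball p r. indicator A (q, s) \<partial>hausdorff_measure d) / ennreal s
           \<partial>lborel) \<le> ennreal (\<gamma>\<^sub>0 * r ^ d))"

text \<open>The largest distance of a point of \<open>X\<close> to \<open>Y\<close>, with the supremum over \<open>{}\<close> being \<open>0\<close>.\<close>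

definition sup_dist :: "'a::metric_space set \<Rightarrow> 'a set \<Rightarrow> real" where
  "sup_dist X Y = (if X = {} then 0 else SUP q\<in>X. infdist q Y)"

definition bilateral_beta ::
    "nat \<Rightarrow> 'a::euclidean_space set \<Rightarrow> 'a \<Rightarrow> real \<Rightarrow> real" where
  "bilateral_beta d E p s = inverse s *
     (INF P\<in>{P. affine P \<and> aff_dim P = int d}.
        sup_dist (ball p s \<inter> E) P + sup_dist (ball p s \<inter> P) E)"

definition bad_set :: "nat \<Rightarrow> 'a::euclidean_space set \<Rightarrow> real \<Rightarrow> ('a \<times> real) set" where
  "bad_set d E \<epsilon> = {(p, s). p \<in> E \<and> 0 < s \<and> bilateral_beta d E p s > \<epsilon>}"

definition bilateral_weak_geometric_lemma :: "nat \<Rightarrow> 'a::euclidean_space set \<Rightarrow> bool" where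
  "bilateral_weak_geometric_lemma d E \<longleftrightarrow>
     (\<exists>C\<ge>1. ahlfors_regular d C E) \<and>
     (\<exists>\<gamma> :: real \<Rightarrow> real. \<forall>\<epsilon>\<in>{0<..<1}. 0 < \<gamma> \<epsilon> \<and> carleson_set d (\<gamma> \<epsilon>) E (bad_set d E \<epsilon>))"

end

theory Submission
  imports Defs
begin

text \<open>
  For \<open>q\<close> in the common part \<open>F\<close> of \<open>E\<close> and the approximating set \<open>E'\<close>, a plane that is good for \<open>E'\<close>
  at scale \<open>2s\<close> is good for \<open>E\<close> at scale \<open>s\<close>, unless some point of \<open>E\<close> or of \<open>E'\<close> within \<open>2s\<close> of \<open>q\<close>
  lies at distance at least a fixed small multiple of \<open>s\<close> from \<open>F\<close>. The exceptional pairs \<open>(q, s)\<close>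
  satisfy a Carleson estimate by Fubini, because every point off \<open>F\<close> accounts for a bounded range of
  scales only. With Chebyshev's inequality this shows that every ball contains a substantial piece
  of \<open>E\<close> whose points see a bounded amount of bad scales, measured by \<open>ds/s\<close>.

  It remains to pass from substantial pieces to all of \<open>E\<close>, a John--Nirenberg argument. A bad pair
  \<open>(x, s)\<close> for \<open>\<epsilon>\<close> makes \<open>(y, 2s)\<close> bad for \<open>\<epsilon>/2\<close> whenever \<open>y \<in> E\<close> is within \<open>s\<close> of \<open>x\<close>. So around a
  point \<open>x\<close> seeing many \<open>\<epsilon>\<close>-bad scales, take the ball reaching out to the points that see few
  \<open>\<epsilon>/2\<close>-bad ones: above its radius few scales are bad, and inside it there is a substantial piece
  seeing few. By Vitali's covering lemma the points with many bad scales then occupy a smaller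
  fraction of every ball. Since \<open>\<epsilon>\<close> is halved each time, this is done only finitely often, until
  the fraction beats the overlap constant of the covering; an induction on the scale concludes.
\<close>

section \<open>Counting scales\<close>

text \<open>The measure ds/s on the positive half-line, Haar measure of the multiplicative group.
  Carrying it on all reals, with density zero off the positive half-line, keeps plain Borel
  sets.\<close>

definition log_measure :: "real measure" where
  "log_measure = density lborel (\<lambda>s. ennreal (if 0 < s then inverse s else 0))"

lemma sets_log_measure [simp, measurable_cong]: "sets log_measure = sets borel"
  by (simp add: log_measure_def)

lemma space_log_measure [simp]: "space log_measure = UNIV"
  by (simp add: log_measure_def)

lemma sigma_finite_log_measure: "sigma_finite_measure log_measure"
  unfolding log_measure_def
  by (subst sigma_finite_measure.sigma_finite_iff_density_finite[OF lborel.sigma_finite_measure_axioms])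
     auto

interpretation log_measure: sigma_finite_measure log_measure
  by (rule sigma_finite_log_measure)

lemma emeasure_log_measure:
  "S \<in> sets borel \<Longrightarrow> emeasure log_measure S =
     (\<integral>\<^sup>+s. ennreal (if 0 < s then inverse s else 0) * indicator S s \<partial>lborel)"
  unfolding log_measure_def by (subst emeasure_density) auto

text \<open>Dilation invariance: substituting \<open>c * s\<close> produces a factor
  \<open>c\<close> that the density \<open>inverse (c * s)\<close> absorbs. Changing scales by a
  constant therefore costs nothing.\<close>

lemma emeasure_log_measure_scale:
  assumes [measurable]: "S \<in> sets borel" and "0 < c"
  shows "emeasure log_measure {s. c * s \<in> S} = emeasure log_measure S"
proof -
  have [measurable]: "{s. c * s \<in> S} \<in> sets borel"
    by measurable
  have "emeasure log_measure S =
      ennreal c * (\<integral>\<^sup>+s. ennreal (if 0 < 0 + c * s then inverse (0 + c * s) else 0)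
         * indicator S (0 + c * s) \<partial>lborel)"
    using assms by (subst emeasure_log_measure, simp, subst nn_integral_real_affine[where c=c and t=0]) auto
  also have "\<dots> = (\<integral>\<^sup>+s. ennreal c * (ennreal (if 0 < 0 + c * s then inverse (0 + c * s) else 0)
         * indicator S (0 + c * s)) \<partial>lborel)"
    by (rule nn_integral_cmult[symmetric]) measurable
  also have "\<dots> = (\<integral>\<^sup>+s. ennreal (if 0 < s then inverse s else 0) * indicator {s. c * s \<in> S} s \<partial>lborel)"
    using assms
    by (intro nn_integral_cong)
       (auto simp: indicator_def zero_less_mult_iff ennreal_mult[symmetric] divide_simps)
  also have "\<dots> = emeasure log_measure {s. c * s \<in> S}"
    by (simp add: emeasure_log_measure)
  finally show ?thesis by simp
qed

lemma emeasure_log_measure_interval: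
  assumes "0 < a" "a \<le> b"
  shows "emeasure log_measure {a..<b} = ennreal (ln (b / a))"
proof -
  \<comment> \<open>Adding the endpoint \<open>b\<close>, a null set, gives the closed interval to
    which the fundamental theorem of calculus applies, with antiderivative
    \<open>ln\<close>.\<close>
  have "emeasure log_measure {a..<b} = (\<integral>\<^sup>+s. ennreal (inverse s) * indicator {a..b} s \<partial>lborel)"
    using assms AE_lborel_singleton[of b]
    by (subst emeasure_log_measure, simp)
       (intro nn_integral_cong_AE, auto simp: indicator_def)
  also have "\<dots> = ennreal (ln b - ln a)"
    using assms
    by (intro nn_integral_FTC_Icc[where F = ln])
       (auto intro!: derivative_eq_intros simp: divide_inverse)
  finally show ?thesis using assms by (simp add: ln_div)
qed

text \<open>Half-open intervals make \<open>occ\<close> additive in the scale, with no null sets to discard.\<close>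

definition occ :: "('a \<times> real) set \<Rightarrow> real \<Rightarrow> real \<Rightarrow> 'a \<Rightarrow> ennreal" where
  "occ A a b x = emeasure log_measure {s \<in> {a..<b}. (x, s) \<in> A}"

lemma section_borel:
  fixes A :: "('a::topological_space \<times> real) set"
  assumes "A \<in> sets borel" shows "{s \<in> {a..<b}. (x, s) \<in> A} \<in> sets borel"
proof -
  have "Pair x \<in> borel_measurable (borel :: real measure)"
    by (intro borel_measurable_continuous_onI continuous_intros)
  from measurable_sets[OF this assms] have [measurable]: "{s. (x, s) \<in> A} \<in> sets borel"
    by (simp add: vimage_def)
  have "{s \<in> {a..<b}. (x, s) \<in> A} = {a..<b} \<inter> {s. (x, s) \<in> A}" by auto
  then show ?thesis by simp
qed

lemma occ_measurable [measurable]: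
  fixes A :: "('a::second_countable_topology \<times> real) set"
  assumes "A \<in> sets borel" shows "occ A a b \<in> borel_measurable borel"
proof -
  have "A \<inter> (UNIV \<times> {a..<b}) \<in> sets ((borel :: 'a measure) \<Otimes>\<^sub>M log_measure)"
    using assms unfolding sets_pair_measure_cong[OF refl sets_log_measure] borel_prod
    by (intro sets.Int borel_Times) auto
  from log_measure.measurable_emeasure_Pair[OF this] show ?thesis
    by (simp add: occ_def[abs_def] vimage_def Int_def conj_ac)
qed

lemma occ_mono:
  fixes A B :: "('a::topological_space \<times> real) set"
  assumes "B \<in> sets borel" "\<And>s. a \<le> s \<Longrightarrow> s < b \<Longrightarrow> (x, s) \<in> A \<Longrightarrow> c \<le> s \<and> s < e \<and> (x, s) \<in> B"
  shows "occ A a b x \<le> occ B c e x"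
  unfolding occ_def using assms(2) section_borel[OF assms(1)] by (intro emeasure_mono) force+

lemma occ_split:
  fixes A :: "('a::topological_space \<times> real) set"
  assumes "A \<in> sets borel" "a \<le> c" "c \<le> b"
  shows "occ A a b x = occ A a c x + occ A c b x"
proof -
  have "{s \<in> {a..<b}. (x, s) \<in> A} = {s \<in> {a..<c}. (x, s) \<in> A} \<union> {s \<in> {c..<b}. (x, s) \<in> A}"
    using assms by auto
  moreover have "emeasure log_measure ({s \<in> {a..<c}. (x, s) \<in> A} \<union> {s \<in> {c..<b}. (x, s) \<in> A})
      = occ A a c x + occ A c b x"
    unfolding occ_def using section_borel[OF assms(1)] by (intro plus_emeasure[symmetric]) auto
  ultimately show ?thesis by (simp only: occ_def)
qed

lemma occ_le_ln:
  fixes A :: "('a::topological_space \<times> real) set"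
  assumes "0 < a" "a \<le> b" shows "occ A a b x \<le> ennreal (ln (b / a))"
  unfolding occ_def emeasure_log_measure_interval[OF assms, symmetric]
  by (intro emeasure_mono) auto

lemma occ_Un_le:
  fixes A B :: "('a::topological_space \<times> real) set"
  assumes "A \<in> sets borel" "B \<in> sets borel"
  shows "occ (A \<union> B) a b x \<le> occ A a b x + occ B a b x"
proof -
  have "{s \<in> {a..<b}. (x, s) \<in> A \<union> B} = {s \<in> {a..<b}. (x, s) \<in> A} \<union> {s \<in> {a..<b}. (x, s) \<in> B}"
    by auto
  moreover have "emeasure log_measure ({s \<in> {a..<b}. (x, s) \<in> A} \<union> {s \<in> {a..<b}. (x, s) \<in> B})
      \<le> occ A a b x + occ B a b x"
    unfolding occ_def using section_borel[OF assms(1)] section_borel[OF assms(2)]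
    by (intro emeasure_subadditive) auto
  ultimately show ?thesis by (simp only: occ_def)
qed

text \<open>Dilation invariance in the form used later: sending the scales \<open>s\<close> of
  \<open>x\<close> to scales \<open>k * s\<close> of a point \<open>y\<close>, possibly
  \<open>x\<close> itself, loses nothing in the count.\<close>

lemma occ_scale_mono:
  fixes A B :: "('a::topological_space \<times> real) set"
  assumes "B \<in> sets borel" "0 < k"
    and "\<And>s. a \<le> s \<Longrightarrow> s < b \<Longrightarrow> (x, s) \<in> A \<Longrightarrow> (y, k * s) \<in> B"
  shows "occ A a b x \<le> occ B (k * a) (k * b) y"
proof -
  define S where "S = {s \<in> {k * a..<k * b}. (y, s) \<in> B}"
  have S [measurable]: "S \<in> sets borel" unfolding S_def by (rule section_borel[OF assms(1)])
  have "{s. k * s \<in> S} \<in> sets borel" by measurable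
  moreover have "{s \<in> {a..<b}. (x, s) \<in> A} \<subseteq> {s. k * s \<in> S}"
    using assms(2,3) by (auto simp: S_def)
  ultimately have "occ A a b x \<le> emeasure log_measure {s. k * s \<in> S}"
    unfolding occ_def by (intro emeasure_mono) auto
  also have "\<dots> = occ B (k * a) (k * b) y"
    unfolding emeasure_log_measure_scale[OF S \<open>0 < k\<close>] by (simp add: occ_def S_def)
  finally show ?thesis .
qed

text \<open>Continuity of the measure from below. Positivity of the scales in \<open>A\<close>
  excludes \<open>s = 0\<close>, which lies in \<open>{0..<b}\<close> but in none of the intervals
  starting at \<open>1 / Suc n\<close>.\<close>

lemma occ_0_SUP:
  fixes A :: "('a::topological_space \<times> real) set"
  assumes A: "A \<in> sets borel" "\<And>s. (x, s) \<in> A \<Longrightarrow> 0 < s"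
  shows "occ A 0 b x = (SUP n. occ A (1 / Suc n) b x)"
proof -
  have "(\<Union>n. {s \<in> {1 / Suc n..<b}. (x, s) \<in> A}) = {s \<in> {0..<b}. (x, s) \<in> A}"
  proof (intro equalityI subsetI)
    fix s assume s: "s \<in> {s \<in> {0..<b}. (x, s) \<in> A}"
    then have "0 < s" using A(2)[of s] by simp
    then obtain n where "1 / real (Suc n) < s" by (rule nat_approx_posE)
    with s show "s \<in> (\<Union>n. {s \<in> {1 / real (Suc n)..<b}. (x, s) \<in> A})"
      by (intro UN_I[of n]) auto
  next
    fix s assume "s \<in> (\<Union>n. {s \<in> {1 / real (Suc n)..<b}. (x, s) \<in> A})"
    then have "s < b" "(x, s) \<in> A" by auto
    with A(2)[of s] show "s \<in> {s \<in> {0..<b}. (x, s) \<in> A}" by simp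
  qed
  moreover have "(SUP n. emeasure log_measure {s \<in> {1 / Suc n..<b}. (x, s) \<in> A})
      = emeasure log_measure (\<Union>n. {s \<in> {1 / Suc n..<b}. (x, s) \<in> A})"
  proof (rule SUP_emeasure_incseq)
    have "1 / real (Suc n) \<le> s" if "1 / real (Suc m) \<le> s" "m \<le> n" for m n s
    proof -
      have "1 / real (Suc n) \<le> 1 / real (Suc m)" using that by (intro divide_left_mono) auto
      then show ?thesis using that by linarith
    qed
    then show "incseq (\<lambda>n. {s \<in> {1 / real (Suc n)..<b}. (x, s) \<in> A})"
      by (auto simp: incseq_def)
  qed (use section_borel[OF A(1)] in auto)
  ultimately show ?thesis by (simp add: occ_def)
qed

lemma occ_0_le:
  fixes A :: "('a::topological_space \<times> real) set"
  assumes "A \<in> sets borel" "\<And>s. (x, s) \<in> A \<Longrightarrow> 0 < s" "\<And>a. 0 < a \<Longrightarrow> occ A a b x \<le> L"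
  shows "occ A 0 b x \<le> L"
proof -
  have "(SUP n. occ A (1 / real (Suc n)) b x) \<le> L"
    by (rule SUP_least) (simp add: assms(3))
  then show ?thesis by (simp only: occ_0_SUP[OF assms(1,2)])
qed

lemma occ_empty_interval: "b \<le> a \<Longrightarrow> occ A a b x = 0"
  by (simp add: occ_def)

section \<open>Hausdorff measure on a set, and the Carleson integral\<close>

text \<open>Restricting by a density rather than to a subspace leaves the measures of
  \<open>E\<close> and of a subset \<open>F\<close> on the same Borel sets, so that they can be
  compared.\<close>

definition surf :: "nat \<Rightarrow> 'a::metric_space set \<Rightarrow> 'a measure" where
  "surf d E = density (hausdorff_measure d) (indicator E)"

lemma sets_surf [simp, measurable_cong]: "sets (surf d E) = sets borel"
  by (simp add: surf_def)

lemma space_surf [simp]: "space (surf d E) = UNIV"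
  by (simp add: surf_def)

lemma emeasure_surf:
  assumes "E \<in> sets borel" "A \<in> sets borel"
  shows "emeasure (surf d E) A = emeasure (hausdorff_measure d) (E \<inter> A)"
  unfolding surf_def using assms
  by (subst emeasure_density) (auto simp: indicator_inter_arith[symmetric])

lemma nn_integral_surf:
  assumes "E \<in> sets borel" "f \<in> borel_measurable borel"
  shows "(\<integral>\<^sup>+x. f x \<partial>surf d E) = (\<integral>\<^sup>+x. indicator E x * f x \<partial>hausdorff_measure d)"
  unfolding surf_def using assms by (subst nn_integral_density) auto

lemma nn_integral_surf_mono:
  assumes "E \<in> sets borel" "F \<in> sets borel" "f \<in> borel_measurable borel" "F \<subseteq> E"
  shows "(\<integral>\<^sup>+x. f x \<partial>surf d F) \<le> (\<integral>\<^sup>+x. f x \<partial>surf d E)"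
  using assms by (simp add: nn_integral_surf) (intro nn_integral_mono mult_right_mono, auto simp: indicator_def)

lemma emeasure_surf_mono:
  assumes "E \<in> sets borel" "F \<in> sets borel" "A \<in> sets borel" "F \<subseteq> E"
  shows "emeasure (surf d F) A \<le> emeasure (surf d E) A"
  using assms by (simp add: emeasure_surf) (intro emeasure_mono, auto)

lemma ahlfors_regular_closed: "ahlfors_regular d C E \<Longrightarrow> closed E"
  by (simp add: ahlfors_regular_def)

lemma ahlfors_regular_borel: "ahlfors_regular d C E \<Longrightarrow> E \<in> sets borel"
  by (simp add: ahlfors_regular_def)

lemma surf_ball_le:
  assumes "ahlfors_regular d C E" "p \<in> E" "0 < r"
  shows "emeasure (surf d E) (ball p r) \<le> ennreal (C * r ^ d)"
  using assms by (simp add: emeasure_surf ahlfors_regular_borel) (simp add: ahlfors_regular_def)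

lemma surf_ball_ge:
  assumes "ahlfors_regular d C E" "p \<in> E" "0 < r"
  shows "ennreal (inverse C * r ^ d) \<le> emeasure (surf d E) (ball p r)"
  using assms by (simp add: emeasure_surf ahlfors_regular_borel) (simp add: ahlfors_regular_def)

text \<open>The upper regularity bound makes all balls around a fixed point of \<open>E\<close>
  finite. Sigma-finiteness is what the interchanges of integrals below require.\<close>

lemma sigma_finite_surf:
  assumes E: "ahlfors_regular d C E" shows "sigma_finite_measure (surf d E)"
proof (cases "E = {}")
  case True
  then have "emeasure (surf d E) UNIV = 0" by (simp add: emeasure_surf)
  then show ?thesis
    by (intro finite_measure.axioms(1) finite_measureI) (simp add: finite_measureI)
next
  case False
  then obtain p where p: "p \<in> E" by blast
  show ?thesis
  proof
    show "\<exists>A. countable A \<and> A \<subseteq> sets (surf d E) \<and> \<Union> A = space (surf d E)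
        \<and> (\<forall>a\<in>A. emeasure (surf d E) a \<noteq> \<infinity>)"
    proof (intro exI conjI ballI)
      let ?A = "range (\<lambda>n. ball p (real (Suc n)))"
      show "countable ?A" "?A \<subseteq> sets (surf d E)" by auto
      have "x \<in> \<Union> ?A" for x
      proof -
        obtain n where "dist p x < real n" using reals_Archimedean2 by blast
        then show ?thesis by (auto intro!: exI[of _ n])
      qed
      then show "\<Union> ?A = space (surf d E)" by auto
      fix a assume "a \<in> ?A"
      then obtain n where "a = ball p (real (Suc n))" by auto
      then have "emeasure (surf d E) a \<le> ennreal (C * real (Suc n) ^ d)"
        using surf_ball_le[OF E p, of "real (Suc n)"] by simp
      also have "\<dots> < top" by simp
      finally show "emeasure (surf d E) a \<noteq> \<infinity>" by auto
    qed
  qed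
qed

text \<open>Tonelli's theorem: integrating over the scale first turns the Carleson integral into the
  integral of \<open>occ\<close>, the amount of scales seen by a point.\<close>

lemma nn_integral_occ:
  fixes A :: "('a::euclidean_space \<times> real) set"
  assumes E: "ahlfors_regular d C E" and A: "A \<in> sets borel" "A \<subseteq> E \<times> {0<..}" and [measurable]: "B \<in> sets borel"
  shows "(\<integral>\<^sup>+s\<in>{0<..<r}. (\<integral>\<^sup>+q\<in>E \<inter> B. indicator A (q, s) \<partial>hausdorff_measure d) / ennreal s \<partial>lborel)
     = (\<integral>\<^sup>+q\<in>B. occ A 0 r q \<partial>surf d E)"
proof -
  interpret S: sigma_finite_measure "surf d E" by (rule sigma_finite_surf[OF E])
  interpret pair_sigma_finite "surf d E" log_measure ..
  have [measurable]: "E \<in> sets borel" by (rule ahlfors_regular_borel[OF E])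
  have [measurable]: "A \<in> sets (borel \<Otimes>\<^sub>M borel)" using A(1) unfolding borel_prod .
  let ?f = "\<lambda>q s. indicator B q * indicator {s \<in> {0..<r}. (q, s) \<in> A} s :: ennreal"
  have [measurable]: "case_prod ?f \<in> borel_measurable (surf d E \<Otimes>\<^sub>M log_measure)"
    by measurable
  \<comment> \<open>The integrands agree at every \<open>s\<close>, also at the extra endpoint
    \<open>s = 0\<close> of the half-open interval, where the density of \<open>log_measure\<close>
    vanishes.\<close>
  have *: "(\<integral>\<^sup>+q. ?f q s \<partial>surf d E) * ennreal (if 0 < s then inverse s else 0)
     = (\<integral>\<^sup>+q\<in>E \<inter> B. indicator A (q, s) \<partial>hausdorff_measure d) / ennreal s * indicator {0<..<r} s" for s
  proof (cases "0 < s \<and> s < r")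
    case True
    have "(\<integral>\<^sup>+q. ?f q s \<partial>surf d E) = (\<integral>\<^sup>+q. indicator E q * ?f q s \<partial>hausdorff_measure d)"
      by (intro nn_integral_surf) measurable
    also have "\<dots> = (\<integral>\<^sup>+q\<in>E \<inter> B. indicator A (q, s) \<partial>hausdorff_measure d)"
      using True by (intro nn_integral_cong) (auto simp: indicator_def)
    finally show ?thesis using True by (simp add: divide_ennreal_def inverse_ennreal)
  next
    case False
    then have "(\<integral>\<^sup>+q. ?f q s \<partial>surf d E) = 0 \<or> \<not> 0 < s"
      by (auto simp: indicator_def)
    with False show ?thesis by auto
  qed
  have "(\<integral>\<^sup>+q\<in>B. occ A 0 r q \<partial>surf d E) = (\<integral>\<^sup>+q. (\<integral>\<^sup>+s. ?f q s \<partial>log_measure) \<partial>surf d E)"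
  proof (intro nn_integral_cong)
    fix q
    have "(\<integral>\<^sup>+s. ?f q s \<partial>log_measure) = indicator B q * (\<integral>\<^sup>+s. indicator {s \<in> {0..<r}. (q, s) \<in> A} s \<partial>log_measure)"
      using section_borel[OF A(1), of 0 r q] by (intro nn_integral_cmult) simp
    also have "(\<integral>\<^sup>+s. indicator {s \<in> {0..<r}. (q, s) \<in> A} s \<partial>log_measure) = occ A 0 r q"
      unfolding occ_def using section_borel[OF A(1), of 0 r q] by (intro nn_integral_indicator) simp
    finally show "occ A 0 r q * indicator B q = (\<integral>\<^sup>+s. ?f q s \<partial>log_measure)"
      by (simp add: mult.commute)
  qed
  also have "\<dots> = (\<integral>\<^sup>+s. (\<integral>\<^sup>+q. ?f q s \<partial>surf d E) \<partial>log_measure)"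
    by (rule Fubini'[symmetric]) measurable
  also have "\<dots> = (\<integral>\<^sup>+s. ennreal (if 0 < s then inverse s else 0) * (\<integral>\<^sup>+q. ?f q s \<partial>surf d E) \<partial>lborel)"
    unfolding log_measure_def by (intro nn_integral_density) measurable
  also have "\<dots> = (\<integral>\<^sup>+s\<in>{0<..<r}. (\<integral>\<^sup>+q\<in>E \<inter> B. indicator A (q, s) \<partial>hausdorff_measure d) / ennreal s \<partial>lborel)"
    by (intro nn_integral_cong, subst mult.commute, rule *)
  finally show ?thesis by (rule sym)
qed

lemma carleson_set_iff:
  assumes "ahlfors_regular d C E"
  shows "carleson_set d \<gamma> E A \<longleftrightarrow> A \<subseteq> E \<times> {0<..} \<and> A \<in> sets borel \<and>
    (\<forall>p\<in>E. \<forall>r>0. (\<integral>\<^sup>+q\<in>ball p r. occ A 0 r q \<partial>surf d E) \<le> ennreal (\<gamma> * r ^ d))"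
  unfolding carleson_set_def using nn_integral_occ[OF assms] by (auto cong: conj_cong)

section \<open>Measurability of the bad set\<close>

text \<open>Boundedness of \<open>X\<close> makes the distances to \<open>Y\<close> bounded above,
  so that the real-valued supremum is a genuine one.\<close>

lemma infdist_le_sup_dist:
  assumes "bounded X" "q \<in> X" shows "infdist q Y \<le> sup_dist X Y"
proof -
  obtain e where e: "\<And>x. x \<in> X \<Longrightarrow> dist q x \<le> e"
    using assms(1) bounded_any_center[of X q] by blast
  have "bdd_above ((\<lambda>x. infdist x Y) ` X)"
  proof (rule bdd_aboveI2)
    fix x assume "x \<in> X"
    then show "infdist x Y \<le> infdist q Y + e"
      using infdist_triangle[of x Y q] e[of x] by (simp add: dist_commute)
  qed
  then show ?thesis using assms(2) by (auto simp: sup_dist_def intro: cSUP_upper)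
qed

lemma sup_dist_le:
  assumes "\<And>q. q \<in> X \<Longrightarrow> infdist q Y \<le> c" "0 \<le> c" shows "sup_dist X Y \<le> c"
  using assms by (auto simp: sup_dist_def intro: cSUP_least)

lemma sup_dist_nonneg: "bounded X \<Longrightarrow> 0 \<le> sup_dist X Y"
proof (cases "X = {}")
  case False
  then obtain q where "q \<in> X" by blast
  moreover assume "bounded X"
  ultimately show ?thesis
    using infdist_le_sup_dist[of X q Y] infdist_nonneg[of q Y] by linarith
qed (simp add: sup_dist_def)

lemma sup_dist_mono:
  assumes "X \<subseteq> Z" "bounded Z" shows "sup_dist X Y \<le> sup_dist Z Y"
  using assms by (intro sup_dist_le sup_dist_nonneg infdist_le_sup_dist) auto

section \<open>Affine planes and the flatness error\<close>

definition planes :: "nat \<Rightarrow> 'a::euclidean_space set set" where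
  "planes d = {P. affine P \<and> aff_dim P = int d}"

definition flat_error :: "'a::metric_space set \<Rightarrow> 'a \<Rightarrow> real \<Rightarrow> 'a set \<Rightarrow> real" where
  "flat_error E p s P = sup_dist (ball p s \<inter> E) P + sup_dist (ball p s \<inter> P) E"

lemma flat_error_nonneg: "0 \<le> flat_error E p s P"
  by (simp add: flat_error_def sup_dist_nonneg bounded_Int)

lemma bilateral_beta_flat_error:
  "bilateral_beta d E p s = inverse s * (INF P\<in>planes d. flat_error E p s P)"
  by (simp add: bilateral_beta_def planes_def flat_error_def)

text \<open>The real-valued infimum over planes is meaningful only over a nonempty family.\<close>

lemma planes_nonempty: "d \<le> DIM('a) \<Longrightarrow> planes d \<noteq> ({} :: 'a::euclidean_space set set)"
  using choose_affine_subset[of "UNIV :: 'a set" "int d"] by (fastforce simp: planes_def)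

lemma bilateral_beta_le:
  assumes "P \<in> planes d" "0 < s" "flat_error E p s P \<le> \<epsilon> * s"
  shows "bilateral_beta d E p s \<le> \<epsilon>"
proof -
  have "(INF P\<in>planes d. flat_error E p s P) \<le> flat_error E p s P"
    by (intro cINF_lower bdd_belowI2[of _ 0] flat_error_nonneg assms)
  then show ?thesis using assms(2,3) by (simp add: bilateral_beta_flat_error field_simps)
qed

lemma bilateral_beta_less:
  fixes E :: "'a::euclidean_space set"
  assumes "d \<le> DIM('a)" "0 < s" "bilateral_beta d E p s < c"
  obtains P where "P \<in> planes d" "flat_error E p s P < c * s"
proof -
  have "(INF P\<in>planes d. flat_error E p s P) < c * s"
    using assms(2,3) by (simp add: bilateral_beta_flat_error field_simps)
  then show ?thesis using that planes_nonempty[OF assms(1)]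
    by (subst (asm) cINF_less_iff) (auto intro: bdd_belowI2[of _ 0] flat_error_nonneg)
qed

text \<open>A sum of two suprema is bounded by bounding the sum for all pairs \<open>x\<close>,
  \<open>y\<close>. If the plane misses the ball there are no pairs and its supremum is zero, which
  is why the first term is also bounded alone. The centre \<open>p\<close> ensures that
  \<open>E\<close> meets the ball.\<close>

lemma flat_error_le:
  assumes "0 < s" "p \<in> E" "0 \<le> c"
    and "\<And>x. x \<in> ball p s \<inter> E \<Longrightarrow> infdist x P \<le> c"
    and "\<And>x y. x \<in> ball p s \<inter> E \<Longrightarrow> y \<in> ball p s \<inter> P \<Longrightarrow> infdist x P + infdist y E \<le> c"
  shows "flat_error E p s P \<le> c"
proof (cases "ball p s \<inter> P = {}")
  case True
  then have "sup_dist (ball p s \<inter> P) E = 0" by (simp add: sup_dist_def)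
  then show ?thesis using assms sup_dist_le[of "ball p s \<inter> E" P c] by (simp add: flat_error_def)
next
  case False
  have le: "sup_dist (ball p s \<inter> E) P \<le> c - infdist y E" if "y \<in> ball p s \<inter> P" for y
  proof (rule sup_dist_le)
    show "infdist q P \<le> c - infdist y E" if "q \<in> ball p s \<inter> E" for q
      using assms(5)[OF that \<open>y \<in> ball p s \<inter> P\<close>] by linarith
    have "p \<in> ball p s \<inter> E" using assms by simp
    from assms(5)[OF this that] show "0 \<le> c - infdist y E" using infdist_nonneg[of p P] by linarith
  qed
  have "sup_dist (ball p s \<inter> P) E \<le> c - sup_dist (ball p s \<inter> E) P"
  proof (rule sup_dist_le)
    show "infdist q E \<le> c - sup_dist (ball p s \<inter> E) P" if "q \<in> ball p s \<inter> P" for q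
      using le[OF that] by linarith
    from False obtain y where "y \<in> ball p s \<inter> P" by blast
    from le[OF this] show "0 \<le> c - sup_dist (ball p s \<inter> E) P" using infdist_nonneg[of y E] by linarith
  qed
  then show ?thesis by (simp add: flat_error_def)
qed

lemma flat_error_ge:
  assumes "x \<in> ball p s \<inter> E" "y \<in> ball p s \<inter> P"
  shows "infdist x P + infdist y E \<le> flat_error E p s P"
  unfolding flat_error_def
  using assms by (intro add_mono infdist_le_sup_dist bounded_Int) auto

lemma flat_error_ge1:
  assumes "x \<in> ball p s \<inter> E" shows "infdist x P \<le> flat_error E p s P"
  using infdist_le_sup_dist[OF _ assms, of P] sup_dist_nonneg[of "ball p s \<inter> P" E]
  by (simp add: flat_error_def bounded_Int)

lemma flat_error_ge2:
  assumes "y \<in> ball p s \<inter> P" shows "infdist y E \<le> flat_error E p s P"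
  using infdist_le_sup_dist[OF _ assms, of E] sup_dist_nonneg[of "ball p s \<inter> E" P]
  by (simp add: flat_error_def bounded_Int)

lemma flat_error_mono:
  assumes "ball p s \<subseteq> ball q t" shows "flat_error E p s P \<le> flat_error E q t P"
  unfolding flat_error_def using assms by (intro add_mono sup_dist_mono bounded_Int) auto

section \<open>Orthonormal frames and compactness of the family of planes\<close>

text \<open>Only the coefficients with index below \<open>d\<close> enter. Describing a plane by a
  base point and a frame reduces limits of planes to limits of vectors.\<close>

definition frame_plane :: "nat \<Rightarrow> 'a::real_vector \<Rightarrow> (nat \<Rightarrow> 'a) \<Rightarrow> 'a set" where
  "frame_plane d a f = range (\<lambda>c. a + (\<Sum>i<d. c i *\<^sub>R f i))"

definition orthonormal :: "nat \<Rightarrow> (nat \<Rightarrow> 'a::real_inner) \<Rightarrow> bool" where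
  "orthonormal d f \<longleftrightarrow> (\<forall>i<d. \<forall>j<d. f i \<bullet> f j = (if i = j then 1 else 0))"

lemma orthonormal_coord:
  assumes "orthonormal d f" "i < d" shows "(\<Sum>j<d. c j *\<^sub>R f j) \<bullet> f i = c i"
proof -
  have "(\<Sum>j<d. c j *\<^sub>R f j) \<bullet> f i = (\<Sum>j<d. c j * (f j \<bullet> f i))"
    by (simp add: inner_sum_left)
  also have "\<dots> = (\<Sum>j<d. if j = i then c j else 0)"
    using assms by (intro sum.cong) (auto simp: orthonormal_def)
  finally show ?thesis using assms by simp
qed

lemma range_frame:
  fixes f :: "nat \<Rightarrow> 'a::real_vector"
  assumes "inj_on f {..<d}"
  shows "range (\<lambda>c. \<Sum>i<d. c i *\<^sub>R f i) = span (f ` {..<d})"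
proof -
  have fin: "span (f ` {..<d}) = range (\<lambda>u. \<Sum>v\<in>f ` {..<d}. u v *\<^sub>R v)"
    by (rule span_finite) simp
  have sum: "(\<Sum>v\<in>f ` {..<d}. u v *\<^sub>R v) = (\<Sum>i<d. u (f i) *\<^sub>R f i)" for u
    using assms by (simp add: sum.reindex)
  show ?thesis
  proof (intro equalityI subsetI)
    fix x assume "x \<in> range (\<lambda>c. \<Sum>i<d. c i *\<^sub>R f i)"
    then obtain c where "x = (\<Sum>i<d. c i *\<^sub>R f i)" by blast
    also have "\<dots> = (\<Sum>i<d. c (the_inv_into {..<d} f (f i)) *\<^sub>R f i)"
      using assms by (intro sum.cong) (auto simp: the_inv_into_f_f)
    also have "\<dots> = (\<Sum>v\<in>f ` {..<d}. c (the_inv_into {..<d} f v) *\<^sub>R v)"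
      by (simp add: sum[of "\<lambda>v. c (the_inv_into {..<d} f v)"])
    finally show "x \<in> span (f ` {..<d})" unfolding fin
      by (rule range_eqI[where x = "\<lambda>v. c (the_inv_into {..<d} f v)"])
  next
    fix x assume "x \<in> span (f ` {..<d})"
    then obtain u where "x = (\<Sum>v\<in>f ` {..<d}. u v *\<^sub>R v)" unfolding fin by blast
    then have "x = (\<Sum>i<d. (u \<circ> f) i *\<^sub>R f i)" by (simp add: sum)
    then show "x \<in> range (\<lambda>c. \<Sum>i<d. c i *\<^sub>R f i)" by blast
  qed
qed

lemma orthonormal_inj:
  assumes "orthonormal d f" shows "inj_on f {..<d}"
  using assms unfolding orthonormal_def inj_on_def by (metis lessThan_iff zero_neq_one)

lemma frame_plane_span:
  assumes "orthonormal d f" shows "frame_plane d a f = (+) a ` span (f ` {..<d})"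
  unfolding range_frame[OF orthonormal_inj[OF assms], symmetric] frame_plane_def by auto

lemma frame_plane_in_planes:
  fixes f :: "nat \<Rightarrow> 'a::euclidean_space"
  assumes "orthonormal d f" shows "frame_plane d a f \<in> planes d"
proof -
  have "pairwise orthogonal (f ` {..<d})"
    using assms by (auto simp: orthonormal_def pairwise_def orthogonal_def)
  moreover have "f i \<noteq> 0" if "i < d" for i
    using assms that by (force simp: orthonormal_def)
  then have "0 \<notin> f ` {..<d}" by force
  ultimately have ind: "independent (f ` {..<d})" by (rule pairwise_orthogonal_independent)
  moreover have "card (f ` {..<d}) = d" using orthonormal_inj[OF assms] by (simp add: card_image)
  ultimately have "dim (span (f ` {..<d})) = d" by (metis dim_span_eq_card_independent)
  then show ?thesis
    by (simp add: planes_def frame_plane_span[OF assms] aff_dim_translation_eq aff_dim_subspace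
        affine_translation[symmetric] subspace_imp_affine)
qed

text \<open>An orthonormal basis of the direction space is enumerated by the indices below
  \<open>d\<close>. The base point is prescribed, which lets it be kept bounded along a sequence of
  planes.\<close>

lemma plane_frame:
  fixes P :: "'a::euclidean_space set"
  assumes "P \<in> planes d" "a \<in> P"
  obtains f where "orthonormal d f" "P = frame_plane d a f"
proof -
  let ?S = "(+) (- a) ` P"
  have S: "subspace ?S"
    using assms affine_diffs_subspace[of P a] by (simp add: planes_def)
  have "aff_dim P = int (dim ?S)"
    using assms by (intro aff_dim_eq_dim hull_inc)
  then have dim: "dim ?S = d" using assms by (simp add: planes_def)
  obtain B where B: "pairwise orthogonal B" "\<And>x. x \<in> B \<Longrightarrow> norm x = 1"
    "independent B" "card B = dim ?S" "span B = ?S"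
    using orthonormal_basis_subspace[OF S] by metis
  have "finite B" using B(3) by (rule independent_imp_finite)
  then obtain f where f: "bij_betw f {..<d} B"
    using B(4) dim ex_bij_betw_nat_finite[of B] by (auto simp: atLeast0LessThan)
  have on: "orthonormal d f"
    unfolding orthonormal_def
  proof (intro allI impI)
    fix i j assume ij: "i < d" "j < d"
    show "f i \<bullet> f j = (if i = j then 1 else 0)"
    proof (cases "i = j")
      case True
      then show ?thesis using B(2)[of "f i"] f ij by (auto simp: dot_square_norm bij_betw_def)
    next
      case False
      then have "f i \<noteq> f j" using f ij by (auto simp: bij_betw_def inj_on_def)
      then show ?thesis using B(1) f ij False by (auto simp: bij_betw_def pairwise_def orthogonal_def)
    qed
  qed
  have "P = (+) a ` ?S" by (force simp: image_image)
  also have "\<dots> = frame_plane d a f"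
    using f B(5) by (simp add: frame_plane_span[OF on] bij_betw_def)
  finally show ?thesis using that on by blast
qed

text \<open>Bolzano-Weierstrass applied to one index after another; a further subsequence keeps the
  limits already obtained.\<close>

lemma bounded_family_subsequence:
  fixes f :: "nat \<Rightarrow> nat \<Rightarrow> 'a::euclidean_space"
  assumes "\<And>k i. i < d \<Longrightarrow> norm (f k i) \<le> b"
  obtains r l where "strict_mono r" "\<And>i. i < d \<Longrightarrow> (\<lambda>k. f (r k) i) \<longlonglongrightarrow> l i"
proof -
  have "\<exists>r l. strict_mono r \<and> (\<forall>i<d. (\<lambda>k. f (r k) i) \<longlonglongrightarrow> l i)"
    using assms
  proof (induction d)
    case 0
    then show ?case by (auto intro!: exI[of _ id] simp: strict_mono_def)
  next
    case (Suc d)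
    then obtain r l where r: "strict_mono r" "\<And>i. i < d \<Longrightarrow> (\<lambda>k. f (r k) i) \<longlonglongrightarrow> l i"
      by (metis less_SucI)
    have "\<forall>k. f (r k) d \<in> cball 0 b" using Suc.prems by simp
    then have "\<exists>x\<in>cball 0 b. \<exists>r'. strict_mono r' \<and> ((\<lambda>k. f (r k) d) \<circ> r') \<longlonglongrightarrow> x"
      by (rule compact_cball[of "0::'a" b, unfolded compact_def, THEN spec, THEN mp])
    then obtain x r' where r': "strict_mono r'" "((\<lambda>k. f (r k) d) \<circ> r') \<longlonglongrightarrow> x" by blast
    have "(\<lambda>k. f ((r \<circ> r') k) i) \<longlonglongrightarrow> (if i < d then l i else x)" if "i < Suc d" for i
    proof (cases "i < d")
      case True
      then show ?thesis using LIMSEQ_subseq_LIMSEQ[OF r(2)[OF True] r'(1)] by (simp add: o_def)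
    next
      case False
      then have "i = d" using that by simp
      then show ?thesis using r'(2) by (simp add: o_def)
    qed
    then show ?case using strict_mono_o[OF r(1) r'(1)]
      by (intro exI[of _ "r \<circ> r'"] exI[of _ "\<lambda>i. if i < d then l i else x"]) blast
  qed
  then show ?thesis using that by blast
qed

lemma planes_closed: "P \<in> planes d \<Longrightarrow> closed P"
  by (simp add: planes_def affine_closed)

text \<open>Base points are bounded and frames consist of unit vectors, so both converge along a
  subsequence, and orthonormality survives in the limit. The last two conclusions are the two halves
  of local convergence to \<open>Q\<close>: distances to \<open>Q\<close> are asymptotically no
  larger, and points of \<open>Q\<close> are limits of points of the planes.\<close>

lemma planes_compactness:
  fixes P :: "nat \<Rightarrow> 'a::euclidean_space set"
  assumes P: "\<And>k. P k \<in> planes d" and a: "\<And>k. a k \<in> P k" "\<And>k. norm (a k) \<le> b"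
  obtains r Q where "strict_mono r" "Q \<in> planes d"
    "\<And>q. \<exists>\<delta>. \<delta> \<longlonglongrightarrow> (0::real) \<and> (\<forall>k. infdist q Q \<le> infdist q (P (r k)) + \<delta> k)"
    "\<And>q. q \<in> Q \<Longrightarrow> \<exists>x. (\<forall>k. x k \<in> P (r k)) \<and> x \<longlonglongrightarrow> q"
proof -
  have "\<forall>k. \<exists>f. orthonormal d f \<and> P k = frame_plane d (a k) f"
    using plane_frame[OF P a(1)] by metis
  then obtain f where f: "\<And>k. orthonormal d (f k)" "\<And>k. P k = frame_plane d (a k) (f k)"
    by metis
  \<comment> \<open>The base point is appended to the frame as entry \<open>d\<close>, so that one
    extraction serves both.\<close>
  define g where "g k i = (if i < d then f k i else a k)" for k i
  have "norm (f k i) = 1" if "i < d" for k i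
    using f(1)[of k] that by (simp add: orthonormal_def norm_eq_sqrt_inner)
  then have "norm (g k i) \<le> max 1 b" for k i
    using a(2)[of k] by (auto simp: g_def)
  then obtain r l where r: "strict_mono r" "\<And>i. i < Suc d \<Longrightarrow> (\<lambda>k. g (r k) i) \<longlonglongrightarrow> l i"
    using bounded_family_subsequence[of "Suc d" g] by metis
  have fl: "(\<lambda>k. f (r k) i) \<longlonglongrightarrow> l i" if "i < d" for i
    using r(2)[of i] that by (simp add: g_def)
  have al: "(\<lambda>k. a (r k)) \<longlonglongrightarrow> l d"
    using r(2)[of d] by (simp add: g_def)
  have on: "orthonormal d l"
    unfolding orthonormal_def
  proof (intro allI impI)
    fix i j assume ij: "i < d" "j < d"
    have "(\<lambda>k. f (r k) i \<bullet> f (r k) j) \<longlonglongrightarrow> l i \<bullet> l j"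
      using ij by (intro tendsto_inner fl)
    moreover have "(\<lambda>k. f (r k) i \<bullet> f (r k) j) = (\<lambda>k. if i = j then 1 else 0)"
      using f(1) ij by (auto simp: orthonormal_def)
    ultimately show "l i \<bullet> l j = (if i = j then 1 else 0)"
      by (metis (no_types) LIMSEQ_unique tendsto_const)
  qed
  let ?Q = "frame_plane d (l d) l"
  have lower: "\<exists>\<delta>. \<delta> \<longlonglongrightarrow> (0::real) \<and> (\<forall>k. infdist q ?Q \<le> infdist q (P (r k)) + \<delta> k)" for q
  proof -
    \<comment> \<open>\<open>M\<close> bounds the coefficients of a point of the plane nearest to
      \<open>q\<close>, since that point lies within \<open>2 * dist q (a (r k))\<close> of the base
      point. Hence \<open>\<delta>\<close> does not depend on the nearest point.\<close>
    define M where "M = 2 * (norm q + b)"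
    define \<delta> where "\<delta> k = norm (a (r k) - l d) + (\<Sum>i<d. M * norm (f (r k) i - l i))" for k
    have "\<delta> \<longlonglongrightarrow> 0 + (\<Sum>i<d. M * 0)"
      unfolding \<delta>_def using al fl
      by (intro tendsto_add tendsto_sum tendsto_mult tendsto_const tendsto_norm_zero)
         (auto simp: LIM_zero_iff)
    moreover have "infdist q ?Q \<le> infdist q (P (r k)) + \<delta> k" for k
    proof -
      have "closed (P (r k))" "P (r k) \<noteq> {}" using planes_closed[OF P] a(1) by auto
      then obtain x where x: "x \<in> P (r k)" "infdist q (P (r k)) = dist q x"
        using infdist_attains_inf by metis
      then obtain c where c: "x = a (r k) + (\<Sum>i<d. c i *\<^sub>R f (r k) i)"
        using f(2) by (auto simp: frame_plane_def)
      have "dist q x \<le> dist q (a (r k))" using infdist_le[OF a(1)] x(2) by metis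
      then have "norm (x - a (r k)) \<le> 2 * dist q (a (r k))"
        using dist_triangle[of x "a (r k)" q] by (simp add: dist_norm norm_minus_commute)
      also have "dist q (a (r k)) \<le> norm q + norm (a (r k))"
        by (simp add: dist_norm norm_triangle_ineq4)
      also have "\<dots> \<le> norm q + b" using a(2) by simp
      finally have xa: "norm (x - a (r k)) \<le> M" by (simp add: M_def)
      have cM: "\<bar>c i\<bar> \<le> M" if "i < d" for i
      proof -
        have "c i = (x - a (r k)) \<bullet> f (r k) i"
          using orthonormal_coord[OF f(1) that, of c] c by simp
        also have "\<bar>\<dots>\<bar> \<le> norm (x - a (r k)) * norm (f (r k) i)" by (rule Cauchy_Schwarz_ineq2)
        also have "norm (f (r k) i) = 1"
          using f(1)[of "r k"] that by (simp add: orthonormal_def norm_eq_sqrt_inner)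
        finally show ?thesis using xa by simp
      qed
      \<comment> \<open>The same coefficients in the limit frame give a competitor in the limit
        plane.\<close>
      define y where "y = l d + (\<Sum>i<d. c i *\<^sub>R l i)"
      have "y \<in> ?Q" by (auto simp: y_def frame_plane_def)
      have "x - y = (a (r k) - l d) + (\<Sum>i<d. c i *\<^sub>R (f (r k) i - l i))"
        by (simp add: c y_def scaleR_diff_right sum_subtractf)
      also have "norm \<dots> \<le> norm (a (r k) - l d) + norm (\<Sum>i<d. c i *\<^sub>R (f (r k) i - l i))"
        by (rule norm_triangle_ineq)
      also have "norm (\<Sum>i<d. c i *\<^sub>R (f (r k) i - l i)) \<le> (\<Sum>i<d. M * norm (f (r k) i - l i))"
        using cM by (intro sum_norm_le) (auto intro: mult_right_mono)
      finally have "dist x y \<le> \<delta> k" by (simp add: \<delta>_def dist_norm)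
      then show ?thesis
        using infdist_le[OF \<open>y \<in> ?Q\<close>, of q] dist_triangle[of q y x] x(2) by linarith
    qed
    ultimately show ?thesis by auto
  qed
  have approx: "\<exists>x. (\<forall>k. x k \<in> P (r k)) \<and> x \<longlonglongrightarrow> q" if q: "q \<in> ?Q" for q
  proof -
    obtain c where c: "q = l d + (\<Sum>i<d. c i *\<^sub>R l i)"
      using q by (auto simp: frame_plane_def)
    have "(\<lambda>k. a (r k) + (\<Sum>i<d. c i *\<^sub>R f (r k) i)) \<longlonglongrightarrow> q"
      unfolding c using al fl by (intro tendsto_add tendsto_sum tendsto_scaleR tendsto_const) auto
    then show ?thesis using f(2)
      by (intro exI[of _ "\<lambda>k. a (r k) + (\<Sum>i<d. c i *\<^sub>R f (r k) i)"]) (auto simp: frame_plane_def)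
  qed
  show ?thesis
    by (rule that[OF r(1) frame_plane_in_planes[OF on] lower approx])
qed

text \<open>Compactness of the planes makes the infimum over them lower semicontinuous in the ball.\<close>

lemma bilateral_beta_limit:
  fixes E :: "'a::euclidean_space set"
  assumes d: "d \<le> DIM('a)" and p: "p \<longlonglongrightarrow> q" "\<And>k. p k \<in> E" "q \<in> E"
    and s: "s \<longlonglongrightarrow> t" "\<And>k. 0 < s k" "0 < t"
    and le: "\<And>k. bilateral_beta d E (p k) (s k) \<le> \<epsilon>" and \<epsilon>: "0 \<le> \<epsilon>"
  shows "bilateral_beta d E q t \<le> \<epsilon>"
proof -
  \<comment> \<open>The infimum over planes is not known to be attained, so planes are chosen with a
    slack that vanishes in the limit.\<close>
  define \<eta> where "\<eta> k = (\<epsilon> + inverse (real (Suc k))) * s k" for k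
  have "\<forall>k. \<exists>P. P \<in> planes d \<and> flat_error E (p k) (s k) P < \<eta> k"
  proof
    fix k
    have "bilateral_beta d E (p k) (s k) < \<epsilon> + inverse (real (Suc k))"
      using le[of k] by (simp add: add_strict_increasing2 le_less_trans[OF le[of k]])
    from bilateral_beta_less[OF d s(2) this]
    show "\<exists>P. P \<in> planes d \<and> flat_error E (p k) (s k) P < \<eta> k" unfolding \<eta>_def by metis
  qed
  then obtain P where P: "\<And>k. P k \<in> planes d" "\<And>k. flat_error E (p k) (s k) (P k) < \<eta> k"
    by metis
  have \<eta>: "\<eta> \<longlonglongrightarrow> (\<epsilon> + 0) * t"
    unfolding \<eta>_def by (intro tendsto_mult tendsto_add tendsto_const s LIMSEQ_inverse_real_of_nat)
  have ne: "P k \<noteq> {}" for k using P(1)[of k] by (auto simp: planes_def)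
  have "\<forall>k. \<exists>a. a \<in> P k \<and> infdist (p k) (P k) = dist (p k) a"
    using infdist_attains_inf[OF planes_closed[OF P(1)] ne] by metis
  then obtain a where a: "\<And>k. a k \<in> P k" "\<And>k. infdist (p k) (P k) = dist (p k) (a k)"
    by metis
  have "Bseq \<eta>" by (rule convergent_imp_Bseq[OF convergentI[OF \<eta>]])
  moreover have "Bseq p" by (rule convergent_imp_Bseq[OF convergentI[OF p(1)]])
  ultimately obtain K L where KL: "\<And>k. norm (\<eta> k) \<le> K" "\<And>k. norm (p k) \<le> L"
    unfolding Bseq_def by blast
  \<comment> \<open>Since \<open>p k\<close> lies in \<open>E\<close>, it is itself within
    \<open>\<eta> k\<close> of the plane; so the nearest points \<open>a k\<close> stay bounded and
    can serve as base points.\<close>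
  have aK: "norm (a k) \<le> L + K" for k
  proof -
    have "dist (p k) (a k) \<le> \<eta> k"
      using flat_error_ge1[of "p k" "p k" "s k" E "P k"] P(2)[of k] a(2) p(2)[of k] s(2)[of k] by simp
    then show ?thesis
      using KL(1)[of k] KL(2)[of k] norm_triangle_ineq2[of "a k" "p k"]
      by (simp add: dist_norm norm_minus_commute)
  qed
  obtain r Q where r: "strict_mono r" "Q \<in> planes d"
    and low: "\<And>q. \<exists>\<delta>. \<delta> \<longlonglongrightarrow> (0::real) \<and> (\<forall>k. infdist q Q \<le> infdist q (P (r k)) + \<delta> k)"
    and app: "\<And>q. q \<in> Q \<Longrightarrow> \<exists>x. (\<forall>k. x k \<in> P (r k)) \<and> x \<longlonglongrightarrow> q"
    by (rule planes_compactness[OF P(1) a(1) aK]) (rule that)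
  have \<eta>r: "(\<lambda>k. \<eta> (r k)) \<longlonglongrightarrow> \<epsilon> * t"
    using LIMSEQ_subseq_LIMSEQ[OF \<eta> r(1)] by (simp add: o_def)
  have pr: "(\<lambda>k. p (r k)) \<longlonglongrightarrow> q" and sr: "(\<lambda>k. s (r k)) \<longlonglongrightarrow> t"
    using LIMSEQ_subseq_LIMSEQ[OF p(1) r(1)] LIMSEQ_subseq_LIMSEQ[OF s(1) r(1)] by (simp_all add: o_def)
  \<comment> \<open>The limit ball is open, so a sequence converging to one of its points is
    eventually inside the approximating balls, where their errors apply.\<close>
  have ev: "\<forall>\<^sub>F k in sequentially. y k \<in> ball (p (r k)) (s (r k))"
    if "y \<longlonglongrightarrow> z" "z \<in> ball q t" for y z
  proof -
    have "(\<lambda>k. s (r k) - dist (p (r k)) (y k)) \<longlonglongrightarrow> t - dist q z"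
      by (intro tendsto_diff tendsto_dist pr sr that)
    moreover have "0 < t - dist q z" using that by simp
    ultimately have "\<forall>\<^sub>F k in sequentially. 0 < s (r k) - dist (p (r k)) (y k)"
      by (rule order_tendstoD(1))
    then show ?thesis by eventually_elim simp
  qed
  have "flat_error E q t Q \<le> \<epsilon> * t"
  proof (rule flat_error_le)
    fix x assume x: "x \<in> ball q t \<inter> E"
    obtain \<delta> where \<delta>: "\<delta> \<longlonglongrightarrow> (0::real)" "\<And>k. infdist x Q \<le> infdist x (P (r k)) + \<delta> k"
      using low[of x] by blast
    have evx: "\<forall>\<^sub>F k in sequentially. x \<in> ball (p (r k)) (s (r k))"
      using x by (intro ev[OF tendsto_const]) auto
    then have "\<forall>\<^sub>F k in sequentially. infdist x Q - \<delta> k \<le> \<eta> (r k)"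
    proof eventually_elim
      case (elim k)
      then show ?case
        using flat_error_ge1[of x "p (r k)" "s (r k)" E "P (r k)"] x P(2)[of "r k"] \<delta>(2)[of k] by simp
    qed
    moreover have "(\<lambda>k. infdist x Q - \<delta> k) \<longlonglongrightarrow> infdist x Q - 0"
      by (intro tendsto_diff tendsto_const \<delta>)
    ultimately show "infdist x Q \<le> \<epsilon> * t"
      using tendsto_le[OF sequentially_bot \<eta>r] by fastforce
    fix y assume y: "y \<in> ball q t \<inter> Q"
    then obtain z where z: "\<And>k. z k \<in> P (r k)" "z \<longlonglongrightarrow> y" using app[of y] by blast
    have "\<forall>\<^sub>F k in sequentially. z k \<in> ball (p (r k)) (s (r k))"
      using y by (intro ev[OF z(2)]) auto
    with evx have "\<forall>\<^sub>F k in sequentially. infdist x Q - \<delta> k + infdist (z k) E \<le> \<eta> (r k)"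
    proof eventually_elim
      case (elim k)
      then show ?case
        using flat_error_ge[of x "p (r k)" "s (r k)" E "z k" "P (r k)"] x P(2)[of "r k"] \<delta>(2)[of k]
          z(1)[of k] by simp
    qed
    moreover have "(\<lambda>k. infdist x Q - \<delta> k + infdist (z k) E) \<longlonglongrightarrow> infdist x Q - 0 + infdist y E"
      by (intro tendsto_diff tendsto_add tendsto_infdist tendsto_const \<delta> z)
    ultimately show "infdist x Q + infdist y E \<le> \<epsilon> * t"
      using tendsto_le[OF sequentially_bot \<eta>r] by fastforce
  qed (use s p \<epsilon> in auto)
  then show ?thesis by (rule bilateral_beta_le[OF r(2) s(3)])
qed

text \<open>By \<open>bilateral_beta_limit\<close> the good pairs are relatively closed in the
  product of \<open>E\<close> and the positive half-line. Removing their closure from this Borel set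
  leaves the bad set.\<close>

lemma bad_set_borel:
  fixes E :: "'a::euclidean_space set"
  assumes "closed E" "d \<le> DIM('a)" "0 \<le> \<epsilon>"
  shows "bad_set d E \<epsilon> \<in> sets borel"
proof -
  let ?S = "{(p, s). p \<in> E \<and> 0 < s \<and> bilateral_beta d E p s \<le> \<epsilon>}"
  have "bad_set d E \<epsilon> = E \<times> {0<..} - closure ?S"
  proof (intro equalityI subsetI)
    fix z assume z: "z \<in> bad_set d E \<epsilon>"
    obtain q t where qt: "z = (q, t)" by (cases z)
    have "z \<notin> closure ?S"
    proof
      assume "z \<in> closure ?S"
      then obtain w where w: "\<And>k. w k \<in> ?S" "w \<longlonglongrightarrow> z" unfolding closure_sequential by blast
      have "q \<in> E" "0 < t" using z by (simp_all add: qt bad_set_def)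
      have "bilateral_beta d E q t \<le> \<epsilon>"
      proof (rule bilateral_beta_limit[of d "\<lambda>k. fst (w k)" q E "\<lambda>k. snd (w k)" t])
        show "(\<lambda>k. fst (w k)) \<longlonglongrightarrow> q" "(\<lambda>k. snd (w k)) \<longlonglongrightarrow> t"
          using tendsto_fst[OF w(2)] tendsto_snd[OF w(2)] by (simp_all add: qt)
        show "fst (w k) \<in> E" "0 < snd (w k)" "bilateral_beta d E (fst (w k)) (snd (w k)) \<le> \<epsilon>" for k
          using w(1)[of k] unfolding case_prod_beta by blast+
      qed (use assms \<open>q \<in> E\<close> \<open>0 < t\<close> in simp_all)
      with z qt show False by (simp add: bad_set_def)
    qed
    moreover have "z \<in> E \<times> {0<..}" using z by (auto simp: bad_set_def)
    ultimately show "z \<in> E \<times> {0<..} - closure ?S" by blast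
  next
    fix z assume z: "z \<in> E \<times> {0<..} - closure ?S"
    then have "z \<notin> closure ?S" by simp
    moreover have "?S \<subseteq> closure ?S" by (rule closure_subset)
    ultimately have "z \<notin> ?S" by (rule contra_subsetD[rotated])
    with z show "z \<in> bad_set d E \<epsilon>" by (cases z) (simp add: bad_set_def)
  qed
  moreover have "E \<times> {0::real<..} \<in> sets borel" using assms(1) by (intro borel_Times) auto
  ultimately show ?thesis by simp
qed

lemma bad_set_antimono: "\<epsilon>' \<le> \<epsilon> \<Longrightarrow> bad_set d E \<epsilon> \<subseteq> bad_set d E \<epsilon>'"
  by (auto simp: bad_set_def)

text \<open>The ball of radius \<open>s\<close> around \<open>x\<close> lies in the ball of radius
  \<open>2 * s\<close> around \<open>y\<close>, so every plane has at least as large an error there.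
  Dividing by twice the radius halves the threshold.\<close>

lemma bad_set_charge:
  fixes E :: "'a::euclidean_space set"
  assumes "d \<le> DIM('a)" "(x, s) \<in> bad_set d E \<epsilon>" "y \<in> E" "dist x y \<le> s"
  shows "(y, 2 * s) \<in> bad_set d E (\<epsilon> / 2)"
proof (rule ccontr)
  have s: "0 < s" "bilateral_beta d E x s > \<epsilon>" using assms(2) by (simp_all add: bad_set_def)
  assume "(y, 2 * s) \<notin> bad_set d E (\<epsilon> / 2)"
  then have "bilateral_beta d E y (2 * s) < bilateral_beta d E x s / 2"
    using s assms(3) by (simp add: bad_set_def)
  from bilateral_beta_less[OF assms(1) _ this]
  obtain P where P: "P \<in> planes d" "flat_error E y (2 * s) P < bilateral_beta d E x s * s"
    using s(1) by auto
  have "ball x s \<subseteq> ball y (2 * s)"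
  proof
    fix z assume "z \<in> ball x s"
    then show "z \<in> ball y (2 * s)"
      using dist_triangle[of y z x] assms(4) by (simp add: dist_commute)
  qed
  then have "flat_error E x s P < bilateral_beta d E x s * s"
    using flat_error_mono[of x s y "2 * s" E P] P(2) by linarith
  then have "flat_error E x s P / s < bilateral_beta d E x s" using s(1) by (simp add: field_simps)
  moreover have "bilateral_beta d E x s \<le> flat_error E x s P / s"
    using s(1) by (intro bilateral_beta_le[OF P(1)]) auto
  ultimately show False by linarith
qed

section \<open>Comparison on the common part of two regular sets\<close>

definition far_set :: "'a::metric_space set \<Rightarrow> 'a set \<Rightarrow> real \<Rightarrow> ('a \<times> real) set" where
  "far_set E F \<tau> = {(q, s). q \<in> F \<and> 0 < s \<and> (\<exists>x\<in>E. dist q x < s \<and> \<tau> * s < infdist x F)}"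

text \<open>Each \<open>x\<close> contributes an open set of pairs, so the union is open however
  many points \<open>E\<close> has.\<close>

lemma far_set_borel:
  fixes F :: "'a::euclidean_space set"
  assumes "closed F" shows "far_set E F \<tau> \<in> sets borel"
proof -
  let ?O = "\<Union>x\<in>E. {z. dist (fst z) x < snd z} \<inter> {z. \<tau> * snd z < infdist x F}"
  have O: "open ?O"
    by (intro open_UN ballI open_Int open_Collect_less continuous_intros)
  have B: "F \<times> {0::real<..} \<in> sets borel" using assms by (intro borel_Times) auto
  have "far_set E F \<tau> = (F \<times> {0<..}) \<inter> ?O"
    by (auto simp: far_set_def)
  with sets.Int[OF B borel_open[OF O]] show ?thesis by (simp only:)
qed

lemma AE_surf: "E \<in> sets borel \<Longrightarrow> AE x in surf d E. x \<in> E"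
  unfolding surf_def by (subst AE_density) (auto simp: indicator_def split: if_splits)

text \<open>Here \<open>ln (4 / \<tau>)\<close> is the logarithmic length of the scales one point
  accounts for, \<open>16 / \<tau>\<^sup>2\<close> is the square of \<open>4 / \<tau>\<close>,
  \<open>3 ^ d\<close> comes from enlarging the ball, and each \<open>C\<close> from one use of
  regularity.\<close>

definition far_const :: "nat \<Rightarrow> real \<Rightarrow> real \<Rightarrow> real" where
  "far_const d C \<tau> = C ^ 3 * (16 / \<tau>\<^sup>2) ^ d * ln (4 / \<tau>) * 3 ^ d"

text \<open>A pair in the far set is witnessed by a whole ball of \<open>E\<close> of radius
  comparable to \<open>s\<close>, on which the distance \<open>\<delta>\<close> to \<open>F\<close>
  is comparable to \<open>s\<close>. A weight of order \<open>\<delta>\<close> to the power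
  \<open>-d\<close> integrates over it to at least one. Integrating out the scale costs a bounded
  logarithm; integrating out \<open>q\<close> cancels the weight, leaving the measure of one larger
  ball.\<close>

lemma far_set_carleson:
  fixes E F :: "'a::euclidean_space set"
  assumes E: "ahlfors_regular d C E" "1 \<le> C" and F: "closed F" "F \<subseteq> E" and \<tau>: "0 < \<tau>" "\<tau> \<le> 1"
    and p: "p \<in> E" and r: "0 < r"
  shows "(\<integral>\<^sup>+q\<in>ball p r. occ (far_set E F \<tau>) 0 r q \<partial>surf d F) \<le> ennreal (far_const d C \<tau> * r ^ d)"
proof -
  interpret SE: sigma_finite_measure "surf d E" by (rule sigma_finite_surf[OF E(1)])
  have [measurable]: "E \<in> sets borel" by (rule ahlfors_regular_borel[OF E(1)])
  have [measurable]: "F \<in> sets borel" using F(1) by simp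
  \<comment> \<open>\<open>F\<close> itself need not be regular, so sigma-finiteness is inherited
    from \<open>E\<close>.\<close>
  have SF: "sigma_finite_measure (surf d F)"
  proof (rule sigma_finite_measure.intro)
    obtain A where A: "countable A" "A \<subseteq> sets (surf d E)" "\<Union> A = space (surf d E)"
      "\<forall>a\<in>A. emeasure (surf d E) a \<noteq> \<infinity>" using SE.sigma_finite_countable by metis
    have "emeasure (surf d F) a \<noteq> \<infinity>" if "a \<in> A" for a
    proof -
      have "emeasure (surf d F) a \<le> emeasure (surf d E) a"
        using A(2) that F(2) by (intro emeasure_surf_mono) auto
      then show ?thesis using A(4) that by (metis infinity_ennreal_def top.extremum_unique)
    qed
    with A show "\<exists>A. countable A \<and> A \<subseteq> sets (surf d F) \<and> \<Union> A = space (surf d F)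
        \<and> (\<forall>a\<in>A. emeasure (surf d F) a \<noteq> \<infinity>)" by (intro exI[of _ A]) auto
  qed
  interpret SF: sigma_finite_measure "surf d F" by (rule SF)
  interpret LE: pair_sigma_finite log_measure "surf d E" ..
  interpret FE: pair_sigma_finite "surf d F" "surf d E" ..
  define D where "D = far_set E F \<tau>"
  have D: "D \<in> sets borel" unfolding D_def by (rule far_set_borel[OF F(1)])
  define \<delta> where "\<delta> x = infdist x F" for x
  have [measurable]: "\<delta> \<in> borel_measurable borel"
    unfolding \<delta>_def by (intro borel_measurable_continuous_onI continuous_intros)
  have \<delta>0: "0 \<le> \<delta> x" for x by (simp add: \<delta>_def infdist_nonneg)
  \<comment> \<open>On the witness ball \<open>\<delta> x < 2 * s\<close>, so the weight is at least
    \<open>C * (2 / (\<tau> * s)) ^ d\<close>, the reciprocal of the lower bound for the measure of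
    a ball of radius \<open>\<tau> * s / 2\<close>.\<close>
  define w where "w x = ennreal (C * (4 / \<tau>) ^ d / \<delta> x ^ d)" for x
  have [measurable]: "w \<in> borel_measurable borel" unfolding w_def by measurable
  \<comment> \<open>What remains once \<open>s\<close> is integrated out:
    \<open>dist q x < 2 * s\<close>, combined with \<open>s < r\<close> and with
    \<open>s < 2 * \<delta> x / \<tau>\<close>.\<close>
  define U where "U q x \<longleftrightarrow> dist q x < 2 * r \<and> dist q x < 4 * \<delta> x / \<tau>" for q x
  have U_meas [measurable]: "Measurable.pred (borel \<Otimes>\<^sub>M borel) (\<lambda>(q, x). U q x)"
    unfolding U_def by measurable
  have Upos: "0 < \<delta> x" if "U q x" for q x
  proof -
    have "0 < 4 * \<delta> x / \<tau>" using that zero_le_dist[of q x] unfolding U_def by linarith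
    then show ?thesis using \<tau> by (simp add: zero_less_divide_iff)
  qed
  have occ_le: "occ D 0 r q \<le> ennreal (ln (4 / \<tau>)) * (\<integral>\<^sup>+x. w x * indicator {x. U q x} x \<partial>surf d E)" for q
  proof -
    have [measurable]: "Measurable.pred borel (U q)" unfolding U_def by measurable
    let ?J = "\<lambda>x. {\<delta> x / 2 ..< 2 * \<delta> x / \<tau>}"
    have pt: "indicator {s \<in> {0..<r}. (q, s) \<in> D} s
        \<le> (\<integral>\<^sup>+x. w x * indicator {x. U q x} x * indicator (?J x) s \<partial>surf d E)" for s
    proof (cases "s < r \<and> (q, s) \<in> D")
      case True
      then obtain x0 where s: "0 < s" "s < r" "q \<in> F"
        and x0: "x0 \<in> E" "dist q x0 < s" "\<tau> * s < \<delta> x0"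
        by (auto simp: D_def far_set_def \<delta>_def)
      \<comment> \<open>The distance to \<open>F\<close> changes by at most the radius, so it stays
        above \<open>\<tau> * s / 2\<close> on this ball. As \<open>q\<close> lies in
        \<open>F\<close>, it also stays below \<open>2 * s\<close>.\<close>
      define R where "R = \<tau> * s / 2"
      have R: "0 < R" using s \<tau> by (simp add: R_def)
      have "\<tau> * s \<le> 1 * s" using s \<tau> by (intro mult_right_mono) auto
      then have "R \<le> s / 2" by (simp add: R_def)
      have in_ball: "\<tau> * s / 2 < \<delta> x \<and> \<delta> x < 2 * s \<and> U q x \<and> s \<in> ?J x" if "x \<in> ball x0 R" for x
      proof -
        have "\<tau> * s / 2 < \<delta> x"
          using infdist_triangle[of x0 F x] that x0(3) by (simp add: \<delta>_def R_def)
        moreover have qx: "dist q x < 2 * s"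
          using that dist_triangle[of q x x0] x0(2) \<open>R \<le> s / 2\<close> s(1) by simp
        moreover have "\<delta> x \<le> dist q x"
          unfolding \<delta>_def using infdist_le[OF s(3), of x] by (simp add: dist_commute)
        moreover have "2 * s < 4 * \<delta> x / \<tau>" "s < 2 * \<delta> x / \<tau>"
          using \<open>\<tau> * s / 2 < \<delta> x\<close> \<tau> by (simp_all add: field_simps)
        ultimately show ?thesis using s by (auto simp: U_def)
      qed
      have "1 = ennreal (C * (2 / (\<tau> * s)) ^ d) * ennreal (inverse C * R ^ d)"
      proof -
        have "(2 / (\<tau> * s)) ^ d * R ^ d = 1"
          unfolding power_mult_distrib[symmetric] using s \<tau> by (simp add: R_def)
        moreover have "C * (2 / (\<tau> * s)) ^ d * (inverse C * R ^ d)
            = (C * inverse C) * ((2 / (\<tau> * s)) ^ d * R ^ d)" by (simp only: ac_simps)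
        ultimately have "C * (2 / (\<tau> * s)) ^ d * (inverse C * R ^ d) = 1" using E(2) by simp
        moreover have "0 \<le> C * (2 / (\<tau> * s)) ^ d" using E(2) s \<tau> by simp
        ultimately show ?thesis by (metis ennreal_mult' ennreal_1)
      qed
      also have "\<dots> \<le> ennreal (C * (2 / (\<tau> * s)) ^ d) * emeasure (surf d E) (ball x0 R)"
        by (rule mult_left_mono[OF surf_ball_ge[OF E(1) x0(1) R]]) simp
      also have "\<dots> = (\<integral>\<^sup>+x. ennreal (C * (2 / (\<tau> * s)) ^ d) * indicator (ball x0 R) x \<partial>surf d E)"
        by (rule nn_integral_cmult_indicator[symmetric]) simp
      also have "\<dots> \<le> (\<integral>\<^sup>+x. w x * indicator {x. U q x} x * indicator (?J x) s \<partial>surf d E)"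
      proof (intro nn_integral_mono)
        fix x
        show "ennreal (C * (2 / (\<tau> * s)) ^ d) * indicator (ball x0 R) x
            \<le> w x * indicator {x. U q x} x * indicator (?J x) s"
        proof (cases "x \<in> ball x0 R")
          case True
          note b = in_ball[OF True]
          have "0 < \<delta> x" using b s \<tau> by (smt (verit) mult_pos_pos half_gt_zero)
          have "2 / (\<tau> * s) \<le> 4 / \<tau> / \<delta> x"
          proof -
            have "2 / (\<tau> * s) = 4 / \<tau> / (2 * s)" by simp
            also have "\<dots> \<le> 4 / \<tau> / \<delta> x" using b \<open>0 < \<delta> x\<close> \<tau> s
              by (intro divide_left_mono) auto
            finally show ?thesis .
          qed
          then have "(2 / (\<tau> * s)) ^ d \<le> (4 / \<tau> / \<delta> x) ^ d"
            using s \<tau> by (intro power_mono) auto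
          then have "(2 / (\<tau> * s)) ^ d \<le> (4 / \<tau>) ^ d / \<delta> x ^ d"
            by (simp only: power_divide[of "4 / \<tau>" "\<delta> x" d])
          then have "C * (2 / (\<tau> * s)) ^ d \<le> C * ((4 / \<tau>) ^ d / \<delta> x ^ d)"
            using E(2) by (intro mult_left_mono) auto
          then have "ennreal (C * (2 / (\<tau> * s)) ^ d) \<le> w x"
            unfolding w_def times_divide_eq_right by (rule ennreal_leI)
          moreover have "U q x" "s \<in> ?J x" using b by auto
          ultimately show ?thesis using True by (simp only: indicator_simps mem_Collect_eq mult_1_right)
        qed simp
      qed
      finally show ?thesis using True s by (simp add: indicator_def)
    qed (auto simp: indicator_def)
    have "occ D 0 r q = (\<integral>\<^sup>+s. indicator {s \<in> {0..<r}. (q, s) \<in> D} s \<partial>log_measure)"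
      unfolding occ_def using section_borel[OF D, of 0 r q] by (intro nn_integral_indicator[symmetric]) simp
    also have "\<dots> \<le> (\<integral>\<^sup>+s. (\<integral>\<^sup>+x. w x * indicator {x. U q x} x * indicator (?J x) s \<partial>surf d E) \<partial>log_measure)"
      by (intro nn_integral_mono pt)
    also have "\<dots> = (\<integral>\<^sup>+x. (\<integral>\<^sup>+s. w x * indicator {x. U q x} x * indicator (?J x) s \<partial>log_measure) \<partial>surf d E)"
    proof (rule LE.Fubini'[symmetric])
      show "(\<lambda>(s, x). w x * indicator {x. U q x} x * indicator (?J x) s)
          \<in> borel_measurable (log_measure \<Otimes>\<^sub>M surf d E)"
        unfolding indicator_def atLeastLessThan_iff by measurable
    qed
    also have "\<dots> \<le> (\<integral>\<^sup>+x. ennreal (ln (4 / \<tau>)) * (w x * indicator {x. U q x} x) \<partial>surf d E)"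
    proof (intro nn_integral_mono)
      fix x
      have "emeasure log_measure (?J x) \<le> ennreal (ln (4 / \<tau>))" if "U q x"
      proof -
        have pos: "0 < \<delta> x" using Upos[OF that] .
        have "\<delta> x * \<tau> \<le> \<delta> x * 4" using \<tau> pos by (intro mult_left_mono) auto
        then have "\<delta> x / 2 \<le> 2 * \<delta> x / \<tau>" using \<tau> by (simp add: field_simps)
        then have "emeasure log_measure (?J x) = ennreal (ln ((2 * \<delta> x / \<tau>) / (\<delta> x / 2)))"
          using pos by (intro emeasure_log_measure_interval) simp_all
        also have "(2 * \<delta> x / \<tau>) / (\<delta> x / 2) = 4 / \<tau>" using pos \<tau> by (simp add: field_simps)
        finally show ?thesis by simp
      qed
      then have "w x * indicator {x. U q x} x * emeasure log_measure (?J x)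
          \<le> w x * indicator {x. U q x} x * ennreal (ln (4 / \<tau>))"
        by (cases "U q x") (simp_all add: mult_left_mono)
      then show "(\<integral>\<^sup>+s. w x * indicator {x. U q x} x * indicator (?J x) s \<partial>log_measure)
          \<le> ennreal (ln (4 / \<tau>)) * (w x * indicator {x. U q x} x)"
        by (subst nn_integral_cmult_indicator) (simp, simp only: mult.commute)
    qed
    also have "\<dots> = ennreal (ln (4 / \<tau>)) * (\<integral>\<^sup>+x. w x * indicator {x. U q x} x \<partial>surf d E)"
      by (intro nn_integral_cmult) measurable
    finally show ?thesis .
  qed
  \<comment> \<open>The relevant \<open>q\<close> lie within \<open>4 * \<delta> x / \<tau>\<close>
    of \<open>x\<close>; the bound for the mass of that ball carries exactly the power of
    \<open>\<delta> x\<close> by which \<open>w x\<close> divides.\<close>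
  have inner: "(\<integral>\<^sup>+q. w x * indicator {x. U q x} x * indicator (ball p r) q \<partial>surf d F)
      \<le> ennreal (C\<^sup>2 * (16 / \<tau>\<^sup>2) ^ d) * indicator (ball p (3 * r)) x" if "x \<in> E" for x
  proof (cases "0 < \<delta> x \<and> x \<in> ball p (3 * r)")
    case True
    then have pos: "0 < 4 * \<delta> x / \<tau>" using \<tau> by simp
    have "(\<integral>\<^sup>+q. w x * indicator {x. U q x} x * indicator (ball p r) q \<partial>surf d F)
        \<le> (\<integral>\<^sup>+q. w x * indicator (ball x (4 * \<delta> x / \<tau>)) q \<partial>surf d F)"
      by (intro nn_integral_mono) (auto simp: indicator_def U_def dist_commute)
    also have "\<dots> = w x * emeasure (surf d F) (ball x (4 * \<delta> x / \<tau>))"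
      by (rule nn_integral_cmult_indicator) simp
    also have "\<dots> \<le> w x * ennreal (C * (4 * \<delta> x / \<tau>) ^ d)"
      using surf_ball_le[OF E(1) that pos] F(2)
      by (intro mult_left_mono order_trans[OF emeasure_surf_mono[of E F]]) auto
    also have "\<dots> = ennreal (C * (4 / \<tau>) ^ d / \<delta> x ^ d * (C * (4 * \<delta> x / \<tau>) ^ d))"
      unfolding w_def using E(2) \<tau> True by (intro ennreal_mult[symmetric]) auto
    also have "C * (4 / \<tau>) ^ d / \<delta> x ^ d * (C * (4 * \<delta> x / \<tau>) ^ d) = C\<^sup>2 * (16 / \<tau>\<^sup>2) ^ d"
    proof -
      have "(16 / \<tau>\<^sup>2) ^ d = (4 / \<tau>) ^ d * (4 / \<tau>) ^ d"
        unfolding power_mult_distrib[symmetric] by (simp add: power2_eq_square)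
      moreover have "(4 * \<delta> x / \<tau>) ^ d = (4 / \<tau>) ^ d * \<delta> x ^ d"
        unfolding power_mult_distrib[symmetric] by simp
      moreover have "C * A / D * (C * (A * D)) = C\<^sup>2 * (A * A)" if "D \<noteq> 0" for A D
        using that by (simp add: power2_eq_square)
      ultimately show ?thesis using True by (simp add: power2_eq_square)
    qed
    finally have "(\<integral>\<^sup>+q. w x * indicator {x. U q x} x * indicator (ball p r) q \<partial>surf d F)
        \<le> ennreal (C\<^sup>2 * (16 / \<tau>\<^sup>2) ^ d)" .
    moreover have "x \<in> ball p (3 * r)" using True by blast
    ultimately show ?thesis by (simp only: indicator_simps mult_1_right)
  next
    case False
    have "\<not> (U q x \<and> q \<in> ball p r)" for q
    proof
      assume q: "U q x \<and> q \<in> ball p r"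
      then have "0 < \<delta> x" using Upos by blast
      moreover have "dist p x < 3 * r" using q dist_triangle[of p x q] unfolding U_def by simp
      ultimately show False using False by simp
    qed
    then have "w x * indicator {x. U q x} x * indicator (ball p r) q = 0" for q
      by (cases "U q x"; cases "q \<in> ball p r") (simp_all only: indicator_simps mem_Collect_eq, simp_all)
    then have "(\<integral>\<^sup>+q. w x * indicator {x. U q x} x * indicator (ball p r) q \<partial>surf d F)
        = (\<integral>\<^sup>+q. 0 \<partial>surf d F)" by (intro nn_integral_cong)
    also have "\<dots> = 0" by simp
    finally show ?thesis by (simp only: zero_le)
  qed
  have [measurable]: "ball p r \<in> sets borel" by simp
  have AE: "AE x in surf d E. (\<integral>\<^sup>+q. w x * indicator {x. U q x} x * indicator (ball p r) q \<partial>surf d F)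
      \<le> ennreal (C\<^sup>2 * (16 / \<tau>\<^sup>2) ^ d) * indicator (ball p (3 * r)) x"
    using AE_surf[OF \<open>E \<in> sets borel\<close>] by eventually_elim (rule inner)
  have "(\<integral>\<^sup>+q. (\<integral>\<^sup>+x. w x * indicator {x. U q x} x * indicator (ball p r) q \<partial>surf d E) \<partial>surf d F)
     = (\<integral>\<^sup>+x. (\<integral>\<^sup>+q. w x * indicator {x. U q x} x * indicator (ball p r) q \<partial>surf d F) \<partial>surf d E)"
    by (rule FE.Fubini'[symmetric]) measurable
  also have "\<dots> \<le> (\<integral>\<^sup>+x. ennreal (C\<^sup>2 * (16 / \<tau>\<^sup>2) ^ d) * indicator (ball p (3 * r)) x \<partial>surf d E)"
    by (rule nn_integral_mono_AE[OF AE])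
  also have "\<dots> = ennreal (C\<^sup>2 * (16 / \<tau>\<^sup>2) ^ d) * emeasure (surf d E) (ball p (3 * r))"
    by (rule nn_integral_cmult_indicator) simp
  also have "\<dots> \<le> ennreal (C\<^sup>2 * (16 / \<tau>\<^sup>2) ^ d) * ennreal (C * (3 * r) ^ d)"
    using surf_ball_le[OF E(1) p, of "3 * r"] r by (intro mult_left_mono) simp_all
  finally have double: "(\<integral>\<^sup>+q. (\<integral>\<^sup>+x. w x * indicator {x. U q x} x * indicator (ball p r) q \<partial>surf d E) \<partial>surf d F)
      \<le> ennreal (C\<^sup>2 * (16 / \<tau>\<^sup>2) ^ d) * ennreal (C * (3 * r) ^ d)" .
  have "(\<integral>\<^sup>+q\<in>ball p r. occ D 0 r q \<partial>surf d F)
      \<le> (\<integral>\<^sup>+q. ennreal (ln (4 / \<tau>)) * (\<integral>\<^sup>+x. w x * indicator {x. U q x} x * indicator (ball p r) q \<partial>surf d E) \<partial>surf d F)"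
  proof (intro nn_integral_mono)
    fix q
    show "occ D 0 r q * indicator (ball p r) q
        \<le> ennreal (ln (4 / \<tau>)) * (\<integral>\<^sup>+x. w x * indicator {x. U q x} x * indicator (ball p r) q \<partial>surf d E)"
    proof (cases "q \<in> ball p r")
      case True
      then show ?thesis using occ_le[of q] by (simp only: indicator_simps mult_1_right)
    next
      case False
      then have "indicator (ball p r) q = (0::ennreal)" by simp
      then show ?thesis by (simp only: mult_zero_right zero_le)
    qed
  qed
  also have "\<dots> = ennreal (ln (4 / \<tau>)) *
      (\<integral>\<^sup>+q. (\<integral>\<^sup>+x. w x * indicator {x. U q x} x * indicator (ball p r) q \<partial>surf d E) \<partial>surf d F)"
    by (intro nn_integral_cmult) measurable
  also have "\<dots> \<le> ennreal (ln (4 / \<tau>)) * (ennreal (C\<^sup>2 * (16 / \<tau>\<^sup>2) ^ d) * ennreal (C * (3 * r) ^ d))"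
    by (intro mult_left_mono double) simp
  also have "\<dots> = ennreal (ln (4 / \<tau>) * (C\<^sup>2 * (16 / \<tau>\<^sup>2) ^ d * (C * (3 * r) ^ d)))"
    using E(2) \<tau> r by (simp add: ennreal_mult)
  also have "ln (4 / \<tau>) * (C\<^sup>2 * (16 / \<tau>\<^sup>2) ^ d * (C * (3 * r) ^ d)) = far_const d C \<tau> * r ^ d"
    by (simp add: far_const_def power_mult_distrib power2_eq_square power3_eq_cube)
  finally show ?thesis by (simp only: D_def)
qed

text \<open>Put \<open>\<delta> = \<epsilon> / 12\<close> and suppose \<open>(q, 2 * s)\<close>
  avoids all three sets. Points of \<open>E\<close> or \<open>E'\<close> within \<open>2 * s\<close>
  of \<open>q\<close> are then within \<open>2 * \<delta> * s\<close> of the common part, and some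
  plane has error below \<open>3 * \<delta> * s\<close> for \<open>E'\<close>. Passing through the
  common part bounds each one-sided distance between \<open>E\<close> and the plane by
  \<open>5 * \<delta> * s\<close>, in total less than \<open>\<epsilon> * s\<close>.\<close>

lemma bad_set_compare:
  fixes E E' :: "'a::euclidean_space set"
  assumes d: "d \<le> DIM('a)" and \<epsilon>: "0 < \<epsilon>" "\<epsilon> \<le> 1" and cl: "closed E" "closed E'"
    and q: "q \<in> E" "q \<in> E'" and bad: "(q, s) \<in> bad_set d E \<epsilon>"
  shows "(q, 2 * s) \<in> bad_set d E' (\<epsilon> / 12) \<union>
      (far_set E (E \<inter> E') (\<epsilon> / 12) \<union> far_set E' (E \<inter> E') (\<epsilon> / 12))"
proof (rule ccontr)
  define F where "F = E \<inter> E'"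
  define \<delta> where "\<delta> = \<epsilon> / 12"
  assume "\<not> ?thesis"
  then have nb: "(q, 2 * s) \<notin> bad_set d E' \<delta>" "(q, 2 * s) \<notin> far_set E F \<delta>" "(q, 2 * s) \<notin> far_set E' F \<delta>"
    by (simp_all add: F_def \<delta>_def)
  have s: "0 < s" "\<epsilon> < bilateral_beta d E q s" using bad by (simp_all add: bad_set_def)
  have \<delta>: "0 < \<delta>" "12 * \<delta> \<le> 1" "12 * \<delta> = \<epsilon>" using \<epsilon> by (simp_all add: \<delta>_def)
  have \<delta>s: "0 < \<delta> * s" "12 * (\<delta> * s) \<le> s"
    using \<delta> s mult_right_mono[of "12 * \<delta>" 1 s] by simp_all
  have "closed F" "q \<in> F" using closed_Int[OF cl] q by (simp_all add: F_def)
  have near: "infdist x F \<le> 2 * (\<delta> * s)" if "x \<in> E \<or> x \<in> E'" "dist q x < 2 * s" for x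
  proof (rule ccontr)
    assume "\<not> ?thesis"
    then have "\<delta> * (2 * s) < infdist x F" by simp
    then have "(q, 2 * s) \<in> far_set E F \<delta> \<or> (q, 2 * s) \<in> far_set E' F \<delta>"
      using that \<open>q \<in> F\<close> s(1) unfolding far_set_def by auto
    with nb show False by blast
  qed
  have "bilateral_beta d E' q (2 * s) \<le> \<delta>"
    using nb(1) q s(1) by (simp add: bad_set_def)
  \<comment> \<open>The slack yields an actual plane; at scale \<open>2 * s\<close> its error is
    below \<open>3 * \<delta> * s\<close>.\<close>
  then have "bilateral_beta d E' q (2 * s) < 3 / 2 * \<delta>" using \<delta>(1) by linarith
  from bilateral_beta_less[OF d _ this] s(1)
  obtain P where P: "P \<in> planes d" "flat_error E' q (2 * s) P < 3 * (\<delta> * s)" by auto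
  have EP: "infdist x P \<le> 5 * (\<delta> * s)" if "x \<in> ball q s \<inter> E" for x
  proof -
    have nx: "infdist x F \<le> 2 * (\<delta> * s)" using that s(1) by (intro near) auto
    obtain y where y: "y \<in> F" "infdist x F = dist x y"
      using infdist_attains_inf[OF \<open>closed F\<close>] \<open>q \<in> F\<close> by blast
    have "dist q y < 2 * s"
      using dist_triangle[of q y x] that y(2) nx \<delta>s by simp
    then have "infdist y P \<le> flat_error E' q (2 * s) P"
      using y(1) by (intro flat_error_ge1) (simp add: F_def)
    then show ?thesis using infdist_triangle[of x P y] P(2) nx y(2) by linarith
  qed
  have PE: "infdist z E \<le> 5 * (\<delta> * s)" if "z \<in> ball q s \<inter> P" for z
  proof -
    have "infdist z E' \<le> flat_error E' q (2 * s) P"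
      using that s(1) by (intro flat_error_ge2) auto
    then have zE: "infdist z E' \<le> 3 * (\<delta> * s)" using P(2) by linarith
    obtain y where y: "y \<in> E'" "infdist z E' = dist z y"
      using infdist_attains_inf[OF cl(2)] q(2) by blast
    have "dist q y < 2 * s"
      using dist_triangle[of q y z] that y(2) zE \<delta>s by simp
    then have "infdist y F \<le> 2 * (\<delta> * s)" using y(1) by (intro near) auto
    moreover have "infdist z E \<le> infdist z F"
      using \<open>q \<in> F\<close> by (intro infdist_mono) (auto simp: F_def)
    ultimately show ?thesis using infdist_triangle[of z F y] zE y(2) by linarith
  qed
  have "flat_error E q s P \<le> \<epsilon> * s"
  proof (rule flat_error_le)
    have e: "\<epsilon> * s = 12 * (\<delta> * s)" using \<delta>(3) by simp
    show "0 \<le> \<epsilon> * s" using \<epsilon> s by simp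
    fix x assume x: "x \<in> ball q s \<inter> E"
    show "infdist x P \<le> \<epsilon> * s" using EP[OF x] \<delta>s e by linarith
    fix y assume "y \<in> ball q s \<inter> P"
    from PE[OF this] EP[OF x] \<delta>s e show "infdist x P + infdist y E \<le> \<epsilon> * s" by linarith
  qed (use s q in auto)
  then have "bilateral_beta d E q s \<le> \<epsilon>" by (rule bilateral_beta_le[OF P(1) s(1)])
  with s show False by simp
qed

section \<open>Substantial pieces with few bad scales\<close>

text \<open>The mass fraction \<open>c\<close> is the same for all \<open>\<epsilon>\<close>, while
  the budget \<open>\<kappa> \<epsilon>\<close> may vary. Halving \<open>\<epsilon>\<close> thus
  affects only the budgets and not the decay factor obtained later.\<close>

definition good_pieces :: "nat \<Rightarrow> real \<Rightarrow> (real \<Rightarrow> real) \<Rightarrow> 'a::euclidean_space set \<Rightarrow> bool" where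
  "good_pieces d c \<kappa> E \<longleftrightarrow> (\<forall>\<epsilon>\<in>{0<..<1}. \<forall>p\<in>E. \<forall>r>0. \<exists>W\<in>sets borel.
     W \<subseteq> E \<inter> ball p r \<and> ennreal (c * r ^ d) \<le> emeasure (surf d E) W \<and>
     (\<forall>x\<in>W. occ (bad_set d E \<epsilon>) 0 r x \<le> ennreal (\<kappa> \<epsilon>)))"

text \<open>By Chebyshev's inequality \<open>g\<close> exceeds \<open>2 * K / \<theta>\<close> on at
  most half of the guaranteed mass; the remainder is kept.\<close>

lemma chebyshev_piece:
  assumes [measurable]: "g \<in> borel_measurable borel" "B \<in> sets borel" and M: "sets M = sets borel"
    and int: "(\<integral>\<^sup>+x\<in>B. g x \<partial>M) \<le> ennreal (K * m)" and mass: "ennreal (\<theta> * m) \<le> emeasure M B"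
    and pos: "0 < K" "0 < \<theta>" "0 < m"
  shows "ennreal (\<theta> / 2 * m) \<le> emeasure M (B \<inter> {x. g x \<le> ennreal (2 * K / \<theta>)})"
proof -
  have [measurable_cong]: "sets M = sets borel" by (rule M)
  let ?\<kappa> = "ennreal (2 * K / \<theta>)"
  let ?N = "B \<inter> {x. \<not> g x \<le> ?\<kappa>}" and ?W = "B \<inter> {x. g x \<le> ?\<kappa>}"
  have meas: "?N \<in> sets M" "?W \<in> sets M" unfolding M by measurable
  have "?\<kappa> * emeasure M ?N = (\<integral>\<^sup>+x. ?\<kappa> * indicator ?N x \<partial>M)"
    using meas by (intro nn_integral_cmult_indicator[symmetric])
  also have "\<dots> \<le> (\<integral>\<^sup>+x\<in>B. g x \<partial>M)"
    by (intro nn_integral_mono) (auto simp: indicator_def)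
  also have "\<dots> \<le> ennreal (K * m)" by (rule int)
  also have "\<dots> = ?\<kappa> * ennreal (\<theta> / 2 * m)"
    using pos by (simp add: ennreal_mult[symmetric])
  finally have "emeasure M ?N \<le> ennreal (\<theta> / 2 * m)"
    using pos by (subst (asm) ennreal_mult_le_mult_iff) auto
  then have "emeasure M ?N + emeasure M ?W \<le> ennreal (\<theta> / 2 * m) + emeasure M ?W"
    by (rule add_right_mono)
  moreover have "emeasure M B = emeasure M ?N + emeasure M ?W"
    using meas by (subst plus_emeasure) (auto intro!: arg_cong[of _ _ "emeasure M"])
  ultimately have "ennreal (\<theta> * m) \<le> ennreal (\<theta> / 2 * m) + emeasure M ?W"
    using mass by (simp only:)
  moreover have "ennreal (\<theta> * m) = ennreal (\<theta> / 2 * m) + ennreal (\<theta> / 2 * m)"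
    using pos by (simp add: ennreal_plus[symmetric] del: ennreal_plus)
  ultimately have "ennreal (\<theta> / 2 * m) + ennreal (\<theta> / 2 * m) \<le> ennreal (\<theta> / 2 * m) + emeasure M ?W"
    by (simp only:)
  then show ?thesis by (simp only: ennreal_add_left_cancel_le) auto
qed

text \<open>The three sets of \<open>bad_set_compare\<close> are integrated over the common part
  \<open>F\<close>: one by the Carleson hypothesis on \<open>E'\<close>, two by
  \<open>far_set_carleson\<close>. Chebyshev's inequality then selects the piece. The factor
  \<open>2 ^ d\<close> comes from balls of radius \<open>2 * r\<close>.\<close>

lemma good_pieces_of_big_pieces:
  fixes E :: "'a::euclidean_space set" and \<gamma> :: "real \<Rightarrow> real"
  assumes d: "d \<le> DIM('a)" and E: "ahlfors_regular d C E" and C: "1 \<le> C" "1 \<le> C'" and \<theta>: "0 < \<theta>"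
    and \<gamma>: "\<And>\<epsilon>. \<epsilon> \<in> {0<..<1} \<Longrightarrow> 0 < \<gamma> \<epsilon>"
    and big: "\<And>p r. p \<in> E \<Longrightarrow> 0 < r \<Longrightarrow> \<exists>E'. ahlfors_regular d C' E' \<and>
        (\<forall>\<epsilon>\<in>{0<..<1}. carleson_set d (\<gamma> \<epsilon>) E' (bad_set d E' \<epsilon>)) \<and>
        ennreal (\<theta> * r ^ d) \<le> emeasure (hausdorff_measure d) (E \<inter> E' \<inter> ball p r)"
  shows "good_pieces d (\<theta> / 2)
    (\<lambda>\<epsilon>. 2 * ((\<gamma> (\<epsilon> / 12) + (far_const d C (\<epsilon> / 12) + far_const d C' (\<epsilon> / 12))) * 2 ^ d) / \<theta>) E"
  unfolding good_pieces_def
proof (intro ballI allI impI)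
  fix \<epsilon> r :: real and p assume \<epsilon>: "\<epsilon> \<in> {0<..<1}" and p: "p \<in> E" and r: "0 < r"
  define \<delta> where "\<delta> = \<epsilon> / 12"
  have \<delta>: "0 < \<delta>" "\<delta> \<le> 1" "\<delta> \<in> {0<..<1}" using \<epsilon> by (auto simp: \<delta>_def)
  obtain E' where E': "ahlfors_regular d C' E'" and car: "\<And>\<epsilon>. \<epsilon> \<in> {0<..<1} \<Longrightarrow> carleson_set d (\<gamma> \<epsilon>) E' (bad_set d E' \<epsilon>)"
    and mass: "ennreal (\<theta> * r ^ d) \<le> emeasure (hausdorff_measure d) (E \<inter> E' \<inter> ball p r)"
    using big[OF p r] by blast
  define F where "F = E \<inter> E'"
  have cl: "closed E" "closed E'" "closed F"
    using closed_Int[OF ahlfors_regular_closed[OF E] ahlfors_regular_closed[OF E']]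
      ahlfors_regular_closed[OF E] ahlfors_regular_closed[OF E'] by (simp_all add: F_def)
  have [measurable]: "E \<in> sets borel" "E' \<in> sets borel" "F \<in> sets borel" using cl by auto
  have massF: "ennreal (\<theta> * r ^ d) \<le> emeasure (surf d F) (ball p r)"
    using mass by (subst emeasure_surf) (simp_all add: F_def)
  \<comment> \<open>The centre \<open>p\<close> need not lie in \<open>E'\<close>, whose Carleson
    estimate asks for a centre there. Positive mass provides a point of \<open>F\<close> in the
    ball, and doubling the radius around it recovers the ball.\<close>
  have "F \<inter> ball p r \<noteq> {}"
  proof
    assume "F \<inter> ball p r = {}"
    then have "ennreal (\<theta> * r ^ d) \<le> 0" using mass by (simp add: F_def)
    then have "\<theta> * r ^ d \<le> 0" by (simp add: ennreal_eq_0_iff)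
    moreover have "0 < \<theta> * r ^ d" using \<theta> r by simp
    ultimately show False by linarith
  qed
  then obtain p' where p': "p' \<in> F" "p' \<in> ball p r" by blast
  have FE: "F \<subseteq> E" "F \<subseteq> E'" "p' \<in> E" "p' \<in> E'" "0 < 2 * r"
    using p'(1) r by (simp_all add: F_def)
  have sub: "ball p r \<subseteq> ball p' (2 * r)"
  proof
    fix x assume "x \<in> ball p r"
    then show "x \<in> ball p' (2 * r)" using p'(2) dist_triangle[of p' x p] by (simp add: dist_commute)
  qed
  define A1 where "A1 = bad_set d E' \<delta>"
  define A2 where "A2 = far_set E F \<delta>"
  define A3 where "A3 = far_set E' F \<delta>"
  have [measurable]: "A1 \<in> sets borel" "A2 \<in> sets borel" "A3 \<in> sets borel"
    using bad_set_borel[OF cl(2) d] far_set_borel[OF cl(3)] \<delta> by (simp_all add: A1_def A2_def A3_def)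
  have A23: "A2 \<union> A3 \<in> sets borel" by simp
  define g where "g q = occ A1 0 (2 * r) q + (occ A2 0 (2 * r) q + occ A3 0 (2 * r) q)" for q
  have g: "g \<in> borel_measurable borel" unfolding g_def by measurable
  have enl: "(\<integral>\<^sup>+q\<in>ball p r. occ A 0 (2 * r) q \<partial>surf d F)
      \<le> (\<integral>\<^sup>+q\<in>ball p' (2 * r). occ A 0 (2 * r) q \<partial>surf d F)" for A
    using sub by (intro nn_integral_mono mult_left_mono) (auto simp: indicator_def)
  have 1: "(\<integral>\<^sup>+q\<in>ball p r. occ A1 0 (2 * r) q \<partial>surf d F) \<le> ennreal (\<gamma> \<delta> * (2 * r) ^ d)"
  proof -
    have "(\<integral>\<^sup>+q\<in>ball p' (2 * r). occ A1 0 (2 * r) q \<partial>surf d F)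
        \<le> (\<integral>\<^sup>+q\<in>ball p' (2 * r). occ A1 0 (2 * r) q \<partial>surf d E')"
    proof (rule nn_integral_surf_mono)
      have [measurable]: "ball p' (2 * r) \<in> sets borel" by simp
      show "(\<lambda>q. occ A1 0 (2 * r) q * indicator (ball p' (2 * r)) q) \<in> borel_measurable borel"
        by measurable
    qed (simp_all add: F_def)
    also have "\<dots> \<le> ennreal (\<gamma> \<delta> * (2 * r) ^ d)"
      using car[OF \<delta>(3)] FE(4,5) unfolding carleson_set_iff[OF E'] A1_def by blast
    finally show ?thesis using enl[of A1] by (rule order_trans[rotated])
  qed
  have 2: "(\<integral>\<^sup>+q\<in>ball p r. occ A2 0 (2 * r) q \<partial>surf d F) \<le> ennreal (far_const d C \<delta> * (2 * r) ^ d)"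
    unfolding A2_def
    by (rule order_trans[OF enl far_set_carleson[OF E C(1) cl(3) FE(1) \<delta>(1,2) FE(3,5)]])
  have 3: "(\<integral>\<^sup>+q\<in>ball p r. occ A3 0 (2 * r) q \<partial>surf d F) \<le> ennreal (far_const d C' \<delta> * (2 * r) ^ d)"
    unfolding A3_def
    by (rule order_trans[OF enl far_set_carleson[OF E' C(2) cl(3) FE(2) \<delta>(1,2) FE(4,5)]])
  have far0: "0 \<le> far_const d c \<delta>" if "1 \<le> c" for c
    using that \<delta> by (auto simp: far_const_def intro!: mult_nonneg_nonneg)
  define K where "K = (\<gamma> \<delta> + (far_const d C \<delta> + far_const d C' \<delta>)) * 2 ^ d"
  have "0 < \<gamma> \<delta>" using \<gamma>[OF \<delta>(3)] .
  then have K: "0 < K" using far0[OF C(1)] far0[OF C(2)] by (simp add: K_def add_pos_nonneg)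
  have mA: "(\<lambda>q. occ A 0 (2 * r) q * indicator (ball p r) q) \<in> borel_measurable (surf d F)"
    if [measurable]: "A \<in> sets borel" for A
  proof -
    have [measurable]: "ball p r \<in> sets borel" by simp
    show ?thesis by measurable
  qed
  have "(\<integral>\<^sup>+q\<in>ball p r. g q \<partial>surf d F) = (\<integral>\<^sup>+q\<in>ball p r. occ A1 0 (2 * r) q \<partial>surf d F) +
      ((\<integral>\<^sup>+q\<in>ball p r. occ A2 0 (2 * r) q \<partial>surf d F) + (\<integral>\<^sup>+q\<in>ball p r. occ A3 0 (2 * r) q \<partial>surf d F))"
    unfolding g_def distrib_right
    by (simp only: nn_integral_add borel_measurable_add
          mA[OF \<open>A1 \<in> sets borel\<close>] mA[OF \<open>A2 \<in> sets borel\<close>] mA[OF \<open>A3 \<in> sets borel\<close>])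
  also have "\<dots> \<le> ennreal (\<gamma> \<delta> * (2 * r) ^ d) +
      (ennreal (far_const d C \<delta> * (2 * r) ^ d) + ennreal (far_const d C' \<delta> * (2 * r) ^ d))"
    by (intro add_mono 1 2 3)
  also have "\<dots> = ennreal (K * r ^ d)"
    using \<open>0 < \<gamma> \<delta>\<close> far0[OF C(1)] far0[OF C(2)] r
    by (simp add: K_def ennreal_plus[symmetric] power_mult_distrib algebra_simps del: ennreal_plus)
  finally have int: "(\<integral>\<^sup>+q\<in>ball p r. g q \<partial>surf d F) \<le> ennreal (K * r ^ d)" .
  let ?G = "ball p r \<inter> {x. g x \<le> ennreal (2 * K / \<theta>)}"
  let ?W = "F \<inter> ?G"
  have W0: "?G \<in> sets borel" using g by measurable
  show "\<exists>W\<in>sets borel. W \<subseteq> E \<inter> ball p r \<and> ennreal (\<theta> / 2 * r ^ d) \<le> emeasure (surf d E) W \<and>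
      (\<forall>x\<in>W. occ (bad_set d E \<epsilon>) 0 r x \<le> ennreal (2 * ((\<gamma> (\<epsilon> / 12) +
        (far_const d C (\<epsilon> / 12) + far_const d C' (\<epsilon> / 12))) * 2 ^ d) / \<theta>))"
  proof (intro bexI[of _ ?W] conjI ballI)
    show W: "?W \<in> sets borel" by (rule sets.Int[OF \<open>F \<in> sets borel\<close> W0])
    show "?W \<subseteq> E \<inter> ball p r" by (auto simp: F_def)
    have "ennreal (\<theta> / 2 * r ^ d) \<le> emeasure (surf d F) ?G"
      by (rule chebyshev_piece[OF g _ sets_surf int massF K \<theta>]) (use r in simp_all)
    also have "\<dots> = emeasure (surf d E) ?W"
    proof -
      have "E \<inter> ?W = F \<inter> ?G" by (auto simp: F_def)
      then show ?thesis using W W0 by (simp only: emeasure_surf[OF \<open>E \<in> sets borel\<close>] emeasure_surf[OF \<open>F \<in> sets borel\<close>])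
    qed
    finally show "ennreal (\<theta> / 2 * r ^ d) \<le> emeasure (surf d E) ?W" .
    fix x assume x: "x \<in> ?W"
    have "occ (bad_set d E \<epsilon>) 0 r x \<le> occ (A1 \<union> (A2 \<union> A3)) (2 * 0) (2 * r) x"
    proof (rule occ_scale_mono)
      show "A1 \<union> (A2 \<union> A3) \<in> sets borel" by measurable
      fix s assume "(x, s) \<in> bad_set d E \<epsilon>"
      then show "(x, 2 * s) \<in> A1 \<union> (A2 \<union> A3)"
        unfolding A1_def A2_def A3_def F_def \<delta>_def
        using \<epsilon> x by (intro bad_set_compare[OF d _ _ cl(1,2)]) (auto simp: F_def)
    qed simp
    also have "\<dots> \<le> occ A1 0 (2 * r) x + occ (A2 \<union> A3) 0 (2 * r) x"
      using occ_Un_le[OF \<open>A1 \<in> sets borel\<close> A23, of 0 "2 * r" x] by simp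
    also have "\<dots> \<le> g x"
      unfolding g_def by (intro add_left_mono occ_Un_le) measurable
    also have "\<dots> \<le> ennreal (2 * K / \<theta>)" using x by simp
    finally show "occ (bad_set d E \<epsilon>) 0 r x \<le> ennreal (2 * ((\<gamma> (\<epsilon> / 12) +
        (far_const d C (\<epsilon> / 12) + far_const d C' (\<epsilon> / 12))) * 2 ^ d) / \<theta>)"
      by (simp only: K_def \<delta>_def)
  qed
qed

lemma bad_set_pos: "(x, s) \<in> bad_set d E \<epsilon> \<Longrightarrow> 0 < s"
  by (simp add: bad_set_def)

section \<open>From substantial pieces to a Carleson estimate\<close>

text \<open>Subadditivity on the cover, the termwise bound, then additivity on the disjoint sets.
  Two measures are allowed because the cover is later measured with the amount of bad scales as a
  weight.\<close>

lemma emeasure_countable_packing: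
  assumes I: "countable I" and disj: "disjoint_family_on W I"
    and W: "\<And>i. i \<in> I \<Longrightarrow> W i \<in> sets M" and V: "\<And>i. i \<in> I \<Longrightarrow> V i \<in> sets N"
    and le: "\<And>i. i \<in> I \<Longrightarrow> emeasure N (V i) \<le> a * emeasure M (W i)"
    and X: "X \<subseteq> (\<Union>i\<in>I. V i)"
  shows "emeasure N X \<le> a * emeasure M (\<Union>i\<in>I. W i)"
proof -
  define J where "J = to_nat_on I ` I"
  define v where "v n = (if n \<in> J then V (from_nat_into I n) else {})" for n
  define w where "w n = (if n \<in> J then W (from_nat_into I n) else {})" for n
  have fJ: "from_nat_into I n \<in> I" if "n \<in> J" for n
    using that I by (auto simp: J_def)
  have nJ: "\<exists>n\<in>J. from_nat_into I n = i" if "i \<in> I" for i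
    using that I by (auto simp: J_def)
  have UN: "(\<Union>n. v n) = (\<Union>i\<in>I. V i)" "(\<Union>n. w n) = (\<Union>i\<in>I. W i)"
    unfolding v_def w_def using fJ nJ by (fastforce split: if_splits)+
  have sets: "range v \<subseteq> sets N" "range w \<subseteq> sets M"
    using fJ V W by (auto simp: v_def w_def)
  have inj: "from_nat_into I m \<noteq> from_nat_into I n" if "m \<in> J" "n \<in> J" "m \<noteq> n" for m n
    using that I by (auto simp: J_def)
  have disjw: "disjoint_family w"
    unfolding disjoint_family_on_def
  proof (intro ballI impI)
    fix m n :: nat assume "m \<noteq> n"
    then show "w m \<inter> w n = {}"
      using inj[of m n] fJ[of m] fJ[of n] disj by (auto simp: w_def disjoint_family_on_def)
  qed
  have "emeasure N X \<le> emeasure N (\<Union>n. v n)"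
    using X sets(1) unfolding UN(1)[symmetric] by (intro emeasure_mono sets.countable_UN) auto
  also have "\<dots> \<le> (\<Sum>n. emeasure N (v n))"
    by (rule emeasure_subadditive_countably[OF sets(1)])
  also have "\<dots> \<le> (\<Sum>n. a * emeasure M (w n))"
    using le fJ by (intro suminf_le) (auto simp: v_def w_def)
  also have "\<dots> = a * (\<Sum>n. emeasure M (w n))" by simp
  also have "(\<Sum>n. emeasure M (w n)) = emeasure M (\<Union>n. w n)"
    by (rule suminf_emeasure[OF sets(2) disjw])
  finally show ?thesis by (simp only: UN)
qed

text \<open>The radius is the distance to \<open>G\<close> capped at \<open>h\<close>: the open ball
  of this radius avoids \<open>G\<close>, while twice the radius reaches it unless the cap is
  attained. Vitali's lemma is applied with half the radii.\<close>

lemma stopping_cover: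
  fixes X G :: "'a::euclidean_space set"
  assumes h: "0 < h" and sep: "\<And>x. x \<in> X \<Longrightarrow> \<exists>e>0. \<forall>y\<in>G. e \<le> dist x y"
  obtains I \<rho> where "countable I" "I \<subseteq> X" "disjoint_family_on (\<lambda>x. ball x (\<rho> x / 2)) I"
    "X \<subseteq> (\<Union>x\<in>I. cball x (5 / 2 * \<rho> x))"
    "\<And>x. x \<in> X \<Longrightarrow> 0 < \<rho> x \<and> \<rho> x \<le> h"
    "\<And>x y. x \<in> X \<Longrightarrow> y \<in> G \<Longrightarrow> \<rho> x \<le> dist x y"
    "\<And>x. x \<in> X \<Longrightarrow> \<rho> x = h \<or> (\<exists>y\<in>G. dist x y \<le> 2 * \<rho> x)"
proof -
  \<comment> \<open>\<open>infdist\<close> to the empty set is \<open>0\<close> by convention, so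
    that case is given the cap.\<close>
  define \<rho> where "\<rho> x = (if G = {} then h else min (infdist x G) h)" for x
  have pos: "0 < \<rho> x \<and> \<rho> x \<le> h" if xX: "x \<in> X" for x
  proof (cases "G = {}")
    case False
    obtain e where e: "0 < e" "\<And>y. y \<in> G \<Longrightarrow> e \<le> dist x y" using sep[OF xX] by blast
    have "e \<le> infdist x G"
      using False e(2) by (simp add: infdist_def) (rule cINF_greatest)
    then show ?thesis using e(1) h by (simp add: \<rho>_def)
  qed (simp add: \<rho>_def h)
  have low: "\<rho> x \<le> dist x y" if "y \<in> G" for x y
    using that infdist_le[OF that, of x] by (auto simp: \<rho>_def)
  have near: "\<rho> x = h \<or> (\<exists>y\<in>G. dist x y \<le> 2 * \<rho> x)" if "x \<in> X" for x
  proof (cases "\<rho> x = h")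
    case False
    then have G: "G \<noteq> {}" and \<rho>: "\<rho> x = infdist x G" by (auto simp: \<rho>_def min_def split: if_splits)
    have "(INF y\<in>G. dist x y) < 2 * \<rho> x"
      using pos[OF that] G \<rho> by (simp add: infdist_def)
    then have "\<exists>y\<in>G. dist x y < 2 * \<rho> x"
      by (subst (asm) cINF_less_iff) (use G in \<open>auto intro: bdd_belowI2[of _ 0]\<close>)
    then show ?thesis using less_imp_le by blast
  qed simp
  have "X \<subseteq> (\<Union>x\<in>X. cball x (\<rho> x / 2))"
    using pos by (fastforce intro: less_imp_le)
  moreover have "0 < \<rho> x / 2 \<and> \<rho> x / 2 \<le> h / 2" if "x \<in> X" for x
    using pos[OF that] by simp
  ultimately obtain I where I: "countable I" "I \<subseteq> X"
    "pairwise (\<lambda>x y. disjnt (cball x (\<rho> x / 2)) (cball y (\<rho> y / 2))) I"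
    "X \<subseteq> (\<Union>x\<in>I. cball x (5 * (\<rho> x / 2)))"
    by (rule Vitali_covering_lemma_cballs[where a = "\<lambda>x. x" and r = "\<lambda>x. \<rho> x / 2"])
  have "disjoint_family_on (\<lambda>x. ball x (\<rho> x / 2)) I"
    unfolding disjoint_family_on_def
  proof (intro ballI impI)
    fix x y assume "x \<in> I" "y \<in> I" "x \<noteq> y"
    then have "disjnt (cball x (\<rho> x / 2)) (cball y (\<rho> y / 2))" using I(3) by (simp add: pairwise_def)
    then show "ball x (\<rho> x / 2) \<inter> ball y (\<rho> y / 2) = {}"
      using ball_subset_cball unfolding disjnt_def by blast
  qed
  moreover have "X \<subseteq> (\<Union>x\<in>I. cball x (5 / 2 * \<rho> x))" using I(4) by simp
  ultimately show ?thesis using that[OF I(1,2) _ _ pos low near] by blast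
qed

text \<open>Scales are split at \<open>k * \<sigma>\<close>. Those below contribute at most
  \<open>ln k\<close>. Those above are at least the distance to \<open>y\<close> and are charged to
  \<open>y\<close> at doubled scale, costing \<open>L\<close> up to \<open>r\<close> and
  \<open>ln 2\<close> between \<open>r\<close> and \<open>2 * r\<close>.\<close>

lemma occ_charge:
  fixes E :: "'a::euclidean_space set"
  assumes d: "d \<le> DIM('a)" and E: "closed E" and \<epsilon>: "0 \<le> \<epsilon>"
    and r: "0 < r" and \<sigma>: "0 < \<sigma>" "1 \<le> k" and L: "0 \<le> L"
    and near: "r \<le> k * \<sigma> \<or> (\<exists>y\<in>E. dist z y \<le> k * \<sigma> \<and> occ (bad_set d E (\<epsilon> / 2)) 0 r y \<le> ennreal L)"
  shows "occ (bad_set d E \<epsilon>) \<sigma> r z \<le> ennreal (L + ln 2 + ln k)"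
proof -
  let ?A = "bad_set d E \<epsilon>" and ?B = "bad_set d E (\<epsilon> / 2)"
  have A: "?A \<in> sets borel" and B: "?B \<in> sets borel"
    using bad_set_borel[OF E d] \<epsilon> by simp_all
  have "0 \<le> ln k" "0 \<le> ln (2::real)" using \<sigma> by simp_all
  have "\<sigma> \<le> k * \<sigma>" using \<sigma> by simp
  have short: "occ ?A \<sigma> (k * \<sigma>) z \<le> ennreal (ln k)"
    using occ_le_ln[OF \<sigma>(1) \<open>\<sigma> \<le> k * \<sigma>\<close>, of ?A z] \<sigma>(1) by simp
  show ?thesis
  proof (cases "r \<le> k * \<sigma>")
    case True
    have "occ ?A \<sigma> r z \<le> occ ?A \<sigma> (k * \<sigma>) z"
      using True by (intro occ_mono[OF A]) simp
    also note short
    also have "ennreal (ln k) \<le> ennreal (L + ln 2 + ln k)"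
      using L by (intro ennreal_leI) simp
    finally show ?thesis .
  next
    case False
    then obtain y where y: "y \<in> E" "dist z y \<le> k * \<sigma>" "occ ?B 0 r y \<le> ennreal L"
      using near by blast
    have "0 < k * \<sigma>" using \<sigma> by simp
    have "occ ?A (k * \<sigma>) r z \<le> occ ?B (2 * (k * \<sigma>)) (2 * r) y"
    proof (rule occ_scale_mono[OF B])
      fix s assume "k * \<sigma> \<le> s" "s < r" "(z, s) \<in> ?A"
      then show "(y, 2 * s) \<in> ?B"
        using y(2) by (intro bad_set_charge[OF d _ y(1)]) auto
    qed simp
    also have "\<dots> \<le> occ ?B 0 (2 * r) y"
      using \<open>0 < k * \<sigma>\<close> by (intro occ_mono[OF B]) simp
    also have "\<dots> = occ ?B 0 r y + occ ?B r (2 * r) y"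
      using r by (intro occ_split[OF B]) simp_all
    also have "\<dots> \<le> ennreal L + ennreal (ln 2)"
      using occ_le_ln[of r "2 * r" ?B y] r by (intro add_mono y(3)) simp
    finally have "occ ?A (k * \<sigma>) r z \<le> ennreal L + ennreal (ln 2)" .
    then have "occ ?A \<sigma> (k * \<sigma>) z + occ ?A (k * \<sigma>) r z \<le> ennreal (ln k) + (ennreal L + ennreal (ln 2))"
      by (intro add_mono short)
    also have "\<dots> = ennreal (L + ln 2 + ln k)"
      using L \<open>0 \<le> ln k\<close> \<open>0 \<le> ln (2::real)\<close>
      by (simp add: ennreal_plus[symmetric] algebra_simps del: ennreal_plus)
    finally show ?thesis
      using occ_split[OF A \<open>\<sigma> \<le> k * \<sigma>\<close>, of r z] False by simp
  qed
qed

section \<open>Decay of the set of points with many bad scales\<close>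

definition heavy :: "nat \<Rightarrow> 'a::euclidean_space set \<Rightarrow> real \<Rightarrow> real \<Rightarrow> real \<Rightarrow> 'a set" where
  "heavy d E \<epsilon> L r = {x \<in> E. \<not> occ (bad_set d E \<epsilon>) 0 r x \<le> ennreal L}"

lemma heavy_borel:
  fixes E :: "'a::euclidean_space set"
  assumes "d \<le> DIM('a)" "closed E" "0 \<le> \<epsilon>"
  shows "heavy d E \<epsilon> L r \<in> sets borel"
proof -
  have [measurable]: "bad_set d E \<epsilon> \<in> sets borel" by (rule bad_set_borel) fact+
  have [measurable]: "E \<in> sets borel" using assms by simp
  have "heavy d E \<epsilon> L r = E \<inter> {x. \<not> occ (bad_set d E \<epsilon>) 0 r x \<le> ennreal L}"
    by (auto simp: heavy_def)
  also have "\<dots> \<in> sets borel" by measurable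
  finally show ?thesis .
qed

text \<open>If points not heavy for \<open>\<epsilon> / 2\<close> came arbitrarily close to
  \<open>x\<close>, charging with \<open>k = 1\<close> would bound the bad scales of
  \<open>x\<close> above every positive cutoff by \<open>L + ln 2\<close>, hence all of them. The
  separation makes the stopping radii positive.\<close>

lemma heavy_separated:
  fixes E :: "'a::euclidean_space set"
  assumes d: "d \<le> DIM('a)" and E: "closed E" and \<epsilon>: "0 \<le> \<epsilon>" and r: "0 < r"
    and L: "0 \<le> L" "L + ln 2 \<le> L'" and x: "x \<in> heavy d E \<epsilon> L' r"
  shows "\<exists>e>0. \<forall>y\<in>E - heavy d E (\<epsilon> / 2) L r. e \<le> dist x y"
proof (rule ccontr)
  assume no: "\<not> ?thesis"
  have "occ (bad_set d E \<epsilon>) 0 r x \<le> ennreal (L + ln 2 + ln 1)"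
  proof (rule occ_0_le)
    show "bad_set d E \<epsilon> \<in> sets borel" by (rule bad_set_borel) fact+
    fix a :: real assume a: "0 < a"
    then obtain y where "y \<in> E - heavy d E (\<epsilon> / 2) L r" "dist x y < a"
      using no by (meson not_less)
    then show "occ (bad_set d E \<epsilon>) a r x \<le> ennreal (L + ln 2 + ln 1)"
      using a by (intro occ_charge[OF d E \<epsilon> r _ _ L(1)]) (auto simp: heavy_def intro!: bexI[of _ y])
  qed (rule bad_set_pos)
  also have "\<dots> \<le> ennreal L'" using L by (intro ennreal_leI) simp
  finally show False using x by (simp add: heavy_def)
qed

lemma heavy_mono:
  fixes E :: "'a::euclidean_space set"
  assumes d: "d \<le> DIM('a)" and E: "closed E" and \<epsilon>: "0 \<le> \<epsilon>'" "\<epsilon>' \<le> \<epsilon>" and "L' \<le> L"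
  shows "heavy d E \<epsilon> L r \<subseteq> heavy d E \<epsilon>' L' r"
proof
  fix x assume x: "x \<in> heavy d E \<epsilon> L r"
  have "occ (bad_set d E \<epsilon>) 0 r x \<le> occ (bad_set d E \<epsilon>') 0 r x"
    using bad_set_antimono[OF \<epsilon>(2)] by (intro occ_mono bad_set_borel[OF E d \<epsilon>(1)]) auto
  moreover have "ennreal L' \<le> ennreal L" using assms(5) by (rule ennreal_leI)
  ultimately show "x \<in> heavy d E \<epsilon>' L' r"
    using x by (auto simp: heavy_def)
qed

text \<open>The closed ball sits in an open one of radius \<open>3 * \<rho>\<close>, six times the
  radius \<open>\<rho> / 2\<close> of the disjoint balls; hence \<open>6 ^ d\<close>.\<close>

lemma surf_cball_le_packing:
  assumes E: "ahlfors_regular d C E" "1 \<le> C" and x: "x \<in> E" and \<rho>: "0 < \<rho>" and c: "0 < c"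
    and W: "ennreal (c * (\<rho> / 2) ^ d) \<le> w"
  shows "emeasure (surf d E) (cball x (5 / 2 * \<rho>)) \<le> ennreal (C * 6 ^ d / c) * w"
proof -
  have "cball x (5 / 2 * \<rho>) \<subseteq> ball x (3 * \<rho>)" using \<rho> by (auto simp: subset_iff)
  then have "emeasure (surf d E) (cball x (5 / 2 * \<rho>)) \<le> emeasure (surf d E) (ball x (3 * \<rho>))"
    by (intro emeasure_mono) auto
  also have "\<dots> \<le> ennreal (C * (3 * \<rho>) ^ d)"
    using \<rho> by (intro surf_ball_le[OF E(1) x]) simp
  also have "C * (3 * \<rho>) ^ d = C * 6 ^ d / c * (c * (\<rho> / 2) ^ d)"
  proof -
    have "(3 * \<rho>) ^ d = 6 ^ d * (\<rho> / 2) ^ d" unfolding power_mult_distrib[symmetric] by simp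
    then show ?thesis using c by simp
  qed
  also have "ennreal \<dots> = ennreal (C * 6 ^ d / c) * ennreal (c * (\<rho> / 2) ^ d)"
    using E(2) c by (intro ennreal_mult') simp
  also have "\<dots> \<le> ennreal (C * 6 ^ d / c) * w" by (rule mult_left_mono[OF W]) simp
  finally show ?thesis .
qed

text \<open>In each half stopping ball the substantial piece is not heavy for
  \<open>\<epsilon>\<close>: small scales are covered by \<open>\<kappa>\<close>, large ones by
  \<open>occ_charge\<close>. The disjoint pieces lie in \<open>X'\<close> but outside
  \<open>X\<close>, so \<open>X\<close> has at most \<open>b\<close> times the measure of
  \<open>X' - X\<close>, hence at most the fraction \<open>b / (1 + b)\<close> of
  \<open>X'\<close>.\<close>

lemma heavy_decay_step:
  fixes E :: "'a::euclidean_space set"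
  assumes d: "d \<le> DIM('a)" and E: "ahlfors_regular d C E" "1 \<le> C" and c: "0 < c"
    and good: "good_pieces d c \<kappa> E" and \<epsilon>: "\<epsilon> \<in> {0<..<1}" and \<eta>: "0 < \<eta>" "\<eta> \<le> 1"
    and r: "0 < r" and L: "0 \<le> L" and L': "max 0 (\<kappa> \<epsilon>) + (L + ln 2 + ln (5 / \<eta>)) \<le> L'"
    and b: "b = C * 6 ^ d / c"
  shows "emeasure (surf d E) (heavy d E \<epsilon> L' r \<inter> ball p t)
    \<le> ennreal (b / (1 + b)) * emeasure (surf d E) (heavy d E (\<epsilon> / 2) L r \<inter> ball p (t + \<eta> * r))"
proof -
  let ?M = "surf d E"
  let ?A = "bad_set d E \<epsilon>"
  define X where "X = heavy d E \<epsilon> L' r \<inter> ball p t"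
  define X' where "X' = heavy d E (\<epsilon> / 2) L r \<inter> ball p (t + \<eta> * r)"
  define G where "G = E \<inter> ball p (t + \<eta> * r) - X'"
  have cl: "closed E" by (rule ahlfors_regular_closed[OF E(1)])
  have \<epsilon>0: "0 \<le> \<epsilon>" "0 \<le> \<epsilon> / 2" using \<epsilon> by simp_all
  have A: "?A \<in> sets borel" by (rule bad_set_borel[OF cl d \<epsilon>0(1)])
  have b0: "0 < b" using E(2) c by (simp add: b)
  have sets: "X \<in> sets borel" "X' \<in> sets borel"
    using heavy_borel[OF d cl \<epsilon>0(1)] heavy_borel[OF d cl \<epsilon>0(2)] by (simp_all add: X_def X'_def)
  have ln: "0 \<le> ln (5 / \<eta>)" "0 \<le> ln (2::real)" using \<eta> by simp_all
  have XE: "X \<subseteq> E" "G \<subseteq> E" by (auto simp: X_def G_def heavy_def)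
  have Gocc: "occ (bad_set d E (\<epsilon> / 2)) 0 r y \<le> ennreal L" if "y \<in> G" for y
    using that by (auto simp: G_def X'_def heavy_def)
  have h: "0 < \<eta> * r" "\<eta> * r \<le> r" using \<eta> r by simp_all
  have sep: "\<exists>e>0. \<forall>y\<in>G. e \<le> dist x y" if "x \<in> X" for x
  proof -
    have "x \<in> heavy d E \<epsilon> L' r" using that by (simp add: X_def)
    moreover have "L + ln 2 \<le> L'" using L' ln by linarith
    ultimately have "\<exists>e>0. \<forall>y\<in>E - heavy d E (\<epsilon> / 2) L r. e \<le> dist x y"
      by (intro heavy_separated[OF d cl \<epsilon>0(1) r L])
    moreover have "G \<subseteq> E - heavy d E (\<epsilon> / 2) L r" by (auto simp: G_def X'_def)
    ultimately show ?thesis by blast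
  qed
  obtain I \<rho> where I: "countable I" "I \<subseteq> X"
    and disj: "disjoint_family_on (\<lambda>x. ball x (\<rho> x / 2)) I"
    and cov: "X \<subseteq> (\<Union>x\<in>I. cball x (5 / 2 * \<rho> x))"
    and \<rho>: "\<And>x. x \<in> X \<Longrightarrow> 0 < \<rho> x \<and> \<rho> x \<le> \<eta> * r"
    and low: "\<And>x y. x \<in> X \<Longrightarrow> y \<in> G \<Longrightarrow> \<rho> x \<le> dist x y"
    and near: "\<And>x. x \<in> X \<Longrightarrow> \<rho> x = \<eta> * r \<or> (\<exists>y\<in>G. dist x y \<le> 2 * \<rho> x)"
    by (rule stopping_cover[OF h(1) sep]) (assumption, rule that)
  have "\<forall>x\<in>I. \<exists>W\<in>sets borel. W \<subseteq> E \<inter> ball x (\<rho> x / 2) \<and>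
      ennreal (c * (\<rho> x / 2) ^ d) \<le> emeasure ?M W \<and> (\<forall>z\<in>W. occ ?A 0 (\<rho> x / 2) z \<le> ennreal (\<kappa> \<epsilon>))"
  proof
    fix x assume "x \<in> I"
    then have "x \<in> E" "0 < \<rho> x / 2" using I(2) XE \<rho>[of x] by auto
    with good \<epsilon> show "\<exists>W\<in>sets borel. W \<subseteq> E \<inter> ball x (\<rho> x / 2) \<and>
      ennreal (c * (\<rho> x / 2) ^ d) \<le> emeasure ?M W \<and> (\<forall>z\<in>W. occ ?A 0 (\<rho> x / 2) z \<le> ennreal (\<kappa> \<epsilon>))"
      unfolding good_pieces_def by blast
  qed
  from bchoice[OF this[unfolded Bex_def]] obtain W where
    W: "\<And>x. x \<in> I \<Longrightarrow> W x \<in> sets borel" "\<And>x. x \<in> I \<Longrightarrow> W x \<subseteq> E \<inter> ball x (\<rho> x / 2)"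
      "\<And>x. x \<in> I \<Longrightarrow> ennreal (c * (\<rho> x / 2) ^ d) \<le> emeasure ?M (W x)"
      "\<And>x z. x \<in> I \<Longrightarrow> z \<in> W x \<Longrightarrow> occ ?A 0 (\<rho> x / 2) z \<le> ennreal (\<kappa> \<epsilon>)"
    by blast
  have WX: "W x \<subseteq> X' - X" if x: "x \<in> I" for x
  proof
    fix z assume z: "z \<in> W x"
    have xX: "x \<in> X" using I(2) x by blast
    have zE: "z \<in> E" and xz: "dist x z < \<rho> x / 2" using W(2)[OF x] z by auto
    have \<rho>x: "0 < \<rho> x" "\<rho> x \<le> \<eta> * r" using \<rho>[OF xX] by simp_all
    have "dist p x < t" using xX by (simp add: X_def)
    then have "dist p z < t + \<eta> * r" using dist_triangle[of p z x] xz \<rho>x by linarith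
    moreover have "z \<notin> G" using low[OF xX, of z] xz \<rho>x by linarith
    ultimately have "z \<in> X'" using zE by (simp add: G_def)
    moreover have "z \<notin> X"
    proof -
      \<comment> \<open>The factor \<open>5 / \<eta>\<close> serves both cases. If the cap
        \<open>\<eta> * r\<close> is attained, it carries \<open>\<rho> x / 2\<close> beyond
        \<open>r\<close>; otherwise \<open>y\<close> is half a radius plus two radii away, that is
        \<open>5 * (\<rho> x / 2)\<close>.\<close>
      have far: "occ ?A (\<rho> x / 2) r z \<le> ennreal (L + ln 2 + ln (5 / \<eta>))"
      proof (rule occ_charge[OF d cl \<epsilon>0(1) r _ _ L])
        show "r \<le> 5 / \<eta> * (\<rho> x / 2) \<or> (\<exists>y\<in>E. dist z y \<le> 5 / \<eta> * (\<rho> x / 2)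
            \<and> occ (bad_set d E (\<epsilon> / 2)) 0 r y \<le> ennreal L)"
        proof (cases "\<rho> x = \<eta> * r")
          case True
          then show ?thesis using \<eta> r by simp
        next
          case False
          then obtain y where y: "y \<in> G" "dist x y \<le> 2 * \<rho> x" using near[OF xX] by blast
          have "dist z y \<le> dist x z + dist x y"
            using dist_triangle[of z y x] by (simp add: dist_commute)
          also have "\<dots> \<le> 5 * (\<rho> x / 2)" using xz y(2) by simp
          also have "\<dots> \<le> 5 / \<eta> * (\<rho> x / 2)"
            using \<eta> \<rho>x by (intro mult_right_mono) (simp_all add: field_simps)
          finally show ?thesis using y(1) XE(2) Gocc by blast
        qed
      qed (use \<rho>x \<eta> in simp_all)
      have "occ ?A 0 r z = occ ?A 0 (\<rho> x / 2) z + occ ?A (\<rho> x / 2) r z"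
        using \<rho>x h(2) by (intro occ_split[OF A]) linarith+
      also have "\<dots> \<le> ennreal (\<kappa> \<epsilon>) + ennreal (L + ln 2 + ln (5 / \<eta>))"
        by (intro add_mono W(4)[OF x z] far)
      \<comment> \<open>\<open>ennreal\<close> sends negative numbers to zero; the maximum makes it
        additive here even if \<open>\<kappa> \<epsilon>\<close> is negative.\<close>
      also have "\<dots> \<le> ennreal (max 0 (\<kappa> \<epsilon>)) + ennreal (L + ln 2 + ln (5 / \<eta>))"
        by (intro add_right_mono ennreal_leI) simp
      also have "\<dots> = ennreal (max 0 (\<kappa> \<epsilon>) + (L + ln 2 + ln (5 / \<eta>)))"
        using L ln by (intro ennreal_plus[symmetric]) auto
      also have "\<dots> \<le> ennreal L'" by (rule ennreal_leI[OF L'])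
      finally show ?thesis by (simp add: X_def heavy_def)
    qed
    ultimately show "z \<in> X' - X" by blast
  qed
  have "emeasure ?M X \<le> ennreal b * emeasure ?M (\<Union>x\<in>I. W x)"
  proof (rule emeasure_countable_packing[OF I(1)])
    show "disjoint_family_on W I"
      unfolding disjoint_family_on_def
    proof (intro ballI impI)
      fix x y assume xy: "x \<in> I" "y \<in> I" "x \<noteq> y"
      then have "ball x (\<rho> x / 2) \<inter> ball y (\<rho> y / 2) = {}"
        using disj by (simp add: disjoint_family_on_def)
      then show "W x \<inter> W y = {}" using W(2)[OF xy(1)] W(2)[OF xy(2)] by blast
    qed
    show "emeasure ?M (cball x (5 / 2 * \<rho> x)) \<le> ennreal b * emeasure ?M (W x)" if "x \<in> I" for x
      unfolding b using that I(2) XE \<rho>[of x] by (intro surf_cball_le_packing E c W(3)) auto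
  qed (use W(1) cov in auto)
  also have "\<dots> \<le> ennreal b * emeasure ?M (X' - X)"
    using WX sets by (intro mult_left_mono emeasure_mono) auto
  finally have le: "emeasure ?M X \<le> ennreal b * emeasure ?M (X' - X)" .
  have "L \<le> L'" using L' ln by linarith
  then have "heavy d E \<epsilon> L' r \<subseteq> heavy d E (\<epsilon> / 2) L r"
    using \<epsilon> by (intro heavy_mono[OF d cl \<epsilon>0(2)]) auto
  then have XX': "X \<subseteq> X'" using h(1) by (auto simp: X_def X'_def)
  have split: "emeasure ?M X' = emeasure ?M X + emeasure ?M (X' - X)"
    using sets XX' by (subst plus_emeasure) (auto intro!: arg_cong[of _ _ "emeasure ?M"])
  \<comment> \<open>Splitting the measure of \<open>X\<close> into two complementary fractions
    avoids a subtraction of possibly infinite values.\<close>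
  have "emeasure ?M X = (ennreal (b / (1 + b)) + ennreal (1 / (1 + b))) * emeasure ?M X"
    using b0 by (simp add: ennreal_plus[symmetric] add_divide_distrib[symmetric] add.commute del: ennreal_plus)
  also have "\<dots> \<le> ennreal (b / (1 + b)) * emeasure ?M X
      + ennreal (1 / (1 + b)) * (ennreal b * emeasure ?M (X' - X))"
    unfolding distrib_right by (intro add_left_mono mult_left_mono le) simp
  also have "ennreal (1 / (1 + b)) * (ennreal b * emeasure ?M (X' - X)) = ennreal (b / (1 + b)) * emeasure ?M (X' - X)"
    using b0 by (simp add: mult.assoc[symmetric] ennreal_mult[symmetric])
  finally show ?thesis
    unfolding split[unfolded X'_def] X_def[symmetric] X'_def[symmetric] split distrib_left .
qed

text \<open>Each step halves \<open>\<epsilon>\<close>, enlarges the ball by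
  \<open>\<eta> * r\<close> and gains the same factor, as \<open>b\<close> does not involve
  \<open>\<epsilon>\<close>. The threshold \<open>L\<close> is chosen before \<open>E\<close>, which
  keeps the final constant uniform.\<close>

lemma heavy_decay:
  fixes C c :: real and \<kappa> :: "real \<Rightarrow> real"
  assumes d: "d \<le> DIM('a::euclidean_space)" and C: "1 \<le> C" and c: "0 < c" and \<eta>: "0 < \<eta>" "\<eta> \<le> 1"
    and b: "b = C * 6 ^ d / c"
  shows "\<epsilon> \<in> {0<..<1} \<Longrightarrow> \<exists>L\<ge>0. \<forall>E :: 'a set. ahlfors_regular d C E \<longrightarrow> good_pieces d c \<kappa> E \<longrightarrow>
    (\<forall>p t r. 0 < r \<longrightarrow> emeasure (surf d E) (heavy d E \<epsilon> L r \<inter> ball p t)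
      \<le> ennreal ((b / (1 + b)) ^ j) * emeasure (surf d E) (ball p (t + j * \<eta> * r)))"
proof (induction j arbitrary: \<epsilon>)
  case 0
  have "emeasure (surf d E) (heavy d E \<epsilon> 0 r \<inter> ball p t) \<le> emeasure (surf d E) (ball p t)"
    for E :: "'a set" and p t r
    by (intro emeasure_mono) auto
  then show ?case by (intro exI[of _ 0]) simp
next
  case (Suc j)
  then have "\<epsilon> / 2 \<in> {0<..<1}" by simp
  from Suc.IH[OF this] obtain L where L: "0 \<le> L" and IH: "\<And>(E :: 'a set) p t r.
      ahlfors_regular d C E \<Longrightarrow> good_pieces d c \<kappa> E \<Longrightarrow> 0 < r \<Longrightarrow>
      emeasure (surf d E) (heavy d E (\<epsilon> / 2) L r \<inter> ball p t)
      \<le> ennreal ((b / (1 + b)) ^ j) * emeasure (surf d E) (ball p (t + j * \<eta> * r))"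
    by blast
  define L' where "L' = max 0 (\<kappa> \<epsilon>) + (L + ln 2 + ln (5 / \<eta>))"
  have "0 \<le> ln (5 / \<eta>)" using \<eta> by simp
  then have "0 \<le> L'" using L by (simp add: L'_def)
  have b0: "0 < b" using C c by (simp add: b)
  show ?case
  proof (intro exI[of _ L'] conjI allI impI)
    fix E :: "'a set" and p t and r :: real
    assume E: "ahlfors_regular d C E" "good_pieces d c \<kappa> E" and r: "0 < r"
    have "emeasure (surf d E) (heavy d E \<epsilon> L' r \<inter> ball p t)
      \<le> ennreal (b / (1 + b)) * emeasure (surf d E) (heavy d E (\<epsilon> / 2) L r \<inter> ball p (t + \<eta> * r))"
      by (rule heavy_decay_step[OF d E(1) C c E(2) Suc.prems \<eta> r L _ b]) (simp add: L'_def)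
    also have "\<dots> \<le> ennreal (b / (1 + b)) * (ennreal ((b / (1 + b)) ^ j)
        * emeasure (surf d E) (ball p (t + \<eta> * r + j * \<eta> * r)))"
      by (intro mult_left_mono IH E r) simp
    also have "\<dots> = ennreal ((b / (1 + b)) ^ Suc j) * emeasure (surf d E) (ball p (t + real (Suc j) * \<eta> * r))"
    proof -
      have "t + \<eta> * r + j * \<eta> * r = t + real (Suc j) * \<eta> * r" by (simp add: algebra_simps)
      moreover have "ennreal (b / (1 + b)) * ennreal ((b / (1 + b)) ^ j) = ennreal ((b / (1 + b)) ^ Suc j)"
        using b0 by (simp add: ennreal_mult[symmetric])
      ultimately show ?thesis by (simp only: mult.assoc[symmetric])
    qed
    finally show "emeasure (surf d E) (heavy d E \<epsilon> L' r \<inter> ball p t)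
      \<le> ennreal ((b / (1 + b)) ^ Suc j) * emeasure (surf d E) (ball p (t + real (Suc j) * \<eta> * r))" .
  qed (rule \<open>0 \<le> L'\<close>)
qed

lemma surf_mono_on:
  assumes "E \<in> sets borel" "A \<in> sets borel" "B \<in> sets borel" "E \<inter> A \<subseteq> B"
  shows "emeasure (surf d E) A \<le> emeasure (surf d E) B"
  unfolding emeasure_surf[OF assms(1,2)] emeasure_surf[OF assms(1,3)]
  using assms by (intro emeasure_mono) auto

section \<open>The Carleson estimate by induction on the scale\<close>

text \<open>Discarding scales below \<open>\<delta>\<close> lets the induction start with an empty
  range. Outside the heavy set the count is at most \<open>K\<close>. On it, stopping balls tripled
  to radius at most \<open>r / 2\<close> take the induction hypothesis for small scales and
  \<open>occ_charge\<close> for large ones. By \<open>small\<close> the half balls have so little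
  total mass that only half of the resulting bound remains.\<close>

lemma truncated_carleson:
  fixes E :: "'a::euclidean_space set"
  assumes d: "d \<le> DIM('a)" and E: "ahlfors_regular d C E" "1 \<le> C" and \<epsilon>: "\<epsilon> \<in> {0<..<1}"
    and L: "0 \<le> L" and a: "0 \<le> a" "6 ^ d * C * a \<le> 1 / 2"
    and small: "\<And>p r. p \<in> E \<Longrightarrow> 0 < r \<Longrightarrow>
      emeasure (surf d E) (heavy d E (\<epsilon> / 2) L r \<inter> ball p (2 * r)) \<le> ennreal (a * r ^ d)"
    and \<delta>: "0 < \<delta>" and K: "K = L + ln 2 + ln 2"
  shows "p \<in> E \<Longrightarrow> 0 < r \<Longrightarrow> r \<le> \<delta> * 2 ^ k \<Longrightarrow>
    (\<integral>\<^sup>+x\<in>ball p r. occ (bad_set d E \<epsilon>) \<delta> r x \<partial>surf d E) \<le> ennreal (3 * K * C * r ^ d)"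
proof (induction k arbitrary: p r)
  case 0
  then show ?case by (simp add: occ_empty_interval)
next
  case (Suc k)
  let ?M = "surf d E" and ?A = "bad_set d E \<epsilon>"
  note p = \<open>p \<in> E\<close> and r = \<open>0 < r\<close>
  have cl: "closed E" by (rule ahlfors_regular_closed[OF E(1)])
  have \<epsilon>0: "0 \<le> \<epsilon>" "0 \<le> \<epsilon> / 2" using \<epsilon> by simp_all
  have Eb [measurable]: "E \<in> sets borel" using cl by simp
  have A [measurable]: "?A \<in> sets borel" by (rule bad_set_borel[OF cl d \<epsilon>0(1)])
  have K0: "0 \<le> K" using L by (simp add: K)
  define X where "X = heavy d E \<epsilon> K r \<inter> ball p r"
  define X' where "X' = heavy d E (\<epsilon> / 2) L r \<inter> ball p (2 * r)"
  define G where "G = E \<inter> ball p (2 * r) - X'"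
  have sets [measurable]: "X \<in> sets borel" "X' \<in> sets borel"
    using heavy_borel[OF d cl \<epsilon>0(1)] heavy_borel[OF d cl \<epsilon>0(2)] by (simp_all add: X_def X'_def)
  have XE: "X \<subseteq> E" "G \<subseteq> E" by (auto simp: X_def G_def heavy_def)
  have Gocc: "occ (bad_set d E (\<epsilon> / 2)) 0 r y \<le> ennreal L" if "y \<in> G" for y
    using that by (auto simp: G_def X'_def heavy_def)
  have h: "0 < r / 6" using r by simp
  have sep: "\<exists>e>0. \<forall>y\<in>G. e \<le> dist x y" if "x \<in> X" for x
  proof -
    have "x \<in> heavy d E \<epsilon> K r" using that by (simp add: X_def)
    moreover have "L + ln 2 \<le> K" by (simp add: K)
    ultimately have "\<exists>e>0. \<forall>y\<in>E - heavy d E (\<epsilon> / 2) L r. e \<le> dist x y"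
      by (intro heavy_separated[OF d cl \<epsilon>0(1) r L])
    moreover have "G \<subseteq> E - heavy d E (\<epsilon> / 2) L r" by (auto simp: G_def X'_def)
    ultimately show ?thesis by blast
  qed
  obtain I \<rho> where I: "countable I" "I \<subseteq> X"
    and disj: "disjoint_family_on (\<lambda>x. ball x (\<rho> x / 2)) I"
    and cov: "X \<subseteq> (\<Union>x\<in>I. cball x (5 / 2 * \<rho> x))"
    and \<rho>: "\<And>x. x \<in> X \<Longrightarrow> 0 < \<rho> x \<and> \<rho> x \<le> r / 6"
    and low: "\<And>x y. x \<in> X \<Longrightarrow> y \<in> G \<Longrightarrow> \<rho> x \<le> dist x y"
    and near: "\<And>x. x \<in> X \<Longrightarrow> \<rho> x = r / 6 \<or> (\<exists>y\<in>G. dist x y \<le> 2 * \<rho> x)"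
    by (rule stopping_cover[OF h sep]) (assumption, rule that)
  define f where "f x = occ ?A \<delta> r x" for x
  have f [measurable]: "f \<in> borel_measurable borel" unfolding f_def by measurable
  \<comment> \<open>The density \<open>f\<close> turns the integral over the cover into a measure,
    to which the packing lemma applies.\<close>
  define N where "N = density ?M f"
  have setsN: "sets N = sets borel" by (simp add: N_def)
  have N: "emeasure N B = (\<integral>\<^sup>+x\<in>B. f x \<partial>?M)" if "B \<in> sets borel" for B
    using that unfolding N_def by (subst emeasure_density) (simp_all add: f)
  define T where "T = 3 * K * C"
  have T0: "0 \<le> T" using K0 E(2) by (simp add: T_def)
  have piece: "emeasure N (cball x (5 / 2 * \<rho> x)) \<le> ennreal ((T + K * C) * 6 ^ d * C) * emeasure ?M (ball x (\<rho> x / 2))"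
    if "x \<in> I" for x
  proof -
    have xX: "x \<in> X" using I(2) that by blast
    then have xE: "x \<in> E" using XE by blast
    \<comment> \<open>Three radii contain the closed ball of the cover. By the cap
      \<open>r / 6\<close> they are at most \<open>r / 2\<close>, in reach of the induction
      hypothesis. Doubled, they equal \<open>r\<close> if the cap is attained and exceed
      \<open>dist z y\<close> otherwise.\<close>
    define \<sigma> where "\<sigma> = 3 * \<rho> x"
    have \<rho>x: "0 < \<rho> x" "\<rho> x \<le> r / 6" using \<rho>[OF xX] by simp_all
    have \<sigma>: "0 < \<sigma>" "\<sigma> \<le> r / 2" using \<rho>x by (simp_all add: \<sigma>_def)
    have pt: "f z * indicator (cball x (5 / 2 * \<rho> x)) z
        \<le> occ ?A \<delta> \<sigma> z * indicator (ball x \<sigma>) z + ennreal K * indicator (ball x \<sigma>) z" if z: "z \<in> E" for z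
    proof (cases "z \<in> cball x (5 / 2 * \<rho> x)")
      case True
      then have xz: "dist x z \<le> 5 / 2 * \<rho> x" by simp
      then have "z \<in> ball x \<sigma>" using \<rho>x by (simp add: \<sigma>_def)
      have far: "occ ?A \<sigma> r z \<le> ennreal (L + ln 2 + ln 2)"
      proof (rule occ_charge[OF d cl \<epsilon>0(1) r _ _ L])
        show "r \<le> 2 * \<sigma> \<or> (\<exists>y\<in>E. dist z y \<le> 2 * \<sigma>
            \<and> occ (bad_set d E (\<epsilon> / 2)) 0 r y \<le> ennreal L)"
        proof (cases "\<rho> x = r / 6")
          case True
          then show ?thesis by (simp add: \<sigma>_def)
        next
          case False
          then obtain y where y: "y \<in> G" "dist x y \<le> 2 * \<rho> x" using near[OF xX] by blast
          have "dist z y \<le> 2 * \<sigma>"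
            using dist_triangle[of z y x] xz y(2) \<rho>x by (simp add: dist_commute \<sigma>_def)
          then show ?thesis using y(1) XE(2) Gocc by blast
        qed
      qed (use \<sigma> in simp_all)
      have "f z \<le> occ ?A \<delta> \<sigma> z + occ ?A \<sigma> r z"
      proof (cases "\<delta> \<le> \<sigma>")
        case True
        then show ?thesis using \<sigma> occ_split[OF A True, of r z] by (simp add: f_def)
      next
        case False
        have "f z \<le> occ ?A \<sigma> r z" unfolding f_def using False by (intro occ_mono[OF A]) simp
        then show ?thesis by (rule order_trans) simp
      qed
      also have "\<dots> \<le> occ ?A \<delta> \<sigma> z + ennreal K" unfolding K by (rule add_left_mono[OF far])
      finally show ?thesis using True \<open>z \<in> ball x \<sigma>\<close> by (simp only: indicator_simps mult_1_right)
    next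
      case False
      then have "indicator (cball x (5 / 2 * \<rho> x)) z = (0::ennreal)" by simp
      then show ?thesis by (simp only: mult_zero_right zero_le)
    qed
    have "emeasure N (cball x (5 / 2 * \<rho> x)) = (\<integral>\<^sup>+z\<in>cball x (5 / 2 * \<rho> x). f z \<partial>?M)" by (intro N) simp
    also have "\<dots> \<le> (\<integral>\<^sup>+z. occ ?A \<delta> \<sigma> z * indicator (ball x \<sigma>) z + ennreal K * indicator (ball x \<sigma>) z \<partial>?M)"
    proof (rule nn_integral_mono_AE)
      show "AE z in ?M. f z * indicator (cball x (5 / 2 * \<rho> x)) z
          \<le> occ ?A \<delta> \<sigma> z * indicator (ball x \<sigma>) z + ennreal K * indicator (ball x \<sigma>) z"
        using AE_surf[OF Eb, of d] by eventually_elim (rule pt)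
    qed
    also have "\<dots> = (\<integral>\<^sup>+z\<in>ball x \<sigma>. occ ?A \<delta> \<sigma> z \<partial>?M) + (\<integral>\<^sup>+z. ennreal K * indicator (ball x \<sigma>) z \<partial>?M)"
    proof (rule nn_integral_add)
      have [measurable]: "ball x \<sigma> \<in> sets borel" by simp
      show "(\<lambda>z. occ ?A \<delta> \<sigma> z * indicator (ball x \<sigma>) z) \<in> borel_measurable ?M"
        "(\<lambda>z. ennreal K * indicator (ball x \<sigma>) z) \<in> borel_measurable ?M" by measurable
    qed
    also have "(\<integral>\<^sup>+z. ennreal K * indicator (ball x \<sigma>) z \<partial>?M) = ennreal K * emeasure ?M (ball x \<sigma>)"
      by (rule nn_integral_cmult_indicator) simp
    also have "(\<integral>\<^sup>+z\<in>ball x \<sigma>. occ ?A \<delta> \<sigma> z \<partial>?M) + ennreal K * emeasure ?M (ball x \<sigma>)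
        \<le> ennreal (T * \<sigma> ^ d) + ennreal K * ennreal (C * \<sigma> ^ d)"
    proof (intro add_mono mult_left_mono surf_ball_le[OF E(1) xE \<sigma>(1)])
      show "(\<integral>\<^sup>+z\<in>ball x \<sigma>. occ ?A \<delta> \<sigma> z \<partial>?M) \<le> ennreal (T * \<sigma> ^ d)"
        unfolding T_def using Suc.prems(3) \<sigma> by (intro Suc.IH[OF xE]) simp_all
    qed simp
    also have "\<dots> = ennreal ((T + K * C) * \<sigma> ^ d)"
      using K0 E(2) T0 \<sigma> by (simp add: ennreal_mult[symmetric] ennreal_plus[symmetric] distrib_right del: ennreal_plus)
    also have "(T + K * C) * \<sigma> ^ d = (T + K * C) * 6 ^ d * C * (inverse C * (\<rho> x / 2) ^ d)"
    proof -
      have "\<sigma> ^ d = 6 ^ d * (\<rho> x / 2) ^ d"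
        unfolding \<sigma>_def power_mult_distrib[symmetric] by simp
      then show ?thesis using E(2) by simp
    qed
    also have "ennreal \<dots> = ennreal ((T + K * C) * 6 ^ d * C) * ennreal (inverse C * (\<rho> x / 2) ^ d)"
      using K0 E(2) T0 by (intro ennreal_mult') simp
    also have "\<dots> \<le> ennreal ((T + K * C) * 6 ^ d * C) * emeasure ?M (ball x (\<rho> x / 2))"
      using \<rho>x by (intro mult_left_mono surf_ball_ge[OF E(1) xE]) simp_all
    finally show ?thesis .
  qed
  have "emeasure N X \<le> ennreal ((T + K * C) * 6 ^ d * C) * emeasure ?M (\<Union>x\<in>I. ball x (\<rho> x / 2))"
    by (rule emeasure_countable_packing[OF I(1) disj _ _ piece cov]) (simp_all add: setsN)
  also have "\<dots> \<le> ennreal ((T + K * C) * 6 ^ d * C) * emeasure ?M X'"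
  proof (intro mult_left_mono surf_mono_on Eb sets(2))
    \<comment> \<open>The half balls avoid \<open>G\<close> and stay in the ball of radius
      \<open>2 * r\<close>, so their points of \<open>E\<close> belong to \<open>X'\<close>, whose
      measure is small.\<close>
    show "E \<inter> (\<Union>x\<in>I. ball x (\<rho> x / 2)) \<subseteq> X'"
    proof
      fix z assume "z \<in> E \<inter> (\<Union>x\<in>I. ball x (\<rho> x / 2))"
      then obtain x where x: "x \<in> X" "dist x z < \<rho> x / 2" and zE: "z \<in> E" using I(2) by auto
      have "dist p x < r" using x(1) by (simp add: X_def)
      then have "dist p z < 2 * r" using dist_triangle[of p z x] x(2) \<rho>[OF x(1)] by linarith
      moreover have "z \<notin> G" using low[OF x(1), of z] x(2) \<rho>[OF x(1)] by linarith
      ultimately show "z \<in> X'" using zE by (simp add: G_def)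
    qed
    show "(\<Union>x\<in>I. ball x (\<rho> x / 2)) \<in> sets borel"
      by (intro borel_open open_UN ballI open_ball)
  qed simp
  also have "\<dots> \<le> ennreal ((T + K * C) * 6 ^ d * C) * ennreal (a * r ^ d)"
    unfolding X'_def by (intro mult_left_mono small p r) simp
  also have "\<dots> = ennreal ((T + K * C) * (6 ^ d * C * a) * r ^ d)"
    using K0 E(2) T0 a(1) r by (simp add: ennreal_mult[symmetric] ac_simps)
  also have "\<dots> \<le> ennreal ((T + K * C) * (1 / 2) * r ^ d)"
    using K0 E(2) T0 r by (intro ennreal_leI mult_right_mono mult_left_mono a(2)) simp_all
  finally have NX: "emeasure N X \<le> ennreal ((T + K * C) * (1 / 2) * r ^ d)" .
  have pt: "f z * indicator (ball p r) z \<le> f z * indicator X z + ennreal K * indicator (ball p r) z"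
    if z: "z \<in> E" for z
  proof (cases "z \<in> ball p r \<and> z \<notin> X")
    case True
    then have "occ ?A 0 r z \<le> ennreal K" using z by (auto simp: X_def heavy_def)
    moreover have "f z \<le> occ ?A 0 r z" unfolding f_def using \<delta> by (intro occ_mono[OF A]) simp
    ultimately show ?thesis using True by simp
  qed (auto simp: indicator_def)
  have "(\<integral>\<^sup>+x\<in>ball p r. f x \<partial>?M) \<le> (\<integral>\<^sup>+x. f x * indicator X x + ennreal K * indicator (ball p r) x \<partial>?M)"
  proof (rule nn_integral_mono_AE)
    show "AE z in ?M. f z * indicator (ball p r) z \<le> f z * indicator X z + ennreal K * indicator (ball p r) z"
      using AE_surf[OF Eb, of d] by eventually_elim (rule pt)
  qed
  also have "\<dots> = (\<integral>\<^sup>+x\<in>X. f x \<partial>?M) + (\<integral>\<^sup>+x. ennreal K * indicator (ball p r) x \<partial>?M)"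
  proof (rule nn_integral_add)
    have [measurable]: "ball p r \<in> sets borel" by simp
    show "(\<lambda>x. f x * indicator X x) \<in> borel_measurable ?M"
      "(\<lambda>x. ennreal K * indicator (ball p r) x) \<in> borel_measurable ?M" by measurable
  qed
  also have "(\<integral>\<^sup>+x. ennreal K * indicator (ball p r) x \<partial>?M) = ennreal K * emeasure ?M (ball p r)"
    by (rule nn_integral_cmult_indicator) simp
  also have "(\<integral>\<^sup>+x\<in>X. f x \<partial>?M) + ennreal K * emeasure ?M (ball p r)
      \<le> ennreal ((T + K * C) * (1 / 2) * r ^ d) + ennreal K * ennreal (C * r ^ d)"
    using NX[unfolded N[OF sets(1)]] by (intro add_mono mult_left_mono surf_ball_le[OF E(1) p r]) simp_all
  also have "\<dots> = ennreal ((T + K * C) * (1 / 2) * r ^ d + K * (C * r ^ d))"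
    using K0 E(2) T0 r by (simp add: ennreal_mult[symmetric] ennreal_plus[symmetric] del: ennreal_plus)
  \<comment> \<open>With \<open>T = 3 * K * C\<close> the sum \<open>(T + K * C) / 2 + K * C\<close>
    returns exactly \<open>T\<close>, closing the induction.\<close>
  also have "(T + K * C) * (1 / 2) * r ^ d + K * (C * r ^ d) = 3 * K * C * r ^ d"
    by (simp add: T_def algebra_simps)
  finally show ?case by (simp only: f_def)
qed

text \<open>The bound is the same for all cutoffs, so monotone convergence along
  \<open>1 / Suc n\<close> removes them; for each cutoff some power of two spans the range of
  scales.\<close>

lemma carleson_of_truncated:
  fixes E :: "'a::euclidean_space set"
  assumes d: "d \<le> DIM('a)" and cl: "closed E" and \<epsilon>: "0 \<le> \<epsilon>" and r: "0 < r"
    and bound: "\<And>\<delta> k. 0 < \<delta> \<Longrightarrow> r \<le> \<delta> * 2 ^ k \<Longrightarrow>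
      (\<integral>\<^sup>+x\<in>ball p r. occ (bad_set d E \<epsilon>) \<delta> r x \<partial>surf d E) \<le> T"
  shows "(\<integral>\<^sup>+x\<in>ball p r. occ (bad_set d E \<epsilon>) 0 r x \<partial>surf d E) \<le> T"
proof -
  let ?A = "bad_set d E \<epsilon>"
  have A [measurable]: "?A \<in> sets borel" by (rule bad_set_borel[OF cl d \<epsilon>])
  have [measurable]: "ball p r \<in> sets borel" by simp
  let ?g = "\<lambda>n x. occ ?A (1 / real (Suc n)) r x * indicator (ball p r) x"
  have "(\<integral>\<^sup>+x\<in>ball p r. occ ?A 0 r x \<partial>surf d E) = (\<integral>\<^sup>+x. (SUP n. ?g n x) \<partial>surf d E)"
  proof (intro nn_integral_cong)
    fix x
    show "occ ?A 0 r x * indicator (ball p r) x = (SUP n. ?g n x)"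
      by (subst occ_0_SUP[OF A bad_set_pos]) (simp_all add: SUP_mult_right_ennreal)
  qed
  also have "\<dots> = (SUP n. \<integral>\<^sup>+x. ?g n x \<partial>surf d E)"
  proof (rule nn_integral_monotone_convergence_SUP)
    show "incseq ?g"
    proof (intro incseq_SucI le_funI mult_right_mono)
      fix n x
      have "1 / real (Suc (Suc n)) \<le> 1 / real (Suc n)" by (intro divide_left_mono) auto
      then show "occ ?A (1 / real (Suc n)) r x \<le> occ ?A (1 / real (Suc (Suc n))) r x"
        by (intro occ_mono[OF A]) linarith
    qed simp
  qed measurable
  also have "\<dots> \<le> T"
  proof (rule SUP_least)
    fix n :: nat
    obtain k where "r * real (Suc n) < 2 ^ k" using real_arch_pow[of 2] by auto
    then have "r \<le> 1 / real (Suc n) * 2 ^ k" by (simp add: field_simps)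
    then show "(\<integral>\<^sup>+x. ?g n x \<partial>surf d E) \<le> T" by (intro bound) simp_all
  qed
  finally show ?thesis .
qed

text \<open>Starting from \<open>\<epsilon> / 2\<close>, \<open>m\<close> decay steps make the heavy
  set small against the constant \<open>6 ^ d * C\<close> of the covering argument. All choices,
  including the constant \<open>3 * K * C\<close>, precede \<open>E\<close>.\<close>

lemma good_pieces_carleson:
  fixes C c \<epsilon> :: real and \<kappa> :: "real \<Rightarrow> real"
  assumes d: "d \<le> DIM('a::euclidean_space)" and C: "1 \<le> C" and c: "0 < c" and \<epsilon>: "\<epsilon> \<in> {0<..<1}"
  shows "\<exists>\<gamma>>0. \<forall>E :: 'a set. ahlfors_regular d C E \<longrightarrow> good_pieces d c \<kappa> E \<longrightarrow>
    carleson_set d \<gamma> E (bad_set d E \<epsilon>)"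
proof -
  define b where "b = C * 6 ^ d / c"
  have b0: "0 < b" using C c by (simp add: b_def)
  define q where "q = b / (1 + b)"
  have q: "0 \<le> q" "q < 1" using b0 by (simp_all add: q_def)
  have pos: "0 < 2 * (6 ^ d * C) * (C * 3 ^ d)" using C by simp
  then obtain m where m: "q ^ m < 1 / (2 * (6 ^ d * C) * (C * 3 ^ d))"
    using real_arch_pow_inv[OF _ q(2), of "1 / (2 * (6 ^ d * C) * (C * 3 ^ d))"] by auto
  \<comment> \<open>\<open>C * 3 ^ d\<close> bounds the measure of a ball of radius
    \<open>3 * r\<close>, in units of \<open>r ^ d\<close>; the choice of \<open>m\<close> makes
    \<open>6 ^ d * C * a\<close> at most one half.\<close>
  define a where "a = q ^ m * (C * 3 ^ d)"
  have a0: "0 \<le> a" using q C by (simp add: a_def)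
  have "q ^ m * (2 * (6 ^ d * C) * (C * 3 ^ d)) < 1"
    using m pos by (simp add: pos_less_divide_eq)
  then have a: "6 ^ d * C * a \<le> 1 / 2" by (simp add: a_def algebra_simps)
  \<comment> \<open>With this step size, \<open>m\<close> enlargements add at most \<open>r\<close>,
    so the ball of radius \<open>2 * r\<close> grows to at most \<open>3 * r\<close>.\<close>
  define \<eta> where "\<eta> = 1 / (1 + real m)"
  have \<eta>: "0 < \<eta>" "\<eta> \<le> 1" "real m * \<eta> \<le> 1" by (simp_all add: \<eta>_def)
  have "\<epsilon> / 2 \<in> {0<..<1}" using \<epsilon> by simp
  from heavy_decay[OF d C c \<eta>(1,2) b_def this, of \<kappa> m] obtain L where L: "0 \<le> L"
    and decay: "\<And>(E :: 'a set) p t r. ahlfors_regular d C E \<Longrightarrow> good_pieces d c \<kappa> E \<Longrightarrow> 0 < r \<Longrightarrow>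
      emeasure (surf d E) (heavy d E (\<epsilon> / 2) L r \<inter> ball p t)
      \<le> ennreal (q ^ m) * emeasure (surf d E) (ball p (t + real m * \<eta> * r))"
    unfolding q_def by blast
  define K where "K = L + ln 2 + ln 2"
  have "0 < ln (2::real)" by simp
  then have K0: "0 < K" using L unfolding K_def by linarith
  show ?thesis
  proof (intro exI[of _ "3 * K * C"] conjI allI impI)
    show "0 < 3 * K * C" using K0 C by simp
    fix E :: "'a set"
    assume E: "ahlfors_regular d C E" and good: "good_pieces d c \<kappa> E"
    have cl: "closed E" by (rule ahlfors_regular_closed[OF E])
    have small: "emeasure (surf d E) (heavy d E (\<epsilon> / 2) L r \<inter> ball p (2 * r)) \<le> ennreal (a * r ^ d)"
      if p: "p \<in> E" and r: "0 < r" for p r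
    proof -
      have "real m * \<eta> * r \<le> r" using \<eta>(3) r by (simp add: mult_left_le_one_le)
      then have "ball p (2 * r + real m * \<eta> * r) \<subseteq> ball p (3 * r)" by (intro subset_ball) simp
      then have "emeasure (surf d E) (ball p (2 * r + real m * \<eta> * r)) \<le> emeasure (surf d E) (ball p (3 * r))"
        by (intro emeasure_mono) simp_all
      also have "\<dots> \<le> ennreal (C * (3 * r) ^ d)" using r by (intro surf_ball_le[OF E p]) simp
      finally have "ennreal (q ^ m) * emeasure (surf d E) (ball p (2 * r + real m * \<eta> * r))
          \<le> ennreal (q ^ m) * ennreal (C * (3 * r) ^ d)" by (rule mult_left_mono) simp
      also have "\<dots> = ennreal (q ^ m * (C * (3 * r) ^ d))"
        using q C r by (intro ennreal_mult[symmetric]) simp_all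
      also have "q ^ m * (C * (3 * r) ^ d) = a * r ^ d" by (simp add: a_def power_mult_distrib)
      finally show ?thesis by (rule order_trans[OF decay[OF E good r]])
    qed
    have "(\<integral>\<^sup>+x\<in>ball p r. occ (bad_set d E \<epsilon>) 0 r x \<partial>surf d E) \<le> ennreal (3 * K * C * r ^ d)"
      if p: "p \<in> E" and r: "0 < r" for p r
    proof (rule carleson_of_truncated[OF d cl _ r])
      fix \<delta> :: real and k assume "0 < \<delta>" "r \<le> \<delta> * 2 ^ k"
      then show "(\<integral>\<^sup>+x\<in>ball p r. occ (bad_set d E \<epsilon>) \<delta> r x \<partial>surf d E) \<le> ennreal (3 * K * C * r ^ d)"
        by (intro truncated_carleson[OF d E C \<epsilon> L a0 a small _ K_def p r])
    qed (use \<epsilon> in simp)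
    moreover have "bad_set d E \<epsilon> \<subseteq> E \<times> {0<..}" by (auto simp: bad_set_def)
    moreover have "bad_set d E \<epsilon> \<in> sets borel" using \<epsilon> by (intro bad_set_borel[OF cl d]) simp
    ultimately show "carleson_set d (3 * K * C) E (bad_set d E \<epsilon>)"
      unfolding carleson_set_iff[OF E] by blast
  qed
qed

theorem theorem4p19:
  fixes d :: nat and C \<theta> C\<^sub>1 :: real and \<gamma>\<^sub>1 :: "real \<Rightarrow> real"
  assumes "0 < d" and "d < CARD('n::finite)"
    and "1 \<le> C" and "0 < \<theta>" and "1 \<le> C\<^sub>1"
    and "\<forall>\<epsilon>\<in>{0<..<1}. 0 < \<gamma>\<^sub>1 \<epsilon>"
  shows "\<exists>\<gamma> :: real \<Rightarrow> real. (\<forall>\<epsilon>\<in>{0<..<1}. 0 < \<gamma> \<epsilon>) \<and>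
    (\<forall>E :: (real ^ 'n) set.
       ahlfors_regular d C E \<longrightarrow>
       (\<forall>p\<in>E. \<forall>r>0. \<exists>E' :: (real ^ 'n) set.
          ahlfors_regular d C\<^sub>1 E' \<and>
          (\<forall>\<epsilon>\<in>{0<..<1}. carleson_set d (\<gamma>\<^sub>1 \<epsilon>) E' (bad_set d E' \<epsilon>)) \<and>
          ennreal (\<theta> * r ^ d) \<le> emeasure (hausdorff_measure d) (E \<inter> E' \<inter> ball p r)) \<longrightarrow>
       bilateral_weak_geometric_lemma d E \<and>
       (\<forall>\<epsilon>\<in>{0<..<1}. carleson_set d (\<gamma> \<epsilon>) E (bad_set d E \<epsilon>)))"
proof -
  have d: "d \<le> DIM(real ^ 'n)" using assms(2) by simp
  \<comment> \<open>\<open>\<kappa>\<close> involves only \<open>d\<close>, \<open>C\<close>,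
    \<open>\<theta>\<close>, \<open>C\<^sub>1\<close> and \<open>\<gamma>\<^sub>1\<close>, so that
    \<open>\<gamma>\<close> can be chosen before any \<open>E\<close> is given.\<close>
  define \<kappa> where "\<kappa> \<epsilon> = 2 * ((\<gamma>\<^sub>1 (\<epsilon> / 12) + (far_const d C (\<epsilon> / 12) + far_const d C\<^sub>1 (\<epsilon> / 12))) * 2 ^ d) / \<theta>" for \<epsilon>
  have "0 < \<theta> / 2" using assms(4) by simp
  from good_pieces_carleson[OF d assms(3) this, of _ \<kappa>]
  obtain \<gamma> where \<gamma>: "\<And>\<epsilon>. \<epsilon> \<in> {0<..<1} \<Longrightarrow> 0 < \<gamma> \<epsilon> \<and> (\<forall>E :: (real ^ 'n) set. ahlfors_regular d C E \<longrightarrow>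
      good_pieces d (\<theta> / 2) \<kappa> E \<longrightarrow> carleson_set d (\<gamma> \<epsilon>) E (bad_set d E \<epsilon>))"
    by metis
  show ?thesis
  proof (intro exI[of _ \<gamma>] conjI allI impI)
    show pos: "\<forall>\<epsilon>\<in>{0<..<1}. 0 < \<gamma> \<epsilon>" using \<gamma> by blast
    fix E :: "(real ^ 'n) set"
    assume E: "ahlfors_regular d C E" and big: "\<forall>p\<in>E. \<forall>r>0. \<exists>E' :: (real ^ 'n) set.
          ahlfors_regular d C\<^sub>1 E' \<and>
          (\<forall>\<epsilon>\<in>{0<..<1}. carleson_set d (\<gamma>\<^sub>1 \<epsilon>) E' (bad_set d E' \<epsilon>)) \<and>
          ennreal (\<theta> * r ^ d) \<le> emeasure (hausdorff_measure d) (E \<inter> E' \<inter> ball p r)"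
    have "good_pieces d (\<theta> / 2) \<kappa> E"
      unfolding \<kappa>_def[abs_def]
      by (rule good_pieces_of_big_pieces[OF d E assms(3,5,4)]) (use assms(6) big in blast)+
    with \<gamma> E show car: "\<forall>\<epsilon>\<in>{0<..<1}. carleson_set d (\<gamma> \<epsilon>) E (bad_set d E \<epsilon>)" by blast
    show "bilateral_weak_geometric_lemma d E"
      unfolding bilateral_weak_geometric_lemma_def using E assms(3) pos car by blast
  qed
qed

end
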